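(* Let $\mathbf Y\in\mathscr C^{0,\alpha,1}$ and let $(Q(\cdot;\mathbf Y),R(\cdot;\mathbf Y)):[0,T]\to(\mathbb R^{d_X}\otimes\mathbb R^{d_X})\times(\mathbb R^{d_Y}\otimes\mathbb R^{d_Y})$ be locally bounded and measurable, with $Q(t;\mathbf Y),R(t;\mathbf Y)\succeq0$ for any $t$. Let $v_0^{\mathbf Y}\in\mathbb R^{d_X}\otimes\mathbb R^{d_X}$ be symmetric and positive semi-definite. Assume $[t\mapsto(F(t;\mathbf Y),F'(t;\mathbf Y))]\in\mathscr D_Y^{2\alpha}$, and that the other coefficients $C(\cdot;\mathbf Y):[0,T]\to\mathbb R^{d_X\times d_X}$, $H(\cdot;\mathbf Y):[0,T]\to\mathbb R^{d_Y\times d_X}$ are locally bounded and measurable in time. Then the (Riccati) rough differential equation $$dv_t^{\mathbf Y}=\Big(C(t;\mathbf Y)v_t^{\mathbf Y}+v_t^{\mathbf Y}C(t;\mathbf Y)^\top+Q(t;\mathbf Y)+\sum_{\kappa,\lambda=1}^{d_Y}F_\kappa(t;\mathbf Y)v_t^{\mathbf Y}F_\lambda(t;\mathbf Y)^\top\dot{[\mathbf Y]}_t^{\kappa\lambda}-v_t^{\mathbf Y}H(t;\mathbf Y)^\top R(t;\mathbf Y)H(t;\mathbf Y)v_t^{\mathbf Y}\Big)dt+\sum_{\kappa=1}^{d_Y}\big(F_\kappa(t;\mathbf Y)v_t^{\mathbf Y}+v_t^{\mathbf Y}F_\kappa(t;\mathbf Y)^\top\big)d\mathbf Y_t^\kappa$$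 started from $v_0^{\mathbf Y}$ has a global solution on $[0,T]$, and $v_t^{\mathbf Y}\succeq0$ for all $t$. Moreover, the solution is locally Lipschitz in its data, notably with respect to $\mathbf Y\in\mathscr C^{0,\alpha,1}$ and $(F,F')\in\mathscr D_Y^{2\alpha}$.
   Context: **Rough paths.** Fix $T>0$, $\alpha\in(1/3,1/2]$. An $\alpha$-Hölder rough path over $\mathbb R^{d_Y}$ is $\mathbf Y=(Y,\mathbb Y)$ with Chen's relation $\mathbb Y_{s,t}=\mathbb Y_{s,u}+\mathbb Y_{u,t}+\delta Y_{s,u}\otimes\delta Y_{u,t}$ and $|\delta Y|_\alpha+|\mathbb Y|_{2\alpha}<\infty$, $\delta Y_{s,t}=Y_t-Y_s$, $|\Xi|_\gamma=\sup_{s<t}|\Xi_{s,t}|/|t-s|^\gamma$; $\rho_\alpha(\mathbf Y,\bar{\mathbf Y})=|\delta Y-\delta\bar Y|_\alpha+|\mathbb Y-\bar{\mathbb Y}|_{2\alpha}$. Bracket: $\delta Y\otimes\delta Y=\mathbb Y+\mathbb Y^\top+\delta[\mathbf Y]$. $\mathscr C^{0,\alpha,1}$: rough paths in the $\rho_\alpha$-closure of smooth rough paths (smooth pairs satisfying Chen's relation) with $C^1$ bracket; $\dot{[\mathbf Y]}=d[\mathbf Y]/dt$. With $\mathbf Y^\circ=(Y,\mathbb Y+\frac12\delta[\mathbf Y])$, this space carries the metric $\rho_{\alpha,1}(\mathbf Y,\bar{\mathbf Y})=\rho_\alpha(\mathbf Y^\circ,\bar{\mathbf Y}^\circ)+|[\mathbf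 Y]-[\bar{\mathbf Y}]|_{Lip}$, $|g|_{Lip}=\sup_{s<t}|\delta g_{s,t}|/|t-s|$. **Notation.** $M\succeq0$ means $M$ is a symmetric positive semi-definite matrix. $F(t;\mathbf Y)=(F_\kappa(t;\mathbf Y))_{\kappa=1}^{d_Y}$ with $F_\kappa\in\mathbb R^{d_X\times d_X}$, $F'=(F'_{\kappa\lambda})$ with $F'_{\kappa\lambda}\in\mathbb R^{d_X\times d_X}$; $(F,F')\in\mathscr D_Y^{2\alpha}$ (controlled rough path) means $F,F'$ are bounded with $|\delta F|_\alpha+|\delta F'|_\alpha+|R^F|_{2\alpha}<\infty$, $(R^F_{s,t})_\kappa=F_\kappa(t)-F_\kappa(s)-\sum_\lambda F'_{\kappa\lambda}(s)\delta Y^\lambda_{s,t}$; the distance between $(F,F')\in\mathscr D_Y^{2\alpha}$ and $(\bar F,\bar F')\in\mathscr D_{\bar Y}^{2\alpha}$ is $|F_0-\bar F_0|+|F'_0-\bar F'_0|+|\delta F'-\delta\bar F'|_\alpha+|R^F-\bar R^{\bar F}|_{2\alpha}$. **Solution.** With $g_\kappa(t,v)=F_\kappa(t)v+vF_\kappa(t)^\top$ and $g'_{\kappa\lambda}(t,v)=F'_{\kappa\lambda}(t)v+vF'_{\kappa\lambda}(t)^\top$, a solution is a continuous path $v$ such that, for $s\le t$, $\delta v_{s,t}=\int_s^t(\text{drift at }r)\,dr+\sum_\kappa g_\kappa(s,v_s)\delta Y^\kappa_{s,t}+\sum_{\kappa,\lambda}\big(D_vg_\lambda(s,v_s)[g_\kappa(s,v_s)]+g'_{\lambda\kappa}(s,v_s)\big)\mathbb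 Y^{\kappa\lambda}_{s,t}+o(|t-s|)$, where the drift is the $dt$-coefficient in the equation (equivalently, $v$ is controlled by $Y$ and the equation holds with a rough integral). "Locally Lipschitz in its data" refers to dependence of $v$ (in supremum norm) on $v_0$, on $\mathbf Y$ (in $\rho_{\alpha,1}$), on $(F,F')$ (in the distance $|F_0-\bar F_0|+|F'_0-\bar F'_0|+|\delta F'-\delta\bar F'|_\alpha+|R^F-\bar R^{\bar F}|_{2\alpha}$ between $(F,F')\in\mathscr D_Y^{2\alpha}$ and $(\bar F,\bar F')\in\mathscr D_{\bar Y}^{2\alpha}$) and on $C,H,Q,R$ (in supremum norm). *)

theory Defs
  imports "HOL-Analysis.Analysis"
begin

definition tensor :: "real^'n \<Rightarrow> real^'m \<Rightarrow> real^'m^'n" where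
  "tensor a b = (\<chi> i j. a $ i * b $ j)"

definition incr :: "(real \<Rightarrow> 'a::real_normed_vector) \<Rightarrow> real \<Rightarrow> real \<Rightarrow> 'a" where
  "incr f s t = f t - f s"

text \<open>The supremum of reals below is only meaningful on functions satisfying \<open>holder_finite\<close>;
  it is only ever applied to such functions under the hypotheses of the theorem.\<close>

definition holder_quotients ::
    "real \<Rightarrow> real \<Rightarrow> (real \<Rightarrow> real \<Rightarrow> 'a::real_normed_vector) \<Rightarrow> real set" where
  "holder_quotients T \<gamma> \<Xi> = {norm (\<Xi> s t) / (t - s) powr \<gamma> | s t. 0 \<le> s \<and> s < t \<and> t \<le> T}"

definition holder_finite ::
    "real \<Rightarrow> real \<Rightarrow> (real \<Rightarrow> real \<Rightarrow> 'a::real_normed_vector) \<Rightarrow> bool" where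
  "holder_finite T \<gamma> \<Xi> \<longleftrightarrow> bdd_above (holder_quotients T \<gamma> \<Xi>)"

definition holder_seminorm ::
    "real \<Rightarrow> real \<Rightarrow> (real \<Rightarrow> real \<Rightarrow> 'a::real_normed_vector) \<Rightarrow> real" where
  "holder_seminorm T \<gamma> \<Xi> = Sup (holder_quotients T \<gamma> \<Xi>)"

definition sup_norm :: "real \<Rightarrow> (real \<Rightarrow> 'a::real_normed_vector) \<Rightarrow> real" where
  "sup_norm T f = (SUP t\<in>{0..T}. norm (f t))"

text \<open>First component: the path; second component: the second level, of which only the values
  at \<open>0 \<le> s \<le> t \<le> T\<close> matter.\<close>

type_synonym 'y rpath = "(real \<Rightarrow> real^'y) \<times> (real \<Rightarrow> real \<Rightarrow> real^'y^'y)"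

definition chen :: "real \<Rightarrow> ('y::finite) rpath \<Rightarrow> bool" where
  "chen T Y \<longleftrightarrow> (\<forall>s u t. 0 \<le> s \<and> s \<le> u \<and> u \<le> t \<and> t \<le> T \<longrightarrow>
     snd Y s t = snd Y s u + snd Y u t + tensor (incr (fst Y) s u) (incr (fst Y) u t))"

definition rough_path :: "real \<Rightarrow> real \<Rightarrow> ('y::finite) rpath \<Rightarrow> bool" where
  "rough_path T \<alpha> Y \<longleftrightarrow>
     chen T Y \<and> holder_finite T \<alpha> (incr (fst Y)) \<and> holder_finite T (2 * \<alpha>) (snd Y)"

definition rho :: "real \<Rightarrow> real \<Rightarrow> ('y::finite) rpath \<Rightarrow> 'y rpath \<Rightarrow> real" where
  "rho T \<alpha> Y Z =
     holder_seminorm T \<alpha> (\<lambda>s t. incr (fst Y) s t - incr (fst Z) s t)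
   + holder_seminorm T (2 * \<alpha>) (\<lambda>s t. snd Y s t - snd Z s t)"

text \<open>The bracket is determined by its increments up to an additive constant, which is
  normalised by \<open>[Y]\<^sub>0 = 0\<close>; see \<open>bracket_incr\<close>.\<close>

definition bracket :: "('y::finite) rpath \<Rightarrow> real \<Rightarrow> real^'y^'y" where
  "bracket Y t =
     tensor (incr (fst Y) 0 t) (incr (fst Y) 0 t) - snd Y 0 t - transpose (snd Y 0 t)"

lemma bracket_incr:
  assumes "chen T Y" "0 \<le> s" "s \<le> t" "t \<le> T"
  shows "tensor (incr (fst Y) s t) (incr (fst Y) s t)
       = snd Y s t + transpose (snd Y s t) + incr (bracket Y) s t"
proof -
  have "snd Y 0 t = snd Y 0 s + snd Y s t + tensor (incr (fst Y) 0 s) (incr (fst Y) s t)"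
    using assms unfolding chen_def by (metis order_refl)
  then have c: "snd Y 0 t $ i $ j = snd Y 0 s $ i $ j + snd Y s t $ i $ j
      + (fst Y s $ i - fst Y 0 $ i) * (fst Y t $ j - fst Y s $ j)" for i j
    by (simp add: incr_def tensor_def)
  show ?thesis
    by (simp add: incr_def bracket_def tensor_def vec_eq_iff transpose_def c algebra_simps)
qed

definition C1_on_interval :: "real \<Rightarrow> (real \<Rightarrow> 'a::real_normed_vector) \<Rightarrow> bool" where
  "C1_on_interval T f \<longleftrightarrow> (\<exists>D. continuous_on {0..T} D \<and>
     (\<forall>t\<in>{0..T}. (f has_vector_derivative D t) (at t within {0..T})))"

definition smooth_on_interval :: "real \<Rightarrow> real \<Rightarrow> (real \<Rightarrow> 'a::real_normed_vector) \<Rightarrow> bool" where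
  "smooth_on_interval a b f \<longleftrightarrow> (\<exists>D :: nat \<Rightarrow> real \<Rightarrow> 'a. D 0 = f \<and>
     (\<forall>n. \<forall>t\<in>{a..b}. (D n has_vector_derivative D (Suc n) t) (at t within {a..b})))"

definition smooth_rough_path :: "real \<Rightarrow> ('y::finite) rpath \<Rightarrow> bool" where
  "smooth_rough_path T Y \<longleftrightarrow> chen T Y \<and> smooth_on_interval 0 T (fst Y) \<and>
     (\<forall>s. 0 \<le> s \<and> s < T \<longrightarrow> smooth_on_interval s T (snd Y s))"

definition rough_path_C01 :: "real \<Rightarrow> real \<Rightarrow> ('y::finite) rpath \<Rightarrow> bool" where
  "rough_path_C01 T \<alpha> Y \<longleftrightarrow> rough_path T \<alpha> Y \<and>
     (\<forall>\<epsilon>>0. \<exists>Z. smooth_rough_path T Z \<and> rho T \<alpha> Y Z < \<epsilon>) \<and>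
     C1_on_interval T (bracket Y)"

definition circ :: "('y::finite) rpath \<Rightarrow> 'y rpath" where
  "circ Y = (fst Y, \<lambda>s t. snd Y s t + (1/2) *\<^sub>R incr (bracket Y) s t)"

definition lip_seminorm :: "real \<Rightarrow> (real \<Rightarrow> 'a::real_normed_vector) \<Rightarrow> real" where
  "lip_seminorm T g = holder_seminorm T 1 (incr g)"

definition rho1 :: "real \<Rightarrow> real \<Rightarrow> ('y::finite) rpath \<Rightarrow> 'y rpath \<Rightarrow> real" where
  "rho1 T \<alpha> Y Z = rho T \<alpha> (circ Y) (circ Z) + lip_seminorm T (\<lambda>t. bracket Y t - bracket Z t)"

text \<open>The component \<open>F t $ \<kappa>\<close> is the matrix \<open>F\<^sub>\<kappa>(t)\<close>, and \<open>F' t $ \<kappa> $ \<mu>\<close> is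
  \<open>F'\<^sub>\<kappa>\<^sub>\<mu>(t)\<close>.\<close>

definition ctrl_remainder ::
    "(real \<Rightarrow> real^'y) \<Rightarrow> (real \<Rightarrow> real^'x^'x^'y) \<Rightarrow> (real \<Rightarrow> real^'x^'x^'y^'y) \<Rightarrow>
     real \<Rightarrow> real \<Rightarrow> real^'x^'x^'y" where
  "ctrl_remainder Y F F' s t =
     (\<chi> \<kappa>. F t $ \<kappa> - F s $ \<kappa> - (\<Sum>\<mu>\<in>UNIV. (incr Y s t $ \<mu>) *\<^sub>R (F' s $ \<kappa> $ \<mu>)))"

definition controlled ::
    "real \<Rightarrow> real \<Rightarrow> (real \<Rightarrow> real^'y) \<Rightarrow> (real \<Rightarrow> real^'x^'x^'y) \<Rightarrow> (real \<Rightarrow> real^'x^'x^'y^'y) \<Rightarrow> bool"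
  where
  "controlled T \<alpha> Y F F' \<longleftrightarrow>
     bounded (F ` {0..T}) \<and> bounded (F' ` {0..T}) \<and>
     holder_finite T \<alpha> (incr F) \<and> holder_finite T \<alpha> (incr F') \<and>
     holder_finite T (2 * \<alpha>) (ctrl_remainder Y F F')"

definition ctrl_dist ::
    "real \<Rightarrow> real \<Rightarrow> (real \<Rightarrow> real^'y) \<Rightarrow> (real \<Rightarrow> real^'x^'x^'y) \<Rightarrow> (real \<Rightarrow> real^'x^'x^'y^'y) \<Rightarrow>
     (real \<Rightarrow> real^'y) \<Rightarrow> (real \<Rightarrow> real^'x^'x^'y) \<Rightarrow> (real \<Rightarrow> real^'x^'x^'y^'y) \<Rightarrow> real" where
  "ctrl_dist T \<alpha> Y F F' Z G G' =
     norm (F 0 - G 0) + norm (F' 0 - G' 0)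
   + holder_seminorm T \<alpha> (\<lambda>s t. incr F' s t - incr G' s t)
   + holder_seminorm T (2 * \<alpha>) (\<lambda>s t. ctrl_remainder Y F F' s t - ctrl_remainder Z G G' s t)"

definition psd :: "real^'n^'n \<Rightarrow> bool" where
  "psd M \<longleftrightarrow> transpose M = M \<and> (\<forall>x. 0 \<le> x \<bullet> (M *v x))"

definition locally_bounded_on ::
    "'a::topological_space set \<Rightarrow> ('a \<Rightarrow> 'b::metric_space) \<Rightarrow> bool" where
  "locally_bounded_on S f \<longleftrightarrow> (\<forall>x\<in>S. \<exists>U. open U \<and> x \<in> U \<and> bounded (f ` (U \<inter> S)))"

text \<open>The type variable \<open>'x\<close> indexes the coordinates of the state space and \<open>'y\<close> those of
  the driving path, so \<open>dat_H\<close> takes values in matrices with rows \<open>'y\<close> and columns \<open>'x\<close>.\<close>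

record ('x, 'y) riccati_data =
  dat_Y :: "('y::finite) rpath"
  dat_F :: "real \<Rightarrow> real^('x::finite)^'x^'y"
  dat_F' :: "real \<Rightarrow> real^'x^'x^'y^'y"
  dat_C :: "real \<Rightarrow> real^'x^'x"
  dat_H :: "real \<Rightarrow> real^'x^'y"
  dat_Q :: "real \<Rightarrow> real^'x^'x"
  dat_R :: "real \<Rightarrow> real^'y^'y"
  dat_v0 :: "real^'x^'x"

definition coeff_ok :: "real \<Rightarrow> (real \<Rightarrow> 'a::euclidean_space) \<Rightarrow> bool" where
  "coeff_ok T f \<longleftrightarrow> locally_bounded_on {0..T} f \<and> f \<in> borel_measurable (lebesgue_on {0..T})"

definition admissible :: "real \<Rightarrow> real \<Rightarrow> ('x::finite, 'y::finite) riccati_data \<Rightarrow> bool" where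
  "admissible T \<alpha> D \<longleftrightarrow>
     rough_path_C01 T \<alpha> (dat_Y D) \<and>
     coeff_ok T (dat_Q D) \<and> coeff_ok T (dat_R D) \<and>
     (\<forall>t\<in>{0..T}. psd (dat_Q D t) \<and> psd (dat_R D t)) \<and>
     psd (dat_v0 D) \<and>
     controlled T \<alpha> (fst (dat_Y D)) (dat_F D) (dat_F' D) \<and>
     coeff_ok T (dat_C D) \<and> coeff_ok T (dat_H D)"

definition sym_mult :: "real^'x^'x \<Rightarrow> real^'x^'x \<Rightarrow> real^'x^'x" where
  "sym_mult A v = A ** v + v ** transpose A"

definition riccati_g ::
    "('x::finite, 'y::finite) riccati_data \<Rightarrow> 'y \<Rightarrow> real \<Rightarrow> real^'x^'x \<Rightarrow> real^'x^'x" where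
  "riccati_g D \<kappa> t v = sym_mult (dat_F D t $ \<kappa>) v"

definition riccati_g' ::
    "('x::finite, 'y::finite) riccati_data \<Rightarrow> 'y \<Rightarrow> 'y \<Rightarrow> real \<Rightarrow> real^'x^'x \<Rightarrow> real^'x^'x" where
  "riccati_g' D \<kappa> \<mu> t v = sym_mult (dat_F' D t $ \<kappa> $ \<mu>) v"

lemma frechet_derivative_riccati_g:
  "frechet_derivative (riccati_g D \<kappa> t) (at v) = riccati_g D \<kappa> t"
proof -
  have "linear (riccati_g D \<kappa> t)"
    by (rule linearI)
      (simp_all add: riccati_g_def sym_mult_def matrix_matrix_mult_def vec_eq_iff
        algebra_simps sum.distrib sum_distrib_left)
  then have "(riccati_g D \<kappa> t has_derivative riccati_g D \<kappa> t) (at v)"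
    by (simp add: linear_imp_has_derivative)
  then show ?thesis
    by (metis frechet_derivative_at)
qed

definition riccati_drift ::
    "real \<Rightarrow> ('x::finite, 'y::finite) riccati_data \<Rightarrow> real \<Rightarrow> real^'x^'x \<Rightarrow> real^'x^'x" where
  "riccati_drift T D t v =
     dat_C D t ** v + v ** transpose (dat_C D t) + dat_Q D t
   + (\<Sum>\<kappa>\<in>UNIV. \<Sum>\<mu>\<in>UNIV.
        (vector_derivative (bracket (dat_Y D)) (at t within {0..T}) $ \<kappa> $ \<mu>) *\<^sub>R
        (dat_F D t $ \<kappa> ** v ** transpose (dat_F D t $ \<mu>)))
   - v ** transpose (dat_H D t) ** dat_R D t ** dat_H D t ** v"

definition riccati_remainder ::
    "real \<Rightarrow> ('x::finite, 'y::finite) riccati_data \<Rightarrow> (real \<Rightarrow> real^'x^'x) \<Rightarrow>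
     real \<Rightarrow> real \<Rightarrow> real^'x^'x" where
  "riccati_remainder T D v s t =
     incr v s t
   - integral {s..t} (\<lambda>r. riccati_drift T D r (v r))
   - (\<Sum>\<kappa>\<in>UNIV. (incr (fst (dat_Y D)) s t $ \<kappa>) *\<^sub>R riccati_g D \<kappa> s (v s))
   - (\<Sum>\<kappa>\<in>UNIV. \<Sum>\<mu>\<in>UNIV. (snd (dat_Y D) s t $ \<kappa> $ \<mu>) *\<^sub>R
        (frechet_derivative (riccati_g D \<mu> s) (at (v s)) (riccati_g D \<kappa> s (v s))
         + riccati_g' D \<mu> \<kappa> s (v s)))"

text \<open>As usual for solutions in the sense of Davie, the remainder is \<open>o(|t - s|)\<close> uniformly
  over \<open>0 \<le> s \<le> t \<le> T\<close>.\<close>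

definition riccati_solution ::
    "real \<Rightarrow> ('x::finite, 'y::finite) riccati_data \<Rightarrow> (real \<Rightarrow> real^'x^'x) \<Rightarrow> bool" where
  "riccati_solution T D v \<longleftrightarrow>
     continuous_on {0..T} v \<and> v 0 = dat_v0 D \<and>
     (\<lambda>r. riccati_drift T D r (v r)) absolutely_integrable_on {0..T} \<and>
     (\<forall>\<epsilon>>0. \<exists>\<delta>>0. \<forall>s t. 0 \<le> s \<and> s \<le> t \<and> t \<le> T \<and> t - s < \<delta> \<longrightarrow>
        norm (riccati_remainder T D v s t) \<le> \<epsilon> * (t - s))"

definition data_dist ::
    "real \<Rightarrow> real \<Rightarrow> ('x::finite, 'y::finite) riccati_data \<Rightarrow> ('x, 'y) riccati_data \<Rightarrow> real" where
  "data_dist T \<alpha> D E =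
     norm (dat_v0 D - dat_v0 E)
   + rho1 T \<alpha> (dat_Y D) (dat_Y E)
   + ctrl_dist T \<alpha> (fst (dat_Y D)) (dat_F D) (dat_F' D) (fst (dat_Y E)) (dat_F E) (dat_F' E)
   + sup_norm T (\<lambda>t. dat_C D t - dat_C E t)
   + sup_norm T (\<lambda>t. dat_H D t - dat_H E t)
   + sup_norm T (\<lambda>t. dat_Q D t - dat_Q E t)
   + sup_norm T (\<lambda>t. dat_R D t - dat_R E t)"

end

theory Submission
  imports Defs
begin

text \<open>
  The Riccati equation is reduced to an ordinary one. Let \<open>\<Phi>\<close> solve the linear rough equation
  \<open>d\<Phi> = C \<Phi> dt + F\<^sub>\<kappa> \<Phi> d\<^bold>Y\<^sup>\<kappa>\<close>, \<open>\<Phi>\<^sub>0 = 1\<close>. Since the product \<open>\<Phi> w \<Phi>\<^sup>T\<close> produces exactly the bracket term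
  \<open>F\<^sub>\<kappa> v F\<^sub>\<lambda>\<^sup>T d[\<^bold>Y]\<^sup>\<kappa>\<^sup>\<lambda>\<close>, a path \<open>v = \<Phi> w \<Phi>\<^sup>T\<close> solves the rough equation if and only if \<open>w\<close> solves
  \<open>w' = q - w S w\<close> with \<open>q = \<Phi>\<^sup>-\<^sup>1 Q \<Phi>\<^sup>-\<^sup>T\<close> and \<open>S = \<Phi>\<^sup>T H\<^sup>T R H \<Phi>\<close> positive semi-definite. This equation is
  linearised by a Hamiltonian system, which gives global existence and positivity; positivity bounds
  \<open>w\<close> by \<open>w\<^sub>0 + \<integral>q\<close>, so Gronwall's inequality gives uniqueness and Lipschitz dependence. The flow \<open>\<Phi>\<close>
  comes from Davie's estimate for Euler schemes on arbitrary finite partitions and Tychonoff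
  compactness, and depends on the data in a locally Lipschitz way by a rough Gronwall inequality.
\<close>

section \<open>Families of increments, bounded and Lipschitz in the data\<close>

text \<open>The obstacle is the quadratic term: it leaves the rough equation without a direct a
  priori bound, and the positivity that rescues the ordinary Riccati equation is invisible in a
  rough expansion. So all roughness is moved into a linear equation, whose errors are measured
  relative to the norm of the starting vector. Lipschitz dependence is not a separate argument.
  Every estimate is made for a whole family indexed by a ball of data, as a bound and a Lipschitz
  bound with the same power of \<open>t - s\<close>, and bilinear operations preserve such pairs.
  The flow is picked by compactness with uniqueness still unknown; Gronwall for differences then
  shows that any choice is Lipschitz in the data. The coefficients are only bounded and measurable
  in time, so the reduced equation is read in integral form. The condition 3\<alpha> > 1 enters
  through the failure of the one-step map to be multiplicative, which is of order 3\<alpha>.\<close>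

text \<open>Unlike \<open>x powr 0\<close>, which is \<open>0\<close> at \<open>x = 0\<close>, the exponent \<open>0\<close> here expresses boundedness on the
  diagonal as well.\<close>

definition pw :: "real \<Rightarrow> real \<Rightarrow> real" where
  "pw x \<gamma> = (if \<gamma> = 0 then 1 else x powr \<gamma>)"

lemma pw_nonneg [simp]: "0 \<le> pw x \<gamma>"
  by (simp add: pw_def)

lemma pw_0 [simp]: "pw x 0 = 1"
  by (simp add: pw_def)

lemma pw_add: "\<lbrakk>0 \<le> x; 0 \<le> a; 0 \<le> b\<rbrakk> \<Longrightarrow> pw x (a + b) = pw x a * pw x b"
  by (cases "x = 0") (auto simp: pw_def powr_add)

lemma pw_mono: "\<lbrakk>0 \<le> x; x \<le> y; 0 \<le> a\<rbrakk> \<Longrightarrow> pw x a \<le> pw y a"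
  by (auto simp: pw_def intro: powr_mono2)

lemma pw_le_exponent:
  assumes "0 \<le> x" "x \<le> T" "0 \<le> a" "a \<le> b"
  shows "pw x b \<le> pw T (b - a) * pw x a"
proof -
  have "pw x b = pw x (b - a) * pw x a"
    using assms pw_add[of x "b - a" a] by simp
  then show ?thesis
    using pw_mono[of x T "b - a"] assms by (simp add: mult_right_mono)
qed

text \<open>In the application \<open>A\<close> is a ball of data and \<open>d\<close> the distance
  of data. Both are kept abstract because the estimates only carry \<open>d i j\<close> along as a
  factor, and because linear rough equations can then be solved once for all families.\<close>

locale data_family =
  fixes A :: "'i set" and d :: "'i \<Rightarrow> 'i \<Rightarrow> real" and T :: real
  assumes T_pos: "0 < T"
    and d_nonneg: "\<lbrakk>i \<in> A; j \<in> A\<rbrakk> \<Longrightarrow> 0 \<le> d i j"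
begin

text \<open>The constant is uniform over the family, so that bilinear combinations satisfy bounds of the
  same form with the exponents added.\<close>

definition lbd :: "real \<Rightarrow> ('i \<Rightarrow> real \<Rightarrow> real \<Rightarrow> real \<Rightarrow> 'a::real_normed_vector) \<Rightarrow> bool" where
  "lbd \<gamma> f \<longleftrightarrow> (\<exists>K\<ge>0. \<forall>i\<in>A. \<forall>s u t. 0 \<le> s \<and> s \<le> u \<and> u \<le> t \<and> t \<le> T \<longrightarrow>
     norm (f i s u t) \<le> K * pw (t - s) \<gamma> \<and>
     (\<forall>j\<in>A. norm (f i s u t - f j s u t) \<le> K * d i j * pw (t - s) \<gamma>))"

lemma lbdI:
  assumes "0 \<le> K"
    and "\<And>i s u t. \<lbrakk>i \<in> A; 0 \<le> s; s \<le> u; u \<le> t; t \<le> T\<rbrakk> \<Longrightarrow> norm (f i s u t) \<le> K * pw (t - s) \<gamma>"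
    and "\<And>i j s u t. \<lbrakk>i \<in> A; j \<in> A; 0 \<le> s; s \<le> u; u \<le> t; t \<le> T\<rbrakk> \<Longrightarrow>
      norm (f i s u t - f j s u t) \<le> K * d i j * pw (t - s) \<gamma>"
  shows "lbd \<gamma> f"
  unfolding lbd_def using assms by blast

lemma lbdE:
  assumes "lbd \<gamma> f"
  obtains K where "0 \<le> K"
    and "\<And>i s u t. \<lbrakk>i \<in> A; 0 \<le> s; s \<le> u; u \<le> t; t \<le> T\<rbrakk> \<Longrightarrow> norm (f i s u t) \<le> K * pw (t - s) \<gamma>"
    and "\<And>i j s u t. \<lbrakk>i \<in> A; j \<in> A; 0 \<le> s; s \<le> u; u \<le> t; t \<le> T\<rbrakk> \<Longrightarrow>
      norm (f i s u t - f j s u t) \<le> K * d i j * pw (t - s) \<gamma>"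
  using assms unfolding lbd_def by metis

lemma lbd_cong:
  assumes "lbd \<gamma> f"
    and "\<And>i s u t. \<lbrakk>i \<in> A; 0 \<le> s; s \<le> u; u \<le> t; t \<le> T\<rbrakk> \<Longrightarrow> g i s u t = f i s u t"
  shows "lbd \<gamma> g"
  using assms unfolding lbd_def by simp

lemma lbd_const: "lbd 0 (\<lambda>i s u t. c)"
  by (rule lbdI[of "norm c"]) (auto simp: d_nonneg)

lemma lbd_bounded_linear:
  assumes "bounded_linear F" "lbd \<gamma> f"
  shows "lbd \<gamma> (\<lambda>i s u t. F (f i s u t))"
proof -
  interpret F: bounded_linear F by fact
  obtain B where B: "B > 0" "\<And>x. norm (F x) \<le> norm x * B"
    using F.pos_bounded by blast
  obtain K where K: "0 \<le> K"
    "\<And>i s u t. \<lbrakk>i \<in> A; 0 \<le> s; s \<le> u; u \<le> t; t \<le> T\<rbrakk> \<Longrightarrow> norm (f i s u t) \<le> K * pw (t - s) \<gamma>"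
    "\<And>i j s u t. \<lbrakk>i \<in> A; j \<in> A; 0 \<le> s; s \<le> u; u \<le> t; t \<le> T\<rbrakk> \<Longrightarrow>
      norm (f i s u t - f j s u t) \<le> K * d i j * pw (t - s) \<gamma>"
    using lbdE[OF assms(2)] by metis
  show ?thesis
  proof (rule lbdI[of "K * B"])
    fix i s u t assume *: "i \<in> A" "0 \<le> s" "s \<le> u" "u \<le> t" "t \<le> T"
    show "norm (F (f i s u t)) \<le> K * B * pw (t - s) \<gamma>"
      using order_trans[OF B(2) mult_right_mono[OF K(2)[OF *]]] B(1) by (simp add: mult_ac)
  next
    fix i j s u t assume *: "i \<in> A" "j \<in> A" "0 \<le> s" "s \<le> u" "u \<le> t" "t \<le> T"
    show "norm (F (f i s u t) - F (f j s u t)) \<le> K * B * d i j * pw (t - s) \<gamma>"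
      using order_trans[OF B(2) mult_right_mono[OF K(3)[OF *]]] B(1)
      by (simp add: mult_ac F.diff)
  qed (use K B in auto)
qed

lemma lbd_add:
  assumes "lbd \<gamma> f" "lbd \<gamma> g"
  shows "lbd \<gamma> (\<lambda>i s u t. f i s u t + g i s u t)"
proof -
  obtain K where K: "0 \<le> K"
    "\<And>i s u t. \<lbrakk>i \<in> A; 0 \<le> s; s \<le> u; u \<le> t; t \<le> T\<rbrakk> \<Longrightarrow> norm (f i s u t) \<le> K * pw (t - s) \<gamma>"
    "\<And>i j s u t. \<lbrakk>i \<in> A; j \<in> A; 0 \<le> s; s \<le> u; u \<le> t; t \<le> T\<rbrakk> \<Longrightarrow>
      norm (f i s u t - f j s u t) \<le> K * d i j * pw (t - s) \<gamma>"
    using lbdE[OF assms(1)] by metis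
  obtain L where L: "0 \<le> L"
    "\<And>i s u t. \<lbrakk>i \<in> A; 0 \<le> s; s \<le> u; u \<le> t; t \<le> T\<rbrakk> \<Longrightarrow> norm (g i s u t) \<le> L * pw (t - s) \<gamma>"
    "\<And>i j s u t. \<lbrakk>i \<in> A; j \<in> A; 0 \<le> s; s \<le> u; u \<le> t; t \<le> T\<rbrakk> \<Longrightarrow>
      norm (g i s u t - g j s u t) \<le> L * d i j * pw (t - s) \<gamma>"
    using lbdE[OF assms(2)] by metis
  show ?thesis
  proof (rule lbdI[of "K + L"])
    fix i s u t assume *: "i \<in> A" "0 \<le> s" "s \<le> u" "u \<le> t" "t \<le> T"
    show "norm (f i s u t + g i s u t) \<le> (K + L) * pw (t - s) \<gamma>"
      using norm_triangle_mono[OF K(2)[OF *] L(2)[OF *]] by (simp add: distrib_right)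
  next
    fix i j s u t assume *: "i \<in> A" "j \<in> A" "0 \<le> s" "s \<le> u" "u \<le> t" "t \<le> T"
    show "norm (f i s u t + g i s u t - (f j s u t + g j s u t)) \<le> (K + L) * d i j * pw (t - s) \<gamma>"
      using norm_triangle_mono[OF K(3)[OF *] L(3)[OF *]] by (simp add: algebra_simps)
  qed (use K L in auto)
qed

lemma lbd_uminus: "lbd \<gamma> f \<Longrightarrow> lbd \<gamma> (\<lambda>i s u t. - f i s u t)"
  by (rule lbd_bounded_linear) (auto intro: bounded_linear_minus bounded_linear_ident)

lemma lbd_diff: "lbd \<gamma> f \<Longrightarrow> lbd \<gamma> g \<Longrightarrow> lbd \<gamma> (\<lambda>i s u t. f i s u t - g i s u t)"
  using lbd_add[OF _ lbd_uminus] by force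

lemma lbd_mono:
  assumes "lbd b f" "0 \<le> a" "a \<le> b"
  shows "lbd a f"
proof -
  obtain K where K: "0 \<le> K"
    "\<And>i s u t. \<lbrakk>i \<in> A; 0 \<le> s; s \<le> u; u \<le> t; t \<le> T\<rbrakk> \<Longrightarrow> norm (f i s u t) \<le> K * pw (t - s) b"
    "\<And>i j s u t. \<lbrakk>i \<in> A; j \<in> A; 0 \<le> s; s \<le> u; u \<le> t; t \<le> T\<rbrakk> \<Longrightarrow>
      norm (f i s u t - f j s u t) \<le> K * d i j * pw (t - s) b"
    using lbdE[OF assms(1)] by metis
  show ?thesis
  proof (rule lbdI[of "K * pw T (b - a)"])
    fix i s u t assume *: "i \<in> A" "0 \<le> s" "s \<le> u" "u \<le> t" "t \<le> T"
    have "K * pw (t - s) b \<le> K * (pw T (b - a) * pw (t - s) a)"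
      using * K(1) assms by (intro mult_left_mono pw_le_exponent) auto
    then show "norm (f i s u t) \<le> K * pw T (b - a) * pw (t - s) a"
      using K(2)[OF *] by (simp add: mult_ac)
  next
    fix i j s u t assume *: "i \<in> A" "j \<in> A" "0 \<le> s" "s \<le> u" "u \<le> t" "t \<le> T"
    have "(K * d i j) * pw (t - s) b \<le> (K * d i j) * (pw T (b - a) * pw (t - s) a)"
      using * K(1) assms d_nonneg by (intro mult_left_mono pw_le_exponent) auto
    then show "norm (f i s u t - f j s u t) \<le> K * pw T (b - a) * d i j * pw (t - s) a"
      using K(3)[OF *] by (simp add: mult_ac)
  qed (use K in auto)
qed

text \<open>A difference of products splits into two terms, each with one Lipschitz and one bounded
  factor. This is why boundedness and the Lipschitz bound are carried together with equal exponents,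
  and where the factor 2 in the constant comes from.\<close>

lemma lbd_bilinear:
  assumes "bounded_bilinear B" "lbd a f" "lbd b g" "0 \<le> a" "0 \<le> b"
  shows "lbd (a + b) (\<lambda>i s u t. B (f i s u t) (g i s u t))"
proof -
  interpret B: bounded_bilinear B by fact
  obtain C where C: "C > 0" "\<And>x y. norm (B x y) \<le> norm x * norm y * C"
    using B.pos_bounded by blast
  obtain K where K: "0 \<le> K"
    "\<And>i s u t. \<lbrakk>i \<in> A; 0 \<le> s; s \<le> u; u \<le> t; t \<le> T\<rbrakk> \<Longrightarrow> norm (f i s u t) \<le> K * pw (t - s) a"
    "\<And>i j s u t. \<lbrakk>i \<in> A; j \<in> A; 0 \<le> s; s \<le> u; u \<le> t; t \<le> T\<rbrakk> \<Longrightarrow>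
      norm (f i s u t - f j s u t) \<le> K * d i j * pw (t - s) a"
    using lbdE[OF assms(2)] by metis
  obtain L where L: "0 \<le> L"
    "\<And>i s u t. \<lbrakk>i \<in> A; 0 \<le> s; s \<le> u; u \<le> t; t \<le> T\<rbrakk> \<Longrightarrow> norm (g i s u t) \<le> L * pw (t - s) b"
    "\<And>i j s u t. \<lbrakk>i \<in> A; j \<in> A; 0 \<le> s; s \<le> u; u \<le> t; t \<le> T\<rbrakk> \<Longrightarrow>
      norm (g i s u t - g j s u t) \<le> L * d i j * pw (t - s) b"
    using lbdE[OF assms(3)] by metis
  show ?thesis
  proof (rule lbdI[of "2 * K * L * C"])
    fix i s u t assume *: "i \<in> A" "0 \<le> s" "s \<le> u" "u \<le> t" "t \<le> T"
    have "norm (B (f i s u t) (g i s u t)) \<le> norm (f i s u t) * norm (g i s u t) * C"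
      by (rule C)
    also have "\<dots> \<le> (K * pw (t - s) a) * (L * pw (t - s) b) * C"
      using K(2)[OF *] L(2)[OF *] C K(1) by (intro mult_right_mono mult_mono) auto
    also have "\<dots> = (K * L * C) * pw (t - s) (a + b)"
      using * assms by (simp add: pw_add mult_ac)
    also have "\<dots> \<le> (2 * K * L * C) * pw (t - s) (a + b)"
      using K(1) L(1) C by (intro mult_right_mono) auto
    finally show "norm (B (f i s u t) (g i s u t)) \<le> 2 * K * L * C * pw (t - s) (a + b)" .
  next
    fix i j s u t assume *: "i \<in> A" "j \<in> A" "0 \<le> s" "s \<le> u" "u \<le> t" "t \<le> T"
    have *: "i \<in> A" "0 \<le> s" "s \<le> u" "u \<le> t" "t \<le> T" "j \<in> A"
      using * by auto
    have "B (f i s u t) (g i s u t) - B (f j s u t) (g j s u t)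
      = B (f i s u t - f j s u t) (g i s u t) + B (f j s u t) (g i s u t - g j s u t)"
      by (simp add: B.diff_left B.diff_right)
    also have "norm \<dots> \<le> norm (f i s u t - f j s u t) * norm (g i s u t) * C
      + norm (f j s u t) * norm (g i s u t - g j s u t) * C"
      by (rule norm_triangle_mono) (rule C)+
    also have "\<dots> \<le> (K * d i j * pw (t - s) a) * (L * pw (t - s) b) * C
       + (K * pw (t - s) a) * (L * d i j * pw (t - s) b) * C"
      using K(2)[OF *(6,2-5)] K(3)[OF *(1,6,2-5)] L(2)[OF *(1-5)] L(3)[OF *(1,6,2-5)] C K(1) d_nonneg *
      by (intro add_mono mult_right_mono mult_mono) auto
    also have "\<dots> = 2 * K * L * C * d i j * pw (t - s) (a + b)"
      using * assms by (simp add: pw_add mult_ac)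
    finally show "norm (B (f i s u t) (g i s u t) - B (f j s u t) (g j s u t))
      \<le> 2 * K * L * C * d i j * pw (t - s) (a + b)" .
  qed (use K L C in auto)
qed

lemma lbd_bilinear_ge:
  assumes "bounded_bilinear B" "lbd a f" "lbd b g" "0 \<le> a" "0 \<le> b" "0 \<le> c" "c \<le> a + b"
  shows "lbd c (\<lambda>i s u t. B (f i s u t) (g i s u t))"
  using lbd_bilinear[OF assms(1-5)] assms(6,7) by (rule lbd_mono)

lemma lbd_sum:
  assumes "\<And>k. k \<in> S \<Longrightarrow> lbd \<gamma> (f k)" "0 \<le> \<gamma>"
  shows "lbd \<gamma> (\<lambda>i s u t. \<Sum>k\<in>S. f k i s u t)"
  using assms(1)
proof (induction S rule: infinite_finite_induct)
  case (insert x F)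
  then show ?case by (simp add: lbd_add)
next
  case empty
  then show ?case by (intro lbdI[of 0]) auto
next
  case (infinite S)
  then show ?case by (intro lbdI[of 0]) auto
qed

text \<open>The defect of a one-step scheme compares \<open>[s, t]\<close> with
  \<open>[s, u]\<close> and \<open>[u, t]\<close>. Estimates on a subinterval are restated relative
  to the full length, which is possible since \<open>pw\<close> is monotone for nonnegative
  exponents.\<close>

lemma lbd_left:
  assumes "lbd \<gamma> (\<lambda>i s u t. f i s t)" "0 \<le> \<gamma>"
  shows "lbd \<gamma> (\<lambda>i s u t. f i s u)"
proof -
  obtain K where K: "0 \<le> K"
    "\<And>i s u t. \<lbrakk>i \<in> A; 0 \<le> s; s \<le> u; u \<le> t; t \<le> T\<rbrakk> \<Longrightarrow> norm (f i s t) \<le> K * pw (t - s) \<gamma>"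
    "\<And>i j s u t. \<lbrakk>i \<in> A; j \<in> A; 0 \<le> s; s \<le> u; u \<le> t; t \<le> T\<rbrakk> \<Longrightarrow>
      norm (f i s t - f j s t) \<le> K * d i j * pw (t - s) \<gamma>"
    using lbdE[OF assms(1)] by metis
  show ?thesis
  proof (rule lbdI[of K])
    fix i s u t assume *: "i \<in> A" "0 \<le> s" "s \<le> u" "u \<le> t" "t \<le> T"
    \<comment> \<open>The hypothesis is used on \<open>[s, u]\<close> with middle time
      \<open>s\<close>, on which the family does not depend.\<close>
    have "norm (f i s u) \<le> K * pw (u - s) \<gamma>"
      using * K(2)[of i s s u] by auto
    also have "\<dots> \<le> K * pw (t - s) \<gamma>"
      using * K(1) assms(2) by (intro mult_left_mono pw_mono) auto
    finally show "norm (f i s u) \<le> K * pw (t - s) \<gamma>" .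
  next
    fix i j s u t assume *: "i \<in> A" "j \<in> A" "0 \<le> s" "s \<le> u" "u \<le> t" "t \<le> T"
    have "norm (f i s u - f j s u) \<le> (K * d i j) * pw (u - s) \<gamma>"
      using * K(3)[of i j s s u] by auto
    also have "\<dots> \<le> (K * d i j) * pw (t - s) \<gamma>"
      using * K(1) assms(2) d_nonneg by (intro mult_left_mono pw_mono) auto
    finally show "norm (f i s u - f j s u) \<le> K * d i j * pw (t - s) \<gamma>" .
  qed fact
qed

lemma lbd_right:
  assumes "lbd \<gamma> (\<lambda>i s u t. f i s t)" "0 \<le> \<gamma>"
  shows "lbd \<gamma> (\<lambda>i s u t. f i u t)"
proof -
  obtain K where K: "0 \<le> K"
    "\<And>i s u t. \<lbrakk>i \<in> A; 0 \<le> s; s \<le> u; u \<le> t; t \<le> T\<rbrakk> \<Longrightarrow> norm (f i s t) \<le> K * pw (t - s) \<gamma>"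
    "\<And>i j s u t. \<lbrakk>i \<in> A; j \<in> A; 0 \<le> s; s \<le> u; u \<le> t; t \<le> T\<rbrakk> \<Longrightarrow>
      norm (f i s t - f j s t) \<le> K * d i j * pw (t - s) \<gamma>"
    using lbdE[OF assms(1)] by metis
  show ?thesis
  proof (rule lbdI[of K])
    fix i s u t assume *: "i \<in> A" "0 \<le> s" "s \<le> u" "u \<le> t" "t \<le> T"
    have "norm (f i u t) \<le> K * pw (t - u) \<gamma>"
      using * K(2)[of i u u t] by auto
    also have "\<dots> \<le> K * pw (t - s) \<gamma>"
      using * K(1) assms(2) by (intro mult_left_mono pw_mono) auto
    finally show "norm (f i u t) \<le> K * pw (t - s) \<gamma>" .
  next
    fix i j s u t assume *: "i \<in> A" "j \<in> A" "0 \<le> s" "s \<le> u" "u \<le> t" "t \<le> T"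
    have "norm (f i u t - f j u t) \<le> (K * d i j) * pw (t - u) \<gamma>"
      using * K(3)[of i j u u t] by auto
    also have "\<dots> \<le> (K * d i j) * pw (t - s) \<gamma>"
      using * K(1) assms(2) d_nonneg by (intro mult_left_mono pw_mono) auto
    finally show "norm (f i u t - f j u t) \<le> K * d i j * pw (t - s) \<gamma>" .
  qed fact
qed

lemma lbd_pointI:
  assumes "0 \<le> K"
    and "\<And>i t. \<lbrakk>i \<in> A; 0 \<le> t; t \<le> T\<rbrakk> \<Longrightarrow> norm (f i t) \<le> K"
    and "\<And>i j t. \<lbrakk>i \<in> A; j \<in> A; 0 \<le> t; t \<le> T\<rbrakk> \<Longrightarrow> norm (f i t - f j t) \<le> K * d i j"
  shows "lbd 0 (\<lambda>i s u t. f i t)"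
  by (rule lbdI[OF assms(1)]) (simp_all add: assms)

lemma lbd_pointE:
  assumes "lbd 0 (\<lambda>i s u t. f i t)"
  obtains K where "0 \<le> K"
    and "\<And>i t. \<lbrakk>i \<in> A; 0 \<le> t; t \<le> T\<rbrakk> \<Longrightarrow> norm (f i t) \<le> K"
    and "\<And>i j t. \<lbrakk>i \<in> A; j \<in> A; 0 \<le> t; t \<le> T\<rbrakk> \<Longrightarrow> norm (f i t - f j t) \<le> K * d i j"
proof -
  obtain K where K: "0 \<le> K"
    "\<And>i s u t. \<lbrakk>i \<in> A; 0 \<le> s; s \<le> u; u \<le> t; t \<le> T\<rbrakk> \<Longrightarrow> norm (f i t) \<le> K * pw (t - s) 0"
    "\<And>i j s u t. \<lbrakk>i \<in> A; j \<in> A; 0 \<le> s; s \<le> u; u \<le> t; t \<le> T\<rbrakk> \<Longrightarrow>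
      norm (f i t - f j t) \<le> K * d i j * pw (t - s) 0"
    using lbdE[OF assms] by metis
  show ?thesis
    by (rule that[OF K(1)])
      (simp_all add: K(2)[of _ t t t for t, simplified] K(3)[of _ _ t t t for t, simplified])
qed

lemma lbd_point_left:
  assumes "lbd 0 (\<lambda>i s u t. f i t)"
  shows "lbd 0 (\<lambda>i s u t. f i s)"
  by (rule lbd_pointE[OF assms], rule lbdI) auto

text \<open>The distance of controlled paths sees a path only at time 0 and through increments. A
  supremum bound is recovered by adding the increment from 0.\<close>

lemma lbd_from_initial:
  assumes "lbd 0 (\<lambda>i s u t. f i 0)" "lbd \<gamma> (\<lambda>i s u t. f i t - f i s)" "0 \<le> \<gamma>"
  shows "lbd 0 (\<lambda>i s u t. f i t)"
proof -
  have *: "lbd 0 (\<lambda>i s u t. f i t - f i s)"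
    using lbd_mono[OF assms(2)] assms(3) by simp
  then obtain K where K: "0 \<le> K"
    "\<And>i s u t. \<lbrakk>i \<in> A; 0 \<le> s; s \<le> u; u \<le> t; t \<le> T\<rbrakk> \<Longrightarrow> norm (f i t - f i s) \<le> K * pw (t - s) 0"
    "\<And>i j s u t. \<lbrakk>i \<in> A; j \<in> A; 0 \<le> s; s \<le> u; u \<le> t; t \<le> T\<rbrakk> \<Longrightarrow>
      norm (f i t - f i s - (f j t - f j s)) \<le> K * d i j * pw (t - s) 0"
    by (elim lbdE) metis
  have "lbd 0 (\<lambda>i s u t. f i t - f i 0)"
    by (rule lbd_pointI[OF K(1)])
      (simp_all add: K(2)[of _ 0 t t for t, simplified] K(3)[of _ _ 0 t t for t, simplified])
  from lbd_add[OF this assms(1)] show ?thesis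
    by simp
qed

end

section \<open>Linear equations driven by almost multiplicative one-step maps\<close>

text \<open>\<open>L\<close> is the one-step map of a scheme: Hoelder close to the identity, and
  multiplicative up to an error of order \<theta> > 1. Both errors are relative to
  \<open>norm v\<close>, so growth stays under control without a localisation of the
  equation.\<close>

locale rough_flow =
  fixes L :: "real \<Rightarrow> real \<Rightarrow> 'v::euclidean_space \<Rightarrow> 'v" and C a \<theta> T :: real
  assumes linear_L: "\<lbrakk>0 \<le> s; s \<le> t; t \<le> T\<rbrakk> \<Longrightarrow> linear (L s t)"
    and near_id: "\<lbrakk>0 \<le> s; s \<le> t; t \<le> T\<rbrakk> \<Longrightarrow> norm (L s t v - v) \<le> C * (t - s) powr a * norm v"
    and defect: "\<lbrakk>0 \<le> s; s \<le> u; u \<le> t; t \<le> T\<rbrakk> \<Longrightarrow>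
      norm (L s t v - L u t (L s u v)) \<le> C * (t - s) powr \<theta> * norm v"
    and C_nonneg: "0 \<le> C" and a_pos: "0 < a" and theta_gt_1: "1 < \<theta>" and T_pos: "0 < T"
begin

lemma L_refl: "0 \<le> s \<Longrightarrow> s \<le> T \<Longrightarrow> L s s v = v"
  using near_id[of s s v] by simp

lemma L_norm_le:
  assumes "0 \<le> s" "s \<le> t" "t \<le> T" "t - s \<le> h"
  shows "norm (L s t v) \<le> (1 + C * h powr a) * norm v"
proof -
  have "norm (L s t v) \<le> norm (L s t v - v) + norm v"
    by norm
  also have "norm (L s t v - v) \<le> C * (t - s) powr a * norm v"
    using assms by (intro near_id) auto
  also have "\<dots> \<le> C * h powr a * norm v"
    using assms C_nonneg a_pos by (intro mult_right_mono mult_left_mono powr_mono2) auto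
  finally show ?thesis
    by (simp add: algebra_simps)
qed

end

text \<open>The first bound is the growth over a stretch of length at most \<open>h\<close> followed
  by one more step, as it occurs in the induction for the Euler scheme; the second lets a supremum
  be absorbed in the rough Gronwall inequality. All terms containing \<open>h\<close> tend to 0 with
  it, so every \<rho> above 1 can be reached.\<close>

lemma small_step_exists:
  fixes C a \<theta> K \<rho> :: real
  assumes "0 < a" "0 < \<theta>" "1 < \<rho>"
  obtains h where "0 < h" "(1 + C * h powr a) * (1 + C * h powr a + K * h powr \<theta>) \<le> \<rho>"
    "K * h powr \<theta> \<le> \<rho> - 1"
proof -
  have powr_0: "((\<lambda>h::real. h powr c) \<longlongrightarrow> 0) (at_right 0)" if "0 < c" for c
    using that by (intro tendsto_zero_powrI[OF tendsto_ident_at tendsto_const])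
      (auto simp: eventually_at_filter)
  have "((\<lambda>h. (1 + C * h powr a) * (1 + C * h powr a + K * h powr \<theta>)) \<longlongrightarrow>
      (1 + C * 0) * (1 + C * 0 + K * 0)) (at_right 0)"
    by (intro tendsto_mult tendsto_add tendsto_const powr_0 assms)
  then have 1: "eventually (\<lambda>h. (1 + C * h powr a) * (1 + C * h powr a + K * h powr \<theta>) < \<rho>) (at_right 0)"
    using assms by (intro order_tendstoD(2)[where y = "(1 + C * 0) * (1 + C * 0 + K * 0)"]) auto
  have "((\<lambda>h. K * h powr \<theta>) \<longlongrightarrow> K * 0) (at_right 0)"
    by (intro tendsto_mult tendsto_const powr_0 assms)
  then have 2: "eventually (\<lambda>h. K * h powr \<theta> < \<rho> - 1) (at_right 0)"
    using assms by (intro order_tendstoD(2)[where y = "K * 0"]) auto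
  have "eventually (\<lambda>h::real. h > 0 \<and> (1 + C * h powr a) * (1 + C * h powr a + K * h powr \<theta>) < \<rho>
     \<and> K * h powr \<theta> < \<rho> - 1) (at_right 0)"
    using 1 2 eventually_at_right_less[of 0] by eventually_elim auto
  then obtain h where "h > 0 \<and> (1 + C * h powr a) * (1 + C * h powr a + K * h powr \<theta>) < \<rho>
     \<and> K * h powr \<theta> < \<rho> - 1"
    using eventually_happens'[OF trivial_limit_at_right_real[of 0]] by blast
  then show ?thesis
    using that[of h] by auto
qed

section \<open>Davie's estimate and existence of solutions\<close>

context rough_flow
begin

text \<open>Davie's argument: splitting \<open>[x\<^sub>i, x\<^sub>j]\<close> at the last partition point before its midpoint
  leaves two pieces of at most half the length, and \<open>2\<^sup>1\<^sup>-\<^sup>\<theta> < 1\<close> lets the induction close.\<close>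

lemma euler_scheme_error:
  fixes x :: "nat \<Rightarrow> real" and y :: "nat \<Rightarrow> 'v"
  assumes x: "\<And>i j. \<lbrakk>i < j; j \<le> n\<rbrakk> \<Longrightarrow> x i < x j" "0 \<le> x 0" "x n \<le> T"
    and y: "\<And>k. k < n \<Longrightarrow> y (Suc k) = L (x k) (x (Suc k)) (y k)"
    and q: "2 * \<rho> * 2 powr (- \<theta>) = q" "q < 1" and \<rho>: "1 < \<rho>"
    and K: "K = (1 + \<rho>) * C / (1 - q)"
    and h: "(1 + C * h powr a) * (1 + C * h powr a + K * h powr \<theta>) \<le> \<rho>"
    and ij: "i \<le> j" "j \<le> n" "x j - x i \<le> h"
  shows "norm (y j - L (x i) (x j) (y i)) \<le> K * (x j - x i) powr \<theta> * norm (y i)"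
  using ij
proof (induction "j - i" arbitrary: i j rule: less_induct)
  case (less i j)
  have le: "x i' \<le> x j'" if "i' \<le> j'" "j' \<le> n" for i' j'
    using x(1)[of i' j'] that by (cases "i' = j'") auto
  have x0: "0 \<le> x k" if "k \<le> n" for k
    using le[of 0 k] that x(2) by auto
  have xT: "x k \<le> T" if "k \<le> n" for k
    using le[of k n] that x(3) by auto
  have K0: "0 \<le> K"
    using K q \<rho> C_nonneg by auto
  define \<eta> where "\<eta> = C * h powr a"
  have \<eta>0: "0 \<le> \<eta>" using C_nonneg by (simp add: \<eta>_def)
  have h\<theta>0: "0 \<le> K * h powr \<theta>" using K0 by simp
  have "(1 + \<eta>) * (1 + \<eta>) \<le> (1 + \<eta>) * (1 + \<eta> + K * h powr \<theta>)"
    using \<eta>0 h\<theta>0 by (intro mult_left_mono) auto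
  with h have \<rho>2: "(1 + \<eta>) * (1 + \<eta>) \<le> \<rho>" by (simp add: \<eta>_def)
  moreover have "(1 + \<eta>) * 1 \<le> (1 + \<eta>) * (1 + \<eta>)"
    using \<eta>0 by (intro mult_left_mono) auto
  ultimately have \<rho>1: "1 + \<eta> \<le> \<rho>" by simp
  show ?case
  proof (cases "i = j")
    case True
    then show ?thesis using L_refl x0 xT less.prems by auto
  next
    case False
    define l where "l = x j - x i"
    have l: "0 < l" "l \<le> h"
      using x(1)[of i j] False less.prems by (auto simp: l_def)
    define k where "k = Max {k. i \<le> k \<and> k < j \<and> x k - x i \<le> l / 2}"
    have fin: "finite {k. i \<le> k \<and> k < j \<and> x k - x i \<le> l / 2}"
      by (rule finite_subset[of _ "{..<j}"]) auto
    have "i \<in> {k. i \<le> k \<and> k < j \<and> x k - x i \<le> l / 2}"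
      using l less.prems False by auto
    then have "k \<in> {k. i \<le> k \<and> k < j \<and> x k - x i \<le> l / 2}"
      unfolding k_def using fin by (intro Max_in) auto
    then have k: "i \<le> k" "k < j" "x k - x i \<le> l / 2" by auto
    have k2: "x j - x (Suc k) \<le> l / 2"
    proof (cases "Suc k = j")
      case False
      then have "\<not> x (Suc k) - x i \<le> l / 2"
        using Max_ge[OF fin, of "Suc k", folded k_def] k by (metis (mono_tags, lifting) Suc_lessI
            le_SucI mem_Collect_eq not_less_eq_eq order_refl)
      then show ?thesis by (simp add: l_def)
    qed (use l in auto)
    have pos: "x i \<le> x k" "x k \<le> x (Suc k)" "x (Suc k) \<le> x j" "0 \<le> x i" "x j \<le> T"
      using le k less.prems x0 xT by auto
    define e where "e = (l / 2) powr \<theta>"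
    have e: "e = 2 powr (- \<theta>) * l powr \<theta>"
      using l by (simp add: e_def powr_divide powr_minus field_simps)
    have th0: "0 < \<theta>" using theta_gt_1 by simp
    have IH1: "norm (y k - L (x i) (x k) (y i)) \<le> K * e * norm (y i)"
    proof -
      have "norm (y k - L (x i) (x k) (y i)) \<le> K * (x k - x i) powr \<theta> * norm (y i)"
        using k less.prems pos by (intro less.hyps) (auto simp: l_def)
      also have "\<dots> \<le> K * e * norm (y i)"
        unfolding e_def using k pos K0 th0 by (intro mult_right_mono mult_left_mono powr_mono2) auto
      finally show ?thesis .
    qed
    have IH2: "norm (y j - L (x (Suc k)) (x j) (y (Suc k))) \<le> K * e * norm (y (Suc k))"
    proof -
      have "norm (y j - L (x (Suc k)) (x j) (y (Suc k))) \<le> K * (x j - x (Suc k)) powr \<theta> * norm (y (Suc k))"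
        using k less.prems pos by (intro less.hyps) auto
      also have "\<dots> \<le> K * e * norm (y (Suc k))"
        unfolding e_def using k2 pos K0 th0 by (intro mult_right_mono mult_left_mono powr_mono2) auto
      finally show ?thesis .
    qed
    have Lb: "norm (L s t v) \<le> (1 + \<eta>) * norm v" if "x i \<le> s" "s \<le> t" "t \<le> x j" for s t v
      unfolding \<eta>_def using that pos l by (intro L_norm_le) (auto simp: l_def)
    have "norm (y k) \<le> norm (y k - L (x i) (x k) (y i)) + norm (L (x i) (x k) (y i))"
      by norm
    also have "\<dots> \<le> K * e * norm (y i) + (1 + \<eta>) * norm (y i)"
      using Lb[of "x i" "x k"] IH1 pos by (intro add_mono) auto
    also have "\<dots> \<le> K * h powr \<theta> * norm (y i) + (1 + \<eta>) * norm (y i)"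
      unfolding e_def using l K0 th0
      by (intro add_mono mult_right_mono mult_left_mono powr_mono2) auto
    finally have yk: "norm (y k) \<le> (1 + \<eta> + K * h powr \<theta>) * norm (y i)"
      by (simp add: algebra_simps)
    have ySk: "y (Suc k) = L (x k) (x (Suc k)) (y k)"
      using y k less.prems by auto
    have "norm (y (Suc k)) \<le> (1 + \<eta>) * norm (y k)"
      unfolding ySk using Lb pos by auto
    also have "\<dots> \<le> (1 + \<eta>) * ((1 + \<eta> + K * h powr \<theta>) * norm (y i))"
      using yk \<eta>0 by (intro mult_left_mono) auto
    also have "\<dots> \<le> \<rho> * norm (y i)"
      using h by (simp add: \<eta>_def mult.assoc[symmetric] mult_right_mono)
    finally have yS: "norm (y (Suc k)) \<le> \<rho> * norm (y i)" .
    \<comment> \<open>The cell \<open>[x k, x (Suc k)]\<close> contains the midpoint and is a single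
      exact step of the scheme, so passing it costs only a defect of \<open>L\<close>, besides the
      error propagated from \<open>x k\<close>.\<close>
    have "y (Suc k) - L (x i) (x (Suc k)) (y i) =
      L (x k) (x (Suc k)) (y k - L (x i) (x k) (y i))
      - (L (x i) (x (Suc k)) (y i) - L (x k) (x (Suc k)) (L (x i) (x k) (y i)))"
      using linear_diff[OF linear_L, of "x k" "x (Suc k)"] pos by (simp add: ySk)
    also have "norm \<dots> \<le> (1 + \<eta>) * (K * e * norm (y i)) + C * l powr \<theta> * norm (y i)"
    proof (rule order_trans[OF norm_triangle_ineq4], rule add_mono)
      show "norm (L (x k) (x (Suc k)) (y k - L (x i) (x k) (y i))) \<le> (1 + \<eta>) * (K * e * norm (y i))"
        using Lb[of "x k" "x (Suc k)"] IH1 pos \<eta>0 by (meson add_nonneg_nonneg mult_left_mono order_trans zero_le_one)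
      have "norm (L (x i) (x (Suc k)) (y i) - L (x k) (x (Suc k)) (L (x i) (x k) (y i)))
        \<le> C * (x (Suc k) - x i) powr \<theta> * norm (y i)"
        using pos by (intro defect) auto
      also have "\<dots> \<le> C * l powr \<theta> * norm (y i)"
        using pos C_nonneg th0 by (intro mult_right_mono mult_left_mono powr_mono2) (auto simp: l_def)
      finally show "norm (L (x i) (x (Suc k)) (y i) - L (x k) (x (Suc k)) (L (x i) (x k) (y i))) \<le> \<dots>" .
    qed
    finally have JS: "norm (y (Suc k) - L (x i) (x (Suc k)) (y i)) \<le>
      (1 + \<eta>) * (K * e * norm (y i)) + C * l powr \<theta> * norm (y i)" .
    have "y j - L (x i) (x j) (y i) = (y j - L (x (Suc k)) (x j) (y (Suc k)))
      + L (x (Suc k)) (x j) (y (Suc k) - L (x i) (x (Suc k)) (y i))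
      - (L (x i) (x j) (y i) - L (x (Suc k)) (x j) (L (x i) (x (Suc k)) (y i)))"
      using linear_diff[OF linear_L, of "x (Suc k)" "x j"] pos by simp
    also have "norm \<dots> \<le> (K * e * (\<rho> * norm (y i))
        + (1 + \<eta>) * ((1 + \<eta>) * (K * e * norm (y i)) + C * l powr \<theta> * norm (y i)))
        + C * l powr \<theta> * norm (y i)"
    proof (rule order_trans[OF norm_triangle_ineq4], rule add_mono, rule norm_triangle_mono)
      have "K * e * norm (y (Suc k)) \<le> K * e * (\<rho> * norm (y i))"
        using yS K0 by (intro mult_left_mono) (auto simp: e_def)
      with IH2 show "norm (y j - L (x (Suc k)) (x j) (y (Suc k))) \<le> K * e * (\<rho> * norm (y i))"
        by simp
      show "norm (L (x (Suc k)) (x j) (y (Suc k) - L (x i) (x (Suc k)) (y i)))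
        \<le> (1 + \<eta>) * ((1 + \<eta>) * (K * e * norm (y i)) + C * l powr \<theta> * norm (y i))"
        using pos \<eta>0 by (intro order_trans[OF Lb mult_left_mono[OF JS]]) auto
      show "norm (L (x i) (x j) (y i) - L (x (Suc k)) (x j) (L (x i) (x (Suc k)) (y i)))
        \<le> C * l powr \<theta> * norm (y i)"
        unfolding l_def using pos by (intro defect) auto
    qed
    also have "\<dots> = (K * e * \<rho> + (1 + \<eta>) * (1 + \<eta>) * (K * e) + ((1 + \<eta>) + 1) * (C * l powr \<theta>)) * norm (y i)"
      by (simp add: algebra_simps)
    also have "\<dots> \<le> (K * e * \<rho> + \<rho> * (K * e) + (\<rho> + 1) * (C * l powr \<theta>)) * norm (y i)"
      using \<rho> \<rho>1 \<rho>2 K0 C_nonneg by (intro mult_right_mono add_mono) (auto simp: e_def)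
    also have "K * e * \<rho> + \<rho> * (K * e) + (\<rho> + 1) * (C * l powr \<theta>) = (q * K + (1 + \<rho>) * C) * l powr \<theta>"
      unfolding e q(1)[symmetric] by (simp add: algebra_simps)
    \<comment> \<open>\<open>K\<close> was chosen as the fixed point of this affine recursion. Both
      halves contribute with the factor \<rho>, whence
      \<open>q = 2 * \<rho> * 2 powr (- \<theta>)\<close>.\<close>
    also have "q * K + (1 + \<rho>) * C = K"
      using q K by (simp add: field_simps)
    finally show ?thesis
      by (simp add: l_def)
  qed
qed

text \<open>Each pair of nearby times imposes one condition on a path, closed for pointwise
  convergence. Finitely many conditions are met by the Euler scheme on a partition containing all
  their end points, with constants independent of the partition; compactness of a product of balls
  then yields one path that meets all of them. Continuity is not built in: it follows afterwards
  from the estimate.\<close>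

lemma solution_exists:
  "\<exists>y K. y 0 = y0 \<and> 0 \<le> K \<and>
     (\<forall>s t. 0 \<le> s \<and> s \<le> t \<and> t \<le> T \<longrightarrow> norm (y t - L s t (y s)) \<le> K * (t - s) powr \<theta>)"
proof -
  \<comment> \<open>Any \<rho> strictly between 1 and \<open>2 powr (\<theta> - 1)\<close> makes
    \<open>q < 1\<close>; the mean of the two is taken.\<close>
  define \<rho> where "\<rho> = (1 + 2 powr (\<theta> - 1)) / 2"
  define q where "q = 2 * \<rho> * 2 powr (- \<theta>)"
  define K where "K = (1 + \<rho>) * C / (1 - q)"
  have two: "1 < 2 powr (\<theta> - 1)" using theta_gt_1 by simp
  then have \<rho>: "1 < \<rho>" by (simp add: \<rho>_def)
  have "q = (2 powr (1 - \<theta>) + 1) / 2"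
    by (simp add: q_def \<rho>_def powr_diff powr_minus field_simps)
  moreover have "2 powr (1 - \<theta>) < (1::real)"
    using theta_gt_1 by (simp add: powr_less_one)
  ultimately have q: "q < 1" by simp
  have K0: "0 \<le> K" using q \<rho> C_nonneg by (simp add: K_def)
  have th0: "0 < \<theta>" using theta_gt_1 by simp
  obtain h where h: "0 < h" "(1 + C * h powr a) * (1 + C * h powr a + K * h powr \<theta>) \<le> \<rho>"
    using small_step_exists[OF a_pos th0 \<rho>] by metis
  have hbd: "1 + C * h powr a + K * h powr \<theta> \<le> \<rho>"
  proof -
    have "1 * (1 + C * h powr a + K * h powr \<theta>) \<le> (1 + C * h powr a) * (1 + C * h powr a + K * h powr \<theta>)"
      using C_nonneg K0 by (intro mult_right_mono) auto
    with h show ?thesis by simp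
  qed
  define N where "N = nat \<lceil>T / h\<rceil>"
  have N: "T \<le> real N * h"
    using h(1) T_pos unfolding N_def by (metis divide_le_eq of_nat_ceiling)
  define R where "R = \<rho> ^ N * norm y0"
  define I where "I = {(s, t). 0 \<le> s \<and> s \<le> t \<and> t \<le> T \<and> t - s \<le> h}"
  define F where "F = (\<lambda>(s, t). {f. f 0 = y0 \<and>
    norm (f t - L s t (f s)) \<le> K * (t - s) powr \<theta> * norm (f s)})"
  define S where "S = {f :: real \<Rightarrow> 'v. \<forall>t. f t \<in> cball 0 R}"
  have "S = PiE UNIV (\<lambda>_. cball 0 R)"
    by (auto simp: S_def PiE_def)
  then have "compact S"
    using compactin_PiE[of "\<lambda>_. euclidean" UNIV "\<lambda>_::real. cball (0::'v) R"]
    by (simp add: euclidean_product_topology)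
  moreover have "closed (F p)" if "p \<in> I" for p
  proof -
    obtain s t where p: "p = (s, t)" by (cases p)
    have "continuous_on UNIV (\<lambda>f. L s t (f s))"
      using that linear_L[of s t]
      by (intro continuous_on_compose2[OF linear_continuous_on[of "L s t" UNIV]])
        (auto simp: p I_def linear_linear)
    then show ?thesis
      unfolding F_def p prod.case
      by (intro closed_Collect_conj closed_Collect_eq closed_Collect_le continuous_intros)
        simp_all
  qed
  moreover have "S \<inter> (\<Inter>p\<in>I'. F p) \<noteq> {}" if I': "finite I'" "I' \<subseteq> I" for I'
  proof -
    \<comment> \<open>Multiples of \<open>h\<close> are added to the partition so that the growth
      bound \<open>grow\<close> can advance by stretches of length at most \<open>h\<close>. The
      radius \<open>R\<close> then depends on the number \<open>N\<close> of stretches and not on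
      the partition.\<close>
    define G where "G = {real k * h | k. k \<le> N \<and> real k * h \<le> T}"
    define P where "P = G \<union> fst ` I' \<union> snd ` I'"
    have "G \<subseteq> (\<lambda>k. real k * h) ` {..N}" by (auto simp: G_def)
    then have "finite G" by (rule finite_subset) simp
    then have "finite P" using I' by (simp add: P_def)
    have PT: "p \<in> {0..T}" if "p \<in> P" for p
      using that I' h(1) by (auto simp: P_def G_def I_def)
    have "0 \<in> P" using T_pos by (auto simp: P_def G_def intro!: exI[of _ 0])
    define xs where "xs = sorted_list_of_set P"
    have xs: "set xs = P" "sorted xs" "distinct xs"
      using \<open>finite P\<close> by (auto simp: xs_def)
    define n where "n = length xs - 1"
    have len: "length xs = Suc n"
      using \<open>0 \<in> P\<close> xs(1) by (cases xs) (auto simp: n_def)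
    define x where "x k = xs ! k" for k
    have x_mono: "x i < x j" if "i < j" "j \<le> n" for i j
      using that xs len by (auto simp: x_def sorted_wrt_nth_less strict_sorted_iff)
    have x_surj: "\<exists>k\<le>n. x k = p" if "p \<in> P" for p
      using that xs(1) len unfolding x_def by (metis in_set_conv_nth less_Suc_eq_le)
    have x_in: "x k \<in> P" if "k \<le> n" for k
      using that xs(1) len unfolding x_def by (metis less_Suc_eq_le nth_mem)
    have x_inj: "i = j" if "x i = x j" "i \<le> n" "j \<le> n" for i j
      using that x_mono by (metis less_irrefl nat_neq_iff)
    obtain k0 where k0: "k0 \<le> n" "x k0 = 0"
      using x_surj[OF \<open>0 \<in> P\<close>] by blast
    have x0: "x 0 = 0"
      using x_mono[of 0 k0] k0 PT[OF x_in[of 0]] by (cases "k0 = 0") auto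
    define y where "y = rec_nat y0 (\<lambda>k. L (x k) (x (Suc k)))"
    have y: "y 0 = y0" "y (Suc k) = L (x k) (x (Suc k)) (y k)" for k
      by (simp_all add: y_def)
    have err: "norm (y j - L (x i) (x j) (y i)) \<le> K * (x j - x i) powr \<theta> * norm (y i)"
      if "i \<le> j" "j \<le> n" "x j - x i \<le> h" for i j
      by (rule euler_scheme_error[of n x y, OF _ _ _ _ q_def[symmetric] q \<rho> K_def h(2) that])
        (use x_mono x0 y PT[OF x_in[of n]] in auto)
    have step: "norm (y j) \<le> \<rho> * norm (y i)" if "i \<le> j" "j \<le> n" "x j - x i \<le> h" for i j
    proof -
      have ij: "0 \<le> x i" "x i \<le> x j" "x j \<le> T"
        using that x_mono[of i j] PT[OF x_in] by (cases "i = j"; force)+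
      have "norm (y j) \<le> norm (y j - L (x i) (x j) (y i)) + norm (L (x i) (x j) (y i))"
        by norm
      also have "\<dots> \<le> K * h powr \<theta> * norm (y i) + (1 + C * h powr a) * norm (y i)"
        using err[OF that] L_norm_le[OF ij that(3), of "y i"] ij that th0 K0
          mult_right_mono[OF mult_left_mono[OF powr_mono2[of \<theta> "x j - x i" h]], of K "norm (y i)"]
        by (intro add_mono) auto
      also have "\<dots> = (1 + C * h powr a + K * h powr \<theta>) * norm (y i)"
        by (simp add: algebra_simps)
      also have "\<dots> \<le> \<rho> * norm (y i)"
        using hbd by (rule mult_right_mono) simp
      finally show ?thesis .
    qed
    have grow: "norm (y j) \<le> \<rho> ^ k * norm y0" if "j \<le> n" "x j \<le> real k * h" "k \<le> N" for j k
      using that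
    proof (induction k arbitrary: j)
      case 0
      then have "j = 0" using x_mono[of 0 j] x0 by (cases "j = 0") auto
      then show ?case by (simp add: y)
    next
      case (Suc k)
      show ?case
      proof (cases "x j \<le> real k * h")
        case True
        then have "norm (y j) \<le> \<rho> ^ k * norm y0" using Suc by auto
        also have "\<dots> \<le> \<rho> ^ Suc k * norm y0"
          using \<rho> by (intro mult_right_mono power_increasing) auto
        finally show ?thesis .
      next
        case False
        then have "real k * h \<in> P"
          using PT[OF x_in[of j]] Suc.prems by (auto simp: P_def G_def)
        then obtain i where i: "i \<le> n" "x i = real k * h" using x_surj by blast
        then have "i \<le> j" using False x_mono[of j i] by fastforce
        then have "norm (y j) \<le> \<rho> * norm (y i)"
          using i Suc.prems by (intro step) (auto simp: algebra_simps)
        also have "\<dots> \<le> \<rho> * (\<rho> ^ k * norm y0)"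
          using Suc i \<rho> by (intro mult_left_mono Suc.IH) auto
        finally show ?thesis by (simp add: mult_ac)
      qed
    qed
    \<comment> \<open>The conditions in \<open>I'\<close> look only at points of \<open>P\<close>;
      elsewhere any value inside the ball serves.\<close>
    define f where "f t = (if t \<in> P then y (THE k. k \<le> n \<and> x k = t) else 0)" for t
    have f: "f (x k) = y k" if "k \<le> n" for k
    proof -
      have "(THE k'. k' \<le> n \<and> x k' = x k) = k"
        using that x_inj by (intro the_equality) auto
      then show ?thesis using x_in that by (simp add: f_def)
    qed
    have "R \<ge> 0" using \<rho> by (simp add: R_def)
    have "norm (f t) \<le> R" for t
    proof (cases "t \<in> P")
      case True
      then obtain k where "k \<le> n" "x k = t" using x_surj by blast
      then show ?thesis
        using grow[of k N] N PT[OF True] f[of k] by (auto simp: R_def)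
    qed (use \<open>R \<ge> 0\<close> in \<open>simp add: f_def\<close>)
    then have "f \<in> S" by (simp add: S_def)
    moreover have "f \<in> F p" if "p \<in> I'" for p
    proof -
      obtain s t where p: "p = (s, t)" by (cases p)
      have st: "(s, t) \<in> I" "s \<in> P" "t \<in> P"
        using that I' by (force simp: p P_def)+
      obtain i where i: "i \<le> n" "x i = s" using x_surj st by blast
      obtain j where j: "j \<le> n" "x j = t" using x_surj st by blast
      have "i \<le> j"
        using st(1) i j x_mono[of j i] by (force simp: I_def)
      then show ?thesis
        using err[of i j] f[of i] f[of j] f[of 0] i j st x0 y by (simp add: F_def p I_def)
    qed
    ultimately show ?thesis by blast
  qed
  ultimately have "S \<inter> (\<Inter>p\<in>I. F p) \<noteq> {}"
    by (rule compact_imp_fip_image)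
  then obtain y where y: "y \<in> S" "\<And>p. p \<in> I \<Longrightarrow> y \<in> F p" by blast
  \<comment> \<open>The initial condition is part of every \<open>F p\<close>, so one pair is needed
    to read it off.\<close>
  have "(0, 0) \<in> I" using h T_pos by (simp add: I_def)
  then have y0: "y 0 = y0" using y(2) by (force simp: F_def)
  have R: "norm (y t) \<le> R" for t using y(1) by (simp add: S_def)
  have R0: "0 \<le> R" using R[of 0] norm_ge_zero order_trans by blast
  \<comment> \<open>For \<open>t - s > h\<close> a bounded quantity is at most its bound times
    \<open>(t - s) powr \<theta> / h powr \<theta>\<close>, which extends the local estimate to all
    pairs.\<close>
  define K' where "K' = K * R + (R + (1 + C * T powr a) * R) / h powr \<theta>"
  have K'0: "0 \<le> K'" using K0 R0 C_nonneg by (simp add: K'_def)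
  have "norm (y t - L s t (y s)) \<le> K' * (t - s) powr \<theta>" if "0 \<le> s" "s \<le> t" "t \<le> T" for s t
  proof (cases "t - s \<le> h")
    case True
    then have "norm (y t - L s t (y s)) \<le> K * (t - s) powr \<theta> * norm (y s)"
      using y(2)[of "(s, t)"] that by (auto simp: F_def I_def)
    also have "\<dots> \<le> K * (t - s) powr \<theta> * R"
      using R K0 by (intro mult_left_mono) auto
    also have "\<dots> = (K * R) * (t - s) powr \<theta>" by simp
    also have "\<dots> \<le> K' * (t - s) powr \<theta>"
      using R0 C_nonneg by (intro mult_right_mono) (auto simp: K'_def)
    finally show ?thesis .
  next
    case False
    have "norm (y t - L s t (y s)) \<le> norm (y t) + norm (L s t (y s))"
      by norm
    also have "norm (L s t (y s)) \<le> (1 + C * T powr a) * norm (y s)"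
      using that by (intro L_norm_le) auto
    also have "\<dots> \<le> (1 + C * T powr a) * R"
      using R C_nonneg by (intro mult_left_mono) auto
    finally have "norm (y t - L s t (y s)) \<le> (R + (1 + C * T powr a) * R) * 1"
      using R[of t] by simp
    also have "\<dots> \<le> (R + (1 + C * T powr a) * R) * ((t - s) powr \<theta> / h powr \<theta>)"
      using False h(1) th0 R0 C_nonneg powr_mono2[of \<theta> h "t - s"]
      by (intro mult_left_mono) auto
    also have "\<dots> = (R + (1 + C * T powr a) * R) / h powr \<theta> * (t - s) powr \<theta>"
      by simp
    also have "\<dots> \<le> K' * (t - s) powr \<theta>"
      using K0 R0 by (intro mult_right_mono) (auto simp: K'_def)
    finally show ?thesis .
  qed
  with y0 K'0 show ?thesis by blast
qed

end

text \<open>One halving turns a constant \<open>c\<close> into \<open>q * c + G\<close>. After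
  \<open>n\<close> halvings the a priori constant \<open>K\<close> survives only as
  \<open>q ^ n * K\<close>, and the limit removes it: a qualitative bound of order \<theta> becomes
  a quantitative one.\<close>

lemma midpoint_contraction:
  fixes f :: "real \<Rightarrow> real \<Rightarrow> real"
  assumes rec: "\<And>s t. \<lbrakk>p \<le> s; s \<le> t; t \<le> b\<rbrakk> \<Longrightarrow>
      f s t \<le> f ((s + t) / 2) t + \<rho> * f s ((s + t) / 2) + G * (t - s) powr \<theta>"
    and bd: "\<And>s t. \<lbrakk>p \<le> s; s \<le> t; t \<le> b\<rbrakk> \<Longrightarrow> f s t \<le> K * (t - s) powr \<theta>"
    and q: "2 * \<rho> * 2 powr (- \<theta>) = q" "q < 1" and \<rho>: "1 \<le> \<rho>" and G: "0 \<le> G" and K: "0 \<le> K"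
    and st: "p \<le> s" "s \<le> t" "t \<le> b"
  shows "f s t \<le> G / (1 - q) * (t - s) powr \<theta>"
proof -
  have q0: "0 \<le> q" using q(1) \<rho> by auto
  have *: "f s t \<le> (q ^ n * K + G / (1 - q)) * (t - s) powr \<theta>"
    if "p \<le> s" "s \<le> t" "t \<le> b" for n s t
    using that
  proof (induction n arbitrary: s t)
    case 0
    have "K * (t - s) powr \<theta> \<le> (K + G / (1 - q)) * (t - s) powr \<theta>"
      using G q by (intro mult_right_mono) auto
    with bd[OF 0] show ?case by simp
  next
    case (Suc n)
    define c where "c = q ^ n * K + G / (1 - q)"
    have c: "0 \<le> c" using q0 q K G by (simp add: c_def)
    define m where "m = (s + t) / 2"
    have m: "s \<le> m" "m \<le> t" "t - m = (t - s) / 2" "m - s = (t - s) / 2"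
      using Suc.prems by (auto simp: m_def field_simps)
    define e where "e = ((t - s) / 2) powr \<theta>"
    have e: "e = 2 powr (- \<theta>) * (t - s) powr \<theta>"
      using Suc.prems by (simp add: e_def powr_divide powr_minus field_simps)
    have "f s t \<le> f m t + \<rho> * f s m + G * (t - s) powr \<theta>"
      unfolding m_def using Suc.prems by (rule rec)
    also have "\<dots> \<le> c * e + \<rho> * (c * e) + G * (t - s) powr \<theta>"
    proof (intro add_mono mult_left_mono order.refl)
      show "f m t \<le> c * e"
        using Suc.IH[of m t] Suc.prems m unfolding c_def e_def by simp
      show "f s m \<le> c * e"
        using Suc.IH[of s m] Suc.prems m unfolding c_def e_def by simp
    qed (use \<rho> G in auto)
    also have "\<dots> \<le> \<rho> * (c * e) + \<rho> * (c * e) + G * (t - s) powr \<theta>"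
      using \<rho> c mult_right_mono[of 1 \<rho> "c * e"] by (simp add: e_def)
    also have "\<dots> = (q * c + G) * (t - s) powr \<theta>"
      unfolding e q(1)[symmetric] by (simp add: algebra_simps)
    also have "q * c + G = q ^ Suc n * K + G / (1 - q)"
      using q(2) by (simp add: c_def field_simps)
    finally show ?case .
  qed
  have "(\<lambda>n. q ^ n) \<longlonglongrightarrow> 0" using q0 q(2) by (intro LIMSEQ_realpow_zero)
  then have "(\<lambda>n. (q ^ n * K + G / (1 - q)) * (t - s) powr \<theta>) \<longlonglongrightarrow> (0 * K + G / (1 - q)) * (t - s) powr \<theta>"
    by (intro tendsto_mult tendsto_add tendsto_const)
  then have "f s t \<le> (0 * K + G / (1 - q)) * (t - s) powr \<theta>"
    by (rule LIMSEQ_le_const) (use *[OF st] in blast)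
  then show ?thesis by simp
qed

text \<open>\<open>\<Delta>\<close> is the local remainder of \<open>z\<close>, up to an error of
  size \<open>e\<close> that stands for a perturbation of the equation. The constant
  \<open>B\<close> is fixed before \<open>L\<close>, \<open>z\<close>, \<open>\<Delta>\<close>,
  \<open>e\<close> and \<open>K\<close> are given; this order of quantifiers makes the later bounds
  uniform over a family. \<open>K\<close> is absent from the conclusion, so a remainder bound that
  is not uniform may be fed in.\<close>

lemma rough_gronwall:
  fixes C a \<theta> T :: real
  assumes "0 \<le> C" "0 < a" "1 < \<theta>" "0 < T"
  obtains B where "0 \<le> B"
    "\<And>L (z :: real \<Rightarrow> 'v::euclidean_space) \<Delta> e K. \<lbrakk>rough_flow L C a \<theta> T; 0 \<le> e; 0 \<le> K;
      \<And>s u t. \<lbrakk>0 \<le> s; s \<le> u; u \<le> t; t \<le> T\<rbrakk> \<Longrightarrow>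
        norm (\<Delta> s t - \<Delta> u t - L u t (\<Delta> s u)) \<le> C * (e + norm (z s)) * (t - s) powr \<theta>;
      \<And>s t. \<lbrakk>0 \<le> s; s \<le> t; t \<le> T\<rbrakk> \<Longrightarrow> norm (\<Delta> s t) \<le> K * (t - s) powr \<theta>;
      \<And>s t. \<lbrakk>0 \<le> s; s \<le> t; t \<le> T\<rbrakk> \<Longrightarrow> norm (z t - L s t (z s) - \<Delta> s t) \<le> C * e\<rbrakk> \<Longrightarrow>
      (\<forall>t. 0 \<le> t \<and> t \<le> T \<longrightarrow> norm (z t) \<le> B * (norm (z 0) + e)) \<and>
      (\<forall>s t. 0 \<le> s \<and> s \<le> t \<and> t \<le> T \<longrightarrow> norm (\<Delta> s t) \<le> B * (norm (z 0) + e) * (t - s) powr \<theta>)"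
proof -
  define \<rho> where "\<rho> = (1 + 2 powr (\<theta> - 1)) / 2"
  define q where "q = 2 * \<rho> * 2 powr (- \<theta>)"
  have two: "1 < 2 powr (\<theta> - 1)" using assms by simp
  then have \<rho>: "1 < \<rho>" by (simp add: \<rho>_def)
  have "q = (2 powr (1 - \<theta>) + 1) / 2"
    by (simp add: q_def \<rho>_def powr_diff powr_minus field_simps)
  moreover have "2 powr (1 - \<theta>) < (1::real)"
    using assms by (simp add: powr_less_one)
  ultimately have q: "q < 1" by simp
  define C2 where "C2 = C / (1 - q)"
  have C2: "0 \<le> C2" using q assms by (simp add: C2_def)
  have th0: "0 < \<theta>" using assms by simp
  obtain h where h: "0 < h" "1 + C * h powr a \<le> \<rho>" "C2 * h powr \<theta> \<le> 1 / 2"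
  proof -
    \<comment> \<open>The cap 3/2 gives \<open>C2 * h powr \<theta> \<le> 1 / 2\<close>, which
      allows half of a supremum to be absorbed below.\<close>
    define \<rho>' where "\<rho>' = min \<rho> (3/2)"
    obtain h where h: "0 < h" "(1 + C * h powr a) * (1 + C * h powr a + C2 * h powr \<theta>) \<le> \<rho>'"
      "C2 * h powr \<theta> \<le> \<rho>' - 1"
      using small_step_exists[OF assms(2) th0, of \<rho>' C C2] \<rho> by (auto simp: \<rho>'_def)
    have "(1 + C * h powr a) * 1 \<le> (1 + C * h powr a) * (1 + C * h powr a + C2 * h powr \<theta>)"
      using assms C2 by (intro mult_left_mono) auto
    then show ?thesis using that[of h] h by (auto simp: \<rho>'_def)
  qed
  \<comment> \<open>The growth factor of \<open>norm (z t) + e\<close> over one stretch of length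
    \<open>h\<close>; its summands are what the absorption in \<open>cell\<close> leaves
    behind.\<close>
  define \<kappa> where "\<kappa> = 2 * \<rho> + 2 * C + 2"
  have \<kappa>: "1 \<le> \<kappa>" using \<rho> assms by (simp add: \<kappa>_def)
  define N where "N = nat \<lceil>T / h\<rceil>"
  have N: "T \<le> real N * h"
    using h(1) assms unfolding N_def by (metis divide_le_eq of_nat_ceiling)
  define B1 where "B1 = \<kappa> ^ N"
  have B1: "1 \<le> B1" using \<kappa> by (simp add: B1_def)
  define B where "B = B1 + C2 * B1 + (B1 + (1 + C * T powr a) * B1 + C) / h powr \<theta>"
  have B: "0 \<le> B" using B1 C2 assms by (simp add: B_def)
  show ?thesis
  proof (rule that[OF B])
    fix L and z :: "real \<Rightarrow> 'v" and \<Delta> e K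
    assume L: "rough_flow L C a \<theta> T" and e: "0 \<le> e" and K: "0 \<le> K"
      and rec: "\<And>s u t. \<lbrakk>0 \<le> s; s \<le> u; u \<le> t; t \<le> T\<rbrakk> \<Longrightarrow>
        norm (\<Delta> s t - \<Delta> u t - L u t (\<Delta> s u)) \<le> C * (e + norm (z s)) * (t - s) powr \<theta>"
      and bd: "\<And>s t. \<lbrakk>0 \<le> s; s \<le> t; t \<le> T\<rbrakk> \<Longrightarrow> norm (\<Delta> s t) \<le> K * (t - s) powr \<theta>"
      and z: "\<And>s t. \<lbrakk>0 \<le> s; s \<le> t; t \<le> T\<rbrakk> \<Longrightarrow> norm (z t - L s t (z s) - \<Delta> s t) \<le> C * e"
    interpret rough_flow L C a \<theta> T by fact
    have z_le: "norm (z t) \<le> norm (\<Delta> s t) + norm (L s t (z s)) + C * e"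
      if "0 \<le> s" "s \<le> t" "t \<le> T" for s t
    proof -
      have "z t = \<Delta> s t + L s t (z s) + (z t - L s t (z s) - \<Delta> s t)" by simp
      also have "norm \<dots> \<le> norm (\<Delta> s t) + norm (L s t (z s)) + C * e"
        using z[OF that] by (intro norm_triangle_mono norm_triangle_ineq)
      finally show ?thesis .
    qed
    have z_bdd: "norm (z t) \<le> K * T powr \<theta> + (1 + C * T powr a) * norm (z 0) + C * e"
      if "0 \<le> t" "t \<le> T" for t
    proof -
      have "norm (z t) \<le> norm (\<Delta> 0 t) + norm (L 0 t (z 0)) + C * e"
        using that by (intro z_le) auto
      moreover have "norm (\<Delta> 0 t) \<le> K * t powr \<theta>" using bd[of 0 t] that by simp
      moreover have "K * t powr \<theta> \<le> K * T powr \<theta>"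
        using that K th0 by (intro mult_left_mono powr_mono2) auto
      moreover have "norm (L 0 t (z 0)) \<le> (1 + C * T powr a) * norm (z 0)"
        using that by (intro L_norm_le) auto
      ultimately show ?thesis by linarith
    qed
    have small: "norm (\<Delta> s t) \<le> C2 * (e + Z) * (t - s) powr \<theta>"
      if pb: "0 \<le> p" "p \<le> b" "b \<le> T" "b - p \<le> h"
        and Z: "\<And>t. \<lbrakk>p \<le> t; t \<le> b\<rbrakk> \<Longrightarrow> norm (z t) \<le> Z"
        and st: "p \<le> s" "s \<le> t" "t \<le> b" for p b Z s t
    proof -
      have Z0: "0 \<le> Z" using Z[of p] pb norm_ge_zero order_trans by blast
      have "norm (\<Delta> s t) \<le> C * (e + Z) / (1 - q) * (t - s) powr \<theta>"
      proof (rule midpoint_contraction[OF _ _ q_def[symmetric] q _ _ K st])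
        fix s t assume st: "p \<le> s" "s \<le> t" "t \<le> b"
        define m where "m = (s + t) / 2"
        have m: "s \<le> m" "m \<le> t" using st by (auto simp: m_def)
        have "norm (\<Delta> s t) \<le> norm (\<Delta> m t) + norm (L m t (\<Delta> s m))
          + norm (\<Delta> s t - \<Delta> m t - L m t (\<Delta> s m))"
          by norm
        also have "norm (L m t (\<Delta> s m)) \<le> (1 + C * h powr a) * norm (\<Delta> s m)"
          using st m pb by (intro L_norm_le) auto
        also have "\<dots> \<le> \<rho> * norm (\<Delta> s m)"
          using h by (intro mult_right_mono) auto
        also have "norm (\<Delta> s t - \<Delta> m t - L m t (\<Delta> s m)) \<le> C * (e + norm (z s)) * (t - s) powr \<theta>"
          using st m pb by (intro rec) auto
        also have "\<dots> \<le> C * (e + Z) * (t - s) powr \<theta>"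
          using Z[of s] st assms by (intro mult_right_mono mult_left_mono) auto
        finally show "norm (\<Delta> s t) \<le> norm (\<Delta> ((s + t) / 2) t) + \<rho> * norm (\<Delta> s ((s + t) / 2))
          + C * (e + Z) * (t - s) powr \<theta>"
          by (simp add: m_def)
      qed (use bd pb \<rho> assms e Z0 in auto)
      then show ?thesis by (simp add: C2_def)
    qed
    have cell: "norm (z t) + e \<le> \<kappa> * (norm (z p) + e)"
      if "0 \<le> p" "p \<le> t" "t \<le> T" "t - p \<le> h" for p t
    proof -
      \<comment> \<open>The supremum is finite by \<open>z_bdd\<close>, whose bound involves
        \<open>K\<close>. Only its finiteness matters: it allows \<open>Z\<close> to be cancelled
        against \<open>Z / 2\<close>.\<close>
      define Z where "Z = (SUP r\<in>{p..t}. norm (z r))"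
      have bdd: "bdd_above ((\<lambda>r. norm (z r)) ` {p..t})"
        using z_bdd that
        by (intro bdd_aboveI2[where M = "K * T powr \<theta> + (1 + C * T powr a) * norm (z 0) + C * e"]) auto
      have Z: "norm (z r) \<le> Z" if "p \<le> r" "r \<le> t" for r
        unfolding Z_def using that bdd by (intro cSUP_upper) auto
      have Z0: "0 \<le> Z" using Z[of p] that norm_ge_zero order_trans by blast
      have "norm (z r) \<le> (e + Z) / 2 + \<rho> * norm (z p) + C * e" if r: "p \<le> r" "r \<le> t" for r
      proof -
        have "norm (z r) \<le> norm (\<Delta> p r) + norm (L p r (z p)) + C * e"
          using that \<open>0 \<le> p\<close> \<open>t \<le> T\<close> by (intro z_le) auto
        moreover have "norm (\<Delta> p r) \<le> C2 * (e + Z) * (r - p) powr \<theta>"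
          using r Z \<open>0 \<le> p\<close> \<open>t \<le> T\<close> \<open>t - p \<le> h\<close> by (intro small[of p r]) auto
        moreover have "C2 * (e + Z) * (r - p) powr \<theta> \<le> C2 * (e + Z) * h powr \<theta>"
          using r \<open>t - p \<le> h\<close> C2 Z0 e th0 by (intro mult_left_mono powr_mono2) auto
        moreover have "C2 * (e + Z) * h powr \<theta> = C2 * h powr \<theta> * (e + Z)"
          by simp
        moreover have "C2 * h powr \<theta> * (e + Z) \<le> (1 / 2) * (e + Z)"
          using h Z0 e by (intro mult_right_mono) auto
        moreover have "norm (L p r (z p)) \<le> (1 + C * h powr a) * norm (z p)"
          using r \<open>0 \<le> p\<close> \<open>t \<le> T\<close> \<open>t - p \<le> h\<close> by (intro L_norm_le) auto
        moreover have "(1 + C * h powr a) * norm (z p) \<le> \<rho> * norm (z p)"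
          using h by (intro mult_right_mono) auto
        ultimately show ?thesis by linarith
      qed
      then have "Z \<le> (e + Z) / 2 + \<rho> * norm (z p) + C * e"
        unfolding Z_def using that by (intro cSUP_least) (auto simp: Z_def)
      moreover have "x \<le> e + 2 * v + 2 * w" if "x \<le> (e + x) / 2 + v + w" for x v w :: real
        using that by (simp add: field_simps)
      ultimately have "Z \<le> e + 2 * (\<rho> * norm (z p)) + 2 * (C * e)"
        by blast
      then have "Z \<le> 2 * \<rho> * norm (z p) + (2 * C + 1) * e"
        by (simp add: algebra_simps)
      moreover have "norm (z t) \<le> Z" using Z that by auto
      moreover have "2 * \<rho> * norm (z p) + (2 * C + 1) * e + e \<le> \<kappa> * (norm (z p) + e)"
        using assms \<rho> e mult_nonneg_nonneg[of "2 * C + 2" "norm (z p)"] mult_nonneg_nonneg[of "2 * \<rho>" e]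
        by (simp add: \<kappa>_def algebra_simps)
      ultimately show ?thesis by simp
    qed
    have grow: "norm (z t) + e \<le> \<kappa> ^ k * (norm (z 0) + e)"
      if "0 \<le> t" "t \<le> T" "t \<le> real k * h" for k t
      using that
    proof (induction k arbitrary: t)
      case 0
      then show ?case by simp
    next
      case (Suc k)
      define p where "p = max 0 (t - h)"
      have p: "0 \<le> p" "p \<le> t" "p \<le> T" "p \<le> real k * h" "t - p \<le> h"
        using Suc.prems h by (auto simp: p_def algebra_simps)
      have "norm (z t) + e \<le> \<kappa> * (norm (z p) + e)"
        using p Suc.prems by (intro cell) auto
      also have "\<dots> \<le> \<kappa> * (\<kappa> ^ k * (norm (z 0) + e))"
        using p \<kappa> by (intro mult_left_mono Suc.IH) auto
      finally show ?case by (simp add: mult_ac)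
    qed
    define E where "E = norm (z 0) + e"
    have E: "0 \<le> E" using e by (simp add: E_def)
    have zB: "norm (z t) + e \<le> B1 * E" if "0 \<le> t" "t \<le> T" for t
      unfolding B1_def E_def using N that by (intro grow) auto
    have part1: "norm (z t) \<le> B * E" if "0 \<le> t" "t \<le> T" for t
    proof -
      have "B1 * E \<le> B * E"
        using E C2 B1 assms by (intro mult_right_mono) (auto simp: B_def)
      then show ?thesis using zB[OF that] e by simp
    qed
    have part2: "norm (\<Delta> s t) \<le> B * E * (t - s) powr \<theta>" if "0 \<le> s" "s \<le> t" "t \<le> T" for s t
    proof (cases "t - s \<le> h")
      case True
      \<comment> \<open>\<open>zB\<close> bounds \<open>norm (z t) + e\<close>, so
        \<open>B1 * E - e\<close> is an admissible bound for \<open>z\<close> and the two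
        occurrences of \<open>e\<close> cancel.\<close>
      have "norm (\<Delta> s t) \<le> C2 * (e + (B1 * E - e)) * (t - s) powr \<theta>"
        using that True zB by (intro small[of s t]) (auto simp: algebra_simps)
      also have "\<dots> = (C2 * B1) * (E * (t - s) powr \<theta>)" by simp
      also have "\<dots> \<le> B * (E * (t - s) powr \<theta>)"
        using E B1 C2 assms by (intro mult_right_mono) (auto simp: B_def)
      finally show ?thesis by (simp add: mult_ac)
    next
      case False
      have "norm (\<Delta> s t) \<le> norm (z t) + norm (L s t (z s)) + norm (z t - L s t (z s) - \<Delta> s t)"
        by norm
      also have "\<dots> \<le> B1 * E + (1 + C * T powr a) * (B1 * E) + C * E"
      proof (intro add_mono)
        show "norm (z t) \<le> B1 * E" using zB[of t] that e by auto
        have "norm (L s t (z s)) \<le> (1 + C * T powr a) * norm (z s)"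
          using that by (intro L_norm_le) auto
        also have "\<dots> \<le> (1 + C * T powr a) * (B1 * E)"
          using zB[of s] that e assms by (intro mult_left_mono) auto
        finally show "norm (L s t (z s)) \<le> (1 + C * T powr a) * (B1 * E)" .
        have "C * e \<le> C * E" using assms by (intro mult_left_mono) (auto simp: E_def)
        then show "norm (z t - L s t (z s) - \<Delta> s t) \<le> C * E"
          using z[OF that] by simp
      qed
      also have "\<dots> = ((B1 + (1 + C * T powr a) * B1 + C) * E) * 1"
        by (simp add: algebra_simps)
      also have "\<dots> \<le> ((B1 + (1 + C * T powr a) * B1 + C) * E) * ((t - s) powr \<theta> / h powr \<theta>)"
        using False h(1) th0 B1 E assms powr_mono2[of \<theta> h "t - s"]
        by (intro mult_left_mono) auto
      also have "\<dots> = ((B1 + (1 + C * T powr a) * B1 + C) / h powr \<theta>) * (E * (t - s) powr \<theta>)"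
        by simp
      also have "\<dots> \<le> B * (E * (t - s) powr \<theta>)"
        using E B1 C2 assms by (intro mult_right_mono) (auto simp: B_def)
      finally show ?thesis by (simp add: mult_ac)
    qed
    show "(\<forall>t. 0 \<le> t \<and> t \<le> T \<longrightarrow> norm (z t) \<le> B * (norm (z 0) + e)) \<and>
      (\<forall>s t. 0 \<le> s \<and> s \<le> t \<and> t \<le> T \<longrightarrow> norm (\<Delta> s t) \<le> B * (norm (z 0) + e) * (t - s) powr \<theta>)"
      using part1 part2 unfolding E_def by blast
  qed
qed

section \<open>Linear rough equations over a family of data\<close>

context data_family
begin

text \<open>Solutions are chosen separately for each index. The rough Gronwall inequality is then
  used twice: with \<open>z = y i\<close> and \<open>e = 0\<close> for uniform bounds, and with
  \<open>z = y i - y j\<close> and \<open>e = d i j\<close> for Lipschitz bounds. The action is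
  abstract because the flow is driven by multiplication from the left and its inverse by
  multiplication from the right, with \<open>mul\<close> reversed.\<close>

lemma linear_rough_equation:
  fixes act :: "'m::real_normed_vector \<Rightarrow> 'v::euclidean_space \<Rightarrow> 'v" and M :: "'i \<Rightarrow> real \<Rightarrow> real \<Rightarrow> 'm"
  assumes act: "bounded_bilinear act"
    and mul: "\<And>m n v. act (mul m n) v = act m (act n v)" and one: "\<And>v. act one v = v"
    and M: "lbd a (\<lambda>i s u t. M i s t - one)" "0 < a"
    and def: "lbd \<theta> (\<lambda>i s u t. M i s t - mul (M i u t) (M i s u))" "1 < \<theta>"
    and y0: "lbd 0 (\<lambda>i s u t. y0 i)"
  shows "\<exists>y. (\<forall>i\<in>A. y i 0 = y0 i) \<and> lbd 0 (\<lambda>i s u t. y i t) \<and>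
    lbd \<theta> (\<lambda>i s u t. y i t - act (M i s t) (y i s))"
proof -
  interpret act: bounded_bilinear act by fact
  obtain Ka where Ka: "Ka > 0" "\<And>x y. norm (act x y) \<le> norm x * norm y * Ka"
    using act.pos_bounded by blast
  obtain K1 where K1: "0 \<le> K1"
    "\<And>i s u t. \<lbrakk>i \<in> A; 0 \<le> s; s \<le> u; u \<le> t; t \<le> T\<rbrakk> \<Longrightarrow> norm (M i s t - one) \<le> K1 * pw (t - s) a"
    "\<And>i j s u t. \<lbrakk>i \<in> A; j \<in> A; 0 \<le> s; s \<le> u; u \<le> t; t \<le> T\<rbrakk> \<Longrightarrow>
      norm (M i s t - one - (M j s t - one)) \<le> K1 * d i j * pw (t - s) a"
    using lbdE[OF M(1)] by metis
  let ?D = "\<lambda>i s u t. M i s t - mul (M i u t) (M i s u)"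
  obtain K2 where K2: "0 \<le> K2"
    "\<And>i s u t. \<lbrakk>i \<in> A; 0 \<le> s; s \<le> u; u \<le> t; t \<le> T\<rbrakk> \<Longrightarrow> norm (?D i s u t) \<le> K2 * pw (t - s) \<theta>"
    "\<And>i j s u t. \<lbrakk>i \<in> A; j \<in> A; 0 \<le> s; s \<le> u; u \<le> t; t \<le> T\<rbrakk> \<Longrightarrow>
      norm (?D i s u t - ?D j s u t) \<le> K2 * d i j * pw (t - s) \<theta>"
    using lbdE[OF def(1)] by metis
  obtain K3 where K3: "0 \<le> K3" "\<And>i. i \<in> A \<Longrightarrow> norm (y0 i) \<le> K3"
    "\<And>i j. \<lbrakk>i \<in> A; j \<in> A\<rbrakk> \<Longrightarrow> norm (y0 i - y0 j) \<le> K3 * d i j"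
    using lbd_pointE[OF y0] T_pos by (metis order.refl less_imp_le)
  have pa: "pw x a = x powr a" "pw x \<theta> = x powr \<theta>" for x
    using M(2) def(2) by (auto simp: pw_def)
  have th0: "0 < \<theta>" using def(2) by simp
  define C where "C = (K1 + K2) * Ka"
  have C0: "0 \<le> C" using K1 K2 Ka by (simp add: C_def)
  have dist_M: "norm (M i s t - M j s t) \<le> K1 * d i j * (t - s) powr a"
    if "i \<in> A" "j \<in> A" "0 \<le> s" "s \<le> t" "t \<le> T" for i j s t
    using K1(3)[of i j s s t] that pa by simp
  have def_eq: "act (M i s t) v - act (M i u t) (act (M i s u) v) = act (?D i s u t) v" for i s u t v
    by (simp add: act.diff_left mul)
  have le1: "K1 * p * v * Ka \<le> C * p * v" "K2 * p * v * Ka \<le> C * p * v" if "0 \<le> p" "0 \<le> v" for p v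
    using that K1 K2 Ka by (auto simp: C_def algebra_simps)
  have flow: "rough_flow (\<lambda>s t. act (M i s t)) C' a \<theta> T" if i: "i \<in> A" and C': "C \<le> C'" for i C'
  proof (rule rough_flow.intro)
    fix s t assume st: "0 \<le> s" "s \<le> t" "t \<le> T"
    show "linear (act (M i s t))"
      by (rule bounded_linear.linear[OF act.bounded_linear_right])
  next
    fix s t v assume st: "0 \<le> s" "s \<le> t" "t \<le> T"
    have "norm (act (M i s t) v - v) = norm (act (M i s t - one) v)"
      by (simp add: act.diff_left one)
    also have "\<dots> \<le> norm (M i s t - one) * norm v * Ka" by (rule Ka)
    also have "\<dots> \<le> K1 * (t - s) powr a * norm v * Ka"
      using K1(2)[of i s s t] i st Ka pa by (intro mult_right_mono) auto
    also have "\<dots> \<le> C * (t - s) powr a * norm v" by (rule le1) auto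
    also have "\<dots> \<le> C' * (t - s) powr a * norm v" using C' by (intro mult_right_mono) auto
    finally show "norm (act (M i s t) v - v) \<le> C' * (t - s) powr a * norm v" .
  next
    fix s u t v assume st: "0 \<le> s" "s \<le> u" "u \<le> t" "t \<le> T"
    have "norm (act (M i s t) v - act (M i u t) (act (M i s u) v)) \<le> norm (?D i s u t) * norm v * Ka"
      unfolding def_eq by (rule Ka)
    also have "\<dots> \<le> K2 * (t - s) powr \<theta> * norm v * Ka"
      using K2(2)[of i s u t] i st Ka pa by (intro mult_right_mono) auto
    also have "\<dots> \<le> C * (t - s) powr \<theta> * norm v" by (rule le1) auto
    also have "\<dots> \<le> C' * (t - s) powr \<theta> * norm v" using C' by (intro mult_right_mono) auto
    finally show "norm (act (M i s t) v - act (M i u t) (act (M i s u) v)) \<le> C' * (t - s) powr \<theta> * norm v" .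
  qed (use M def T_pos C0 C' in auto)
  have "\<forall>i\<in>A. \<exists>y K. y 0 = y0 i \<and> 0 \<le> K \<and> (\<forall>s t. 0 \<le> s \<and> s \<le> t \<and> t \<le> T \<longrightarrow>
      norm (y t - act (M i s t) (y s)) \<le> K * (t - s) powr \<theta>)"
    using rough_flow.solution_exists[OF flow[OF _ order.refl]] by (intro ballI)
  then obtain y where "\<forall>i\<in>A. \<exists>K. y i 0 = y0 i \<and> 0 \<le> K \<and> (\<forall>s t. 0 \<le> s \<and> s \<le> t \<and> t \<le> T \<longrightarrow>
      norm (y i t - act (M i s t) (y i s)) \<le> K * (t - s) powr \<theta>)"
    unfolding bchoice_iff by blast
  then obtain K where "\<forall>i\<in>A. y i 0 = y0 i \<and> 0 \<le> K i \<and> (\<forall>s t. 0 \<le> s \<and> s \<le> t \<and> t \<le> T \<longrightarrow>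
      norm (y i t - act (M i s t) (y i s)) \<le> K i * (t - s) powr \<theta>)"
    unfolding bchoice_iff by blast
  then have y: "\<And>i. i \<in> A \<Longrightarrow> y i 0 = y0 i" "\<And>i. i \<in> A \<Longrightarrow> 0 \<le> K i"
    "\<And>i s t. \<lbrakk>i \<in> A; 0 \<le> s; s \<le> t; t \<le> T\<rbrakk> \<Longrightarrow>
      norm (y i t - act (M i s t) (y i s)) \<le> K i * (t - s) powr \<theta>"
    by blast+
  define J where "J i s t = y i t - act (M i s t) (y i s)" for i s t
  \<comment> \<open>The recursion asked for by the Gronwall inequality is an exact identity, with
    the multiplicative defect of \<open>M\<close> applied to \<open>y i s\<close> as source.\<close>
  have J_rec: "J i s t - J i u t - act (M i u t) (J i s u) = - act (?D i s u t) (y i s)" for i s u t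
    by (simp add: J_def act.diff_right def_eq[symmetric])
  obtain B1 where B1: "0 \<le> B1"
    "\<And>L (z :: real \<Rightarrow> 'v) \<Delta> e k. \<lbrakk>rough_flow L C a \<theta> T; 0 \<le> e; 0 \<le> k;
      \<And>s u t. \<lbrakk>0 \<le> s; s \<le> u; u \<le> t; t \<le> T\<rbrakk> \<Longrightarrow>
        norm (\<Delta> s t - \<Delta> u t - L u t (\<Delta> s u)) \<le> C * (e + norm (z s)) * (t - s) powr \<theta>;
      \<And>s t. \<lbrakk>0 \<le> s; s \<le> t; t \<le> T\<rbrakk> \<Longrightarrow> norm (\<Delta> s t) \<le> k * (t - s) powr \<theta>;
      \<And>s t. \<lbrakk>0 \<le> s; s \<le> t; t \<le> T\<rbrakk> \<Longrightarrow> norm (z t - L s t (z s) - \<Delta> s t) \<le> C * e\<rbrakk> \<Longrightarrow>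
      (\<forall>t. 0 \<le> t \<and> t \<le> T \<longrightarrow> norm (z t) \<le> B1 * (norm (z 0) + e)) \<and>
      (\<forall>s t. 0 \<le> s \<and> s \<le> t \<and> t \<le> T \<longrightarrow> norm (\<Delta> s t) \<le> B1 * (norm (z 0) + e) * (t - s) powr \<theta>)"
    by (fact rough_gronwall[OF C0 M(2) def(2) T_pos, where 'v = 'v])
  define E where "E = B1 * K3"
  have E0: "0 \<le> E" using B1 K3 by (simp add: E_def)
  have bound: "(\<forall>t. 0 \<le> t \<and> t \<le> T \<longrightarrow> norm (y i t) \<le> E) \<and>
     (\<forall>s t. 0 \<le> s \<and> s \<le> t \<and> t \<le> T \<longrightarrow> norm (J i s t) \<le> E * (t - s) powr \<theta>)" if i: "i \<in> A" for i
  proof -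
    have *: "(\<forall>t. 0 \<le> t \<and> t \<le> T \<longrightarrow> norm (y i t) \<le> B1 * (norm (y i 0) + 0)) \<and>
     (\<forall>s t. 0 \<le> s \<and> s \<le> t \<and> t \<le> T \<longrightarrow> norm (J i s t) \<le> B1 * (norm (y i 0) + 0) * (t - s) powr \<theta>)"
    proof (rule B1(2)[OF flow[OF i order.refl]])
      fix s u t assume st: "0 \<le> s" "s \<le> u" "u \<le> t" "t \<le> T"
      have "norm (J i s t - J i u t - act (M i u t) (J i s u))
        = norm (act (M i s t) (y i s) - act (M i u t) (act (M i s u) (y i s)))"
        unfolding J_rec def_eq by simp
      also have "\<dots> \<le> C * (t - s) powr \<theta> * norm (y i s)"
        using st by (intro rough_flow.defect[OF flow[OF i order.refl]])
      finally show "norm (J i s t - J i u t - act (M i u t) (J i s u)) \<le> C * (0 + norm (y i s)) * (t - s) powr \<theta>"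
        by (simp add: mult_ac)
    next
      show "norm (J i s t) \<le> K i * (t - s) powr \<theta>" if "0 \<le> s" "s \<le> t" "t \<le> T" for s t
        using y(3)[OF i that] by (simp add: J_def)
    qed (use y i in \<open>auto simp: J_def\<close>)
    have "B1 * (norm (y i 0) + 0) \<le> E"
      unfolding E_def using K3(2)[OF i] y(1)[OF i] B1 by (intro mult_left_mono) auto
    with * show ?thesis
      by (meson mult_right_mono order_trans powr_ge_zero)
  qed
  \<comment> \<open>The difference of two solutions is propagated by the maps of \<open>i\<close>;
    what the maps of \<open>j\<close> do differently is a source proportional to
    \<open>d i j\<close>. \<open>C'\<close> is large enough to cover these sources. It involves
    \<open>E\<close>, hence it is fixed only after the uniform bounds.\<close>
  define C' where "C' = C + (2 * K1 * E * T powr a + 2 * K2 * E + K2) * Ka"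
  have C'C: "C \<le> C'" using K1 K2 Ka E0 by (simp add: C'_def)
  have C'0: "0 \<le> C'" using C0 C'C by simp
  obtain B2 where B2: "0 \<le> B2"
    "\<And>L (z :: real \<Rightarrow> 'v) \<Delta> e k. \<lbrakk>rough_flow L C' a \<theta> T; 0 \<le> e; 0 \<le> k;
      \<And>s u t. \<lbrakk>0 \<le> s; s \<le> u; u \<le> t; t \<le> T\<rbrakk> \<Longrightarrow>
        norm (\<Delta> s t - \<Delta> u t - L u t (\<Delta> s u)) \<le> C' * (e + norm (z s)) * (t - s) powr \<theta>;
      \<And>s t. \<lbrakk>0 \<le> s; s \<le> t; t \<le> T\<rbrakk> \<Longrightarrow> norm (\<Delta> s t) \<le> k * (t - s) powr \<theta>;
      \<And>s t. \<lbrakk>0 \<le> s; s \<le> t; t \<le> T\<rbrakk> \<Longrightarrow> norm (z t - L s t (z s) - \<Delta> s t) \<le> C' * e\<rbrakk> \<Longrightarrow>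
      (\<forall>t. 0 \<le> t \<and> t \<le> T \<longrightarrow> norm (z t) \<le> B2 * (norm (z 0) + e)) \<and>
      (\<forall>s t. 0 \<le> s \<and> s \<le> t \<and> t \<le> T \<longrightarrow> norm (\<Delta> s t) \<le> B2 * (norm (z 0) + e) * (t - s) powr \<theta>)"
    by (fact rough_gronwall[OF C'0 M(2) def(2) T_pos, where 'v = 'v])
  define E' where "E' = B2 * (K3 + 1)"
  have E'0: "0 \<le> E'" using B2 K3 by (simp add: E'_def)
  have lip: "(\<forall>t. 0 \<le> t \<and> t \<le> T \<longrightarrow> norm (y i t - y j t) \<le> E' * d i j) \<and>
     (\<forall>s t. 0 \<le> s \<and> s \<le> t \<and> t \<le> T \<longrightarrow> norm (J i s t - J j s t) \<le> E' * d i j * (t - s) powr \<theta>)"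
    if i: "i \<in> A" and j: "j \<in> A" for i j
  proof -
    let ?e = "d i j"
    have e0: "0 \<le> ?e" using d_nonneg i j by simp
    have *: "(\<forall>t. 0 \<le> t \<and> t \<le> T \<longrightarrow> norm (y i t - y j t) \<le> B2 * (norm (y i 0 - y j 0) + ?e)) \<and>
     (\<forall>s t. 0 \<le> s \<and> s \<le> t \<and> t \<le> T \<longrightarrow>
       norm (J i s t - J j s t) \<le> B2 * (norm (y i 0 - y j 0) + ?e) * (t - s) powr \<theta>)"
    proof (rule B2(2)[OF flow[OF i C'C] e0])
      fix s u t assume st: "0 \<le> s" "s \<le> u" "u \<le> t" "t \<le> T"
      have eq: "J i s t - J j s t - (J i u t - J j u t) - act (M i u t) (J i s u - J j s u)
        = act (M i u t - M j u t) (J j s u)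
          - (act (?D i s u t) (y i s - y j s) + act (?D i s u t - ?D j s u t) (y j s))"
        by (simp add: J_def mul act.diff_left act.diff_right act.add_left act.add_right algebra_simps)
      have ts: "0 \<le> (t - s) powr \<theta>" by simp
      have t1: "norm (act (M i u t - M j u t) (J j s u)) \<le> (K1 * ?e * T powr a) * (E * (t - s) powr \<theta>) * Ka"
      proof -
        have "norm (M i u t - M j u t) \<le> K1 * ?e * (t - u) powr a"
          using st i j by (intro dist_M) auto
        also have "\<dots> \<le> K1 * ?e * T powr a"
          using st K1 e0 M by (intro mult_left_mono powr_mono2) auto
        finally have 1: "norm (M i u t - M j u t) \<le> K1 * ?e * T powr a" .
        have "norm (J j s u) \<le> E * (u - s) powr \<theta>" using bound[OF j] st by auto
        also have "\<dots> \<le> E * (t - s) powr \<theta>"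
          using st E0 th0 by (intro mult_left_mono powr_mono2) auto
        finally have 2: "norm (J j s u) \<le> E * (t - s) powr \<theta>" .
        show ?thesis
          using K1 e0 Ka by (intro order_trans[OF Ka(2)] mult_right_mono mult_mono 1 2) auto
      qed
      have t2: "norm (act (?D i s u t) (y i s - y j s)) \<le> (K2 * (t - s) powr \<theta>) * norm (y i s - y j s) * Ka"
        using K2(2)[of i s u t] st i Ka pa by (intro order_trans[OF Ka(2)] mult_right_mono) auto
      have t3: "norm (act (?D i s u t - ?D j s u t) (y j s)) \<le> (K2 * ?e * (t - s) powr \<theta>) * E * Ka"
        using K2(3)[of i j s u t] bound[OF j] st i j Ka pa e0 K2(1)
        by (intro order_trans[OF Ka(2)] mult_right_mono mult_mono) auto
      have "norm (J i s t - J j s t - (J i u t - J j u t) - act (M i u t) (J i s u - J j s u))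
        \<le> (K1 * ?e * T powr a) * (E * (t - s) powr \<theta>) * Ka
         + ((K2 * (t - s) powr \<theta>) * norm (y i s - y j s) * Ka + (K2 * ?e * (t - s) powr \<theta>) * E * Ka)"
        unfolding eq by (rule order_trans[OF norm_triangle_ineq4], rule add_mono[OF t1],
            rule norm_triangle_mono[OF t2 t3])
      also have "\<dots> = ((K1 * E * T powr a + K2 * E) * Ka * ?e + K2 * Ka * norm (y i s - y j s)) * (t - s) powr \<theta>"
        by (simp add: algebra_simps)
      also have "\<dots> \<le> (C' * ?e + C' * norm (y i s - y j s)) * (t - s) powr \<theta>"
        using K1 K2 E0 Ka e0 C0 by (intro mult_right_mono add_mono) (auto simp: C'_def algebra_simps)
      finally show "norm (J i s t - J j s t - (J i u t - J j u t) - act (M i u t) (J i s u - J j s u))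
        \<le> C' * (?e + norm (y i s - y j s)) * (t - s) powr \<theta>"
        by (simp add: algebra_simps)
    next
      fix s t assume st: "0 \<le> s" "s \<le> t" "t \<le> T"
      show "norm (J i s t - J j s t) \<le> 2 * E * (t - s) powr \<theta>"
      proof -
        have "norm (J i s t) \<le> E * (t - s) powr \<theta>" "norm (J j s t) \<le> E * (t - s) powr \<theta>"
          using bound[OF i] bound[OF j] st by blast+
        from add_mono[OF this] show ?thesis
          using norm_triangle_ineq4[of "J i s t" "J j s t"] by simp
      qed
      have eq: "y i t - y j t - act (M i s t) (y i s - y j s) - (J i s t - J j s t)
        = act (M i s t - M j s t) (y j s)"
        by (simp add: J_def act.diff_left act.diff_right act.add_left act.add_right algebra_simps)
      have "norm (M i s t - M j s t) \<le> K1 * ?e * (t - s) powr a"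
        using st i j by (intro dist_M) auto
      also have "\<dots> \<le> K1 * ?e * T powr a"
        using st K1 e0 M by (intro mult_left_mono powr_mono2) auto
      finally have 1: "norm (M i s t - M j s t) \<le> K1 * ?e * T powr a" .
      have "norm (act (M i s t - M j s t) (y j s)) \<le> (K1 * ?e * T powr a) * E * Ka"
        using 1 bound[OF j] st Ka e0 K1(1)
        by (intro order_trans[OF Ka(2)] mult_right_mono mult_mono) auto
      also have "\<dots> = (K1 * E * T powr a * Ka) * ?e" by simp
      also have "\<dots> \<le> C' * ?e"
        using K1 K2 E0 Ka e0 C0 by (intro mult_right_mono) (auto simp: C'_def algebra_simps)
      finally show "norm (y i t - y j t - act (M i s t) (y i s - y j s) - (J i s t - J j s t)) \<le> C' * ?e"
        unfolding eq .
    qed (use E0 in auto)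
    have "norm (y i 0 - y j 0) + ?e \<le> (K3 + 1) * ?e"
      using K3(3)[OF i j] y(1) i j by (simp add: algebra_simps)
    then have "B2 * (norm (y i 0 - y j 0) + ?e) \<le> E' * ?e"
      unfolding E'_def using B2 mult_left_mono by (fastforce simp: mult.assoc)
    with * show ?thesis
      by (meson mult_right_mono order_trans powr_ge_zero)
  qed
  have "lbd 0 (\<lambda>i s u t. y i t)"
  proof (rule lbd_pointI[of "E + E'"])
    fix i t assume *: "i \<in> A" "0 \<le> t" "t \<le> T"
    then show "norm (y i t) \<le> E + E'" using bound[of i] E'0 by force
  next
    fix i j t assume *: "i \<in> A" "j \<in> A" "0 \<le> t" "t \<le> T"
    then have "norm (y i t - y j t) \<le> E' * d i j" using lip[of i j] by blast
    also have "\<dots> \<le> (E + E') * d i j" using E0 d_nonneg * by (intro mult_right_mono) auto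
    finally show "norm (y i t - y j t) \<le> (E + E') * d i j" .
  qed (use E0 E'0 in simp)
  moreover have "lbd \<theta> (\<lambda>i s u t. J i s t)"
  proof (rule lbdI[of "E + E'"])
    fix i s u t assume *: "i \<in> A" "0 \<le> s" "s \<le> u" "u \<le> t" "t \<le> T"
    have "norm (J i s t) \<le> E * (t - s) powr \<theta>" using bound[of i] * by auto
    also have "\<dots> \<le> (E + E') * (t - s) powr \<theta>" using E'0 by (intro mult_right_mono) auto
    finally show "norm (J i s t) \<le> (E + E') * pw (t - s) \<theta>" by (simp add: pa)
  next
    fix i j s u t assume *: "i \<in> A" "j \<in> A" "0 \<le> s" "s \<le> u" "u \<le> t" "t \<le> T"
    have "norm (J i s t - J j s t) \<le> E' * d i j * (t - s) powr \<theta>" using lip[of i j] * by auto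
    also have "\<dots> \<le> (E + E') * d i j * (t - s) powr \<theta>"
      using E0 d_nonneg * by (intro mult_right_mono) auto
    finally show "norm (J i s t - J j s t) \<le> (E + E') * d i j * pw (t - s) \<theta>" by (simp add: pa)
  qed (use E0 E'0 in auto)
  ultimately show ?thesis
    using y(1) unfolding J_def by blast
qed

end

section \<open>Lipschitz paths as integrals\<close>

text \<open>Bounded, rather than merely integrable, coefficients form a class stable under bilinear
  operations, and their integrals are Lipschitz in time.\<close>

definition bmeas :: "real \<Rightarrow> (real \<Rightarrow> 'a::euclidean_space) \<Rightarrow> bool" where
  "bmeas T f \<longleftrightarrow> bounded (f ` {0..T}) \<and> f \<in> borel_measurable (lebesgue_on {0..T})"

lemma bmeas_bound:
  assumes "bmeas T f"
  obtains K where "0 < K" "\<And>t. \<lbrakk>0 \<le> t; t \<le> T\<rbrakk> \<Longrightarrow> norm (f t) \<le> K"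
  using assms unfolding bmeas_def bounded_pos by (metis atLeastAtMost_iff imageI)

lemma bmeas_continuous: "continuous_on {0..T} f \<Longrightarrow> bmeas T f"
  by (simp add: bmeas_def compact_imp_bounded compact_continuous_image
      continuous_imp_measurable_on_sets_lebesgue)

lemma bmeas_bilinear:
  fixes B :: "'a::euclidean_space \<Rightarrow> 'b::euclidean_space \<Rightarrow> 'c::euclidean_space"
  assumes B: "bounded_bilinear B" and f: "bmeas T f" and g: "bmeas T g"
  shows "bmeas T (\<lambda>t. B (f t) (g t))"
  unfolding bmeas_def
proof
  interpret bounded_bilinear B by fact
  have "continuous_on UNIV (\<lambda>x. B (fst x) (snd x))"
    by (rule continuous_on[OF continuous_on_fst[OF continuous_on_id] continuous_on_snd[OF continuous_on_id]])
  then show "(\<lambda>t. B (f t) (g t)) \<in> borel_measurable (lebesgue_on {0..T})"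
    using f g unfolding bmeas_def by (blast intro: borel_measurable_continuous_Pair)
  obtain C where C: "C > 0" "\<And>x y. norm (B x y) \<le> norm x * norm y * C"
    using pos_bounded by blast
  obtain K where K: "0 < K" "\<And>t. \<lbrakk>0 \<le> t; t \<le> T\<rbrakk> \<Longrightarrow> norm (f t) \<le> K"
    using bmeas_bound[OF f] by blast
  obtain L where L: "0 < L" "\<And>t. \<lbrakk>0 \<le> t; t \<le> T\<rbrakk> \<Longrightarrow> norm (g t) \<le> L"
    using bmeas_bound[OF g] by blast
  have "norm (B (f t) (g t)) \<le> K * L * C" if "0 \<le> t" "t \<le> T" for t
    using that K L C by (intro order_trans[OF C(2)] mult_right_mono mult_mono) auto
  then show "bounded ((\<lambda>t. B (f t) (g t)) ` {0..T})"
    unfolding bounded_iff by (intro exI[of _ "K * L * C"]) auto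
qed

lemma bmeas_linear:
  fixes F :: "'a::euclidean_space \<Rightarrow> 'b::euclidean_space"
  assumes "bounded_linear F" "bmeas T f"
  shows "bmeas T (\<lambda>t. F (f t))"
proof -
  have "(\<lambda>t. F (f t)) \<in> borel_measurable (lebesgue_on {0..T})"
    using assms(2) bounded_linear.continuous_on[OF assms(1) continuous_on_id]
    unfolding bmeas_def by (blast intro: measurable_compose[OF _ borel_measurable_continuous_onI])
  moreover have "bounded (F ` (f ` {0..T}))"
    using assms bounded_linear_image[of "f ` {0..T}" F] by (simp add: bmeas_def)
  ultimately show ?thesis
    by (simp add: bmeas_def image_image)
qed

lemma bmeas_add: "bmeas T f \<Longrightarrow> bmeas T g \<Longrightarrow> bmeas T (\<lambda>t. f t + g t)"
  unfolding bmeas_def by (auto intro: bounded_plus_comp)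

lemma bmeas_diff: "bmeas T f \<Longrightarrow> bmeas T g \<Longrightarrow> bmeas T (\<lambda>t. f t - g t)"
  unfolding bmeas_def by (auto intro: bounded_minus_comp)

lemma bmeas_const: "bmeas T (\<lambda>t. c)"
  by (rule bmeas_continuous) simp

lemma bmeas_sum:
  assumes "\<And>k. k \<in> S \<Longrightarrow> bmeas T (f k)"
  shows "bmeas T (\<lambda>t. \<Sum>k\<in>S. f k t)"
  using assms
  by (induction S rule: infinite_finite_induct) (auto simp: bmeas_const intro: bmeas_add)

lemma bmeas_absolutely_integrable:
  assumes "bmeas T f"
  shows "f absolutely_integrable_on {0..T}"
proof -
  obtain K where K: "\<And>t. \<lbrakk>0 \<le> t; t \<le> T\<rbrakk> \<Longrightarrow> norm (f t) \<le> K"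
    using bmeas_bound[OF assms] by blast
  show ?thesis
    by (rule measurable_bounded_by_integrable_imp_absolutely_integrable[where g = "\<lambda>_. K"])
      (use K assms in \<open>auto simp: bmeas_def\<close>)
qed

lemma bmeas_integrable:
  assumes "bmeas T f" "0 \<le> s" "t \<le> T"
  shows "f integrable_on {s..t}"
  using bmeas_absolutely_integrable[OF assms(1)] assms(2,3)
  by (meson absolutely_integrable_on_def atLeastatMost_subset_iff integrable_on_subinterval)

lemma integral_additive:
  assumes "bmeas T f" "0 \<le> s" "s \<le> u" "u \<le> t" "t \<le> T"
  shows "integral {s..t} f = integral {s..u} f + integral {u..t} f"
  using assms by (intro Henstock_Kurzweil_Integration.integral_combine[symmetric] bmeas_integrable) auto

lemma integral_norm_le:
  fixes f :: "real \<Rightarrow> 'a::euclidean_space"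
  assumes "f integrable_on {s..t}" "\<And>r. \<lbrakk>s \<le> r; r \<le> t\<rbrakk> \<Longrightarrow> norm (f r) \<le> K" "s \<le> t"
  shows "norm (integral {s..t} f) \<le> K * (t - s)"
proof -
  have "norm (integral {s..t} f) \<le> integral {s..t} (\<lambda>_. K)"
    using assms by (intro Henstock_Kurzweil_Integration.integral_norm_bound_integral) auto
  also have "\<dots> = K * (t - s)"
    using assms by simp
  finally show ?thesis .
qed

lemma integral_bounded_linear_comp:
  assumes "bounded_linear F" "f integrable_on {s..t}"
  shows "integral {s..t} (\<lambda>r. F (f r)) = F (integral {s..t} f)"
  using integral_linear[OF assms(2,1)] by (simp add: o_def)

text \<open>The quantifiers are those of the remainder clause in \<open>riccati_solution\<close>,
  which therefore reads \<open>small_o T (riccati_remainder T D v)\<close>.\<close>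

definition small_o :: "real \<Rightarrow> (real \<Rightarrow> real \<Rightarrow> 'a::real_normed_vector) \<Rightarrow> bool" where
  "small_o T f \<longleftrightarrow> (\<forall>\<epsilon>>0. \<exists>\<delta>>0. \<forall>s t. 0 \<le> s \<and> s \<le> t \<and> t \<le> T \<and> t - s < \<delta> \<longrightarrow>
     norm (f s t) \<le> \<epsilon> * (t - s))"

lemma small_o_dominated:
  assumes "small_o T f" "\<And>s t. \<lbrakk>0 \<le> s; s \<le> t; t \<le> T\<rbrakk> \<Longrightarrow> norm (g s t) \<le> K * norm (f s t)"
  shows "small_o T g"
  unfolding small_o_def
proof (intro allI impI)
  fix \<epsilon> :: real assume \<epsilon>: "\<epsilon> > 0"
  define K' where "K' = \<bar>K\<bar> + 1"
  have K': "K' > 0" "K \<le> K'" by (auto simp: K'_def)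
  then have "\<epsilon> / K' > 0" using \<epsilon> by simp
  then obtain \<delta> where \<delta>: "\<delta> > 0"
    "\<And>s t. \<lbrakk>0 \<le> s; s \<le> t; t \<le> T; t - s < \<delta>\<rbrakk> \<Longrightarrow> norm (f s t) \<le> \<epsilon> / K' * (t - s)"
    using assms(1) unfolding small_o_def by meson
  have "norm (g s t) \<le> \<epsilon> * (t - s)" if "0 \<le> s" "s \<le> t" "t \<le> T" "t - s < \<delta>" for s t
  proof -
    have "norm (g s t) \<le> K * norm (f s t)" using that by (intro assms(2))
    also have "\<dots> \<le> K' * norm (f s t)" using K' by (intro mult_right_mono) auto
    also have "\<dots> \<le> K' * (\<epsilon> / K' * (t - s))" using that K' \<delta> by (intro mult_left_mono) auto
    finally show ?thesis using K' by simp
  qed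
  then show "\<exists>\<delta>>0. \<forall>s t. 0 \<le> s \<and> s \<le> t \<and> t \<le> T \<and> t - s < \<delta> \<longrightarrow> norm (g s t) \<le> \<epsilon> * (t - s)"
    using \<delta>(1) by blast
qed

lemma small_o_add:
  assumes "small_o T f" "small_o T g"
  shows "small_o T (\<lambda>s t. f s t + g s t)"
  unfolding small_o_def
proof (intro allI impI)
  fix \<epsilon> :: real assume "\<epsilon> > 0"
  then have e2: "\<epsilon> / 2 > 0" by simp
  obtain \<delta> where \<delta>: "\<delta> > 0"
    "\<And>s t. \<lbrakk>0 \<le> s; s \<le> t; t \<le> T; t - s < \<delta>\<rbrakk> \<Longrightarrow> norm (f s t) \<le> \<epsilon> / 2 * (t - s)"
    using assms(1) e2 unfolding small_o_def by meson
  obtain \<delta>' where \<delta>': "\<delta>' > 0"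
    "\<And>s t. \<lbrakk>0 \<le> s; s \<le> t; t \<le> T; t - s < \<delta>'\<rbrakk> \<Longrightarrow> norm (g s t) \<le> \<epsilon> / 2 * (t - s)"
    using assms(2) e2 unfolding small_o_def by meson
  have "norm (f s t + g s t) \<le> \<epsilon> * (t - s)"
    if "0 \<le> s" "s \<le> t" "t \<le> T" "t - s < min \<delta> \<delta>'" for s t
    using norm_triangle_mono[OF \<delta>(2)[of s t] \<delta>'(2)[of s t]] that by simp
  then show "\<exists>\<delta>>0. \<forall>s t. 0 \<le> s \<and> s \<le> t \<and> t \<le> T \<and> t - s < \<delta> \<longrightarrow> norm (f s t + g s t) \<le> \<epsilon> * (t - s)"
    using \<delta>(1) \<delta>'(1) by (metis min_less_iff_conj)
qed

lemma small_o_uminus: "small_o T f \<Longrightarrow> small_o T (\<lambda>s t. - f s t)"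
  by (simp add: small_o_def)

lemma small_o_diff: "small_o T f \<Longrightarrow> small_o T g \<Longrightarrow> small_o T (\<lambda>s t. f s t - g s t)"
  using small_o_add[OF _ small_o_uminus] by force

lemma small_o_cong:
  assumes "small_o T f" "\<And>s t. \<lbrakk>0 \<le> s; s \<le> t; t \<le> T\<rbrakk> \<Longrightarrow> g s t = f s t"
  shows "small_o T g"
  using assms unfolding small_o_def by simp

lemma small_o_powr:
  assumes "1 < \<theta>" "\<And>s t. \<lbrakk>0 \<le> s; s \<le> t; t \<le> T\<rbrakk> \<Longrightarrow> norm (f s t) \<le> K * (t - s) powr \<theta>"
  shows "small_o T f"
  unfolding small_o_def
proof (intro allI impI)
  fix \<epsilon> :: real assume \<epsilon>: "\<epsilon> > 0"
  define K' where "K' = \<bar>K\<bar> + 1"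
  have K': "K' > 0" "K \<le> K'" by (auto simp: K'_def)
  \<comment> \<open>The solution of
    \<open>K' * \<delta> powr (\<theta> - 1) = \<epsilon>\<close>.\<close>
  define \<delta> where "\<delta> = (\<epsilon> / K') powr (1 / (\<theta> - 1))"
  have \<delta>: "\<delta> > 0" using \<epsilon> K' by (simp add: \<delta>_def)
  have \<delta>2: "\<delta> powr (\<theta> - 1) = \<epsilon> / K'"
    using assms(1) \<epsilon> K' by (simp add: \<delta>_def powr_powr)
  have "norm (f s t) \<le> \<epsilon> * (t - s)" if "0 \<le> s" "s \<le> t" "t \<le> T" "t - s < \<delta>" for s t
  proof -
    have "norm (f s t) \<le> K * (t - s) powr \<theta>" using that by (intro assms(2))
    also have "\<dots> \<le> K' * (t - s) powr \<theta>" using K' by (intro mult_right_mono) auto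
    also have "(t - s) powr \<theta> = (t - s) powr (\<theta> - 1) * (t - s)"
      using that by (cases "s = t") (auto simp: powr_diff)
    also have "K' * ((t - s) powr (\<theta> - 1) * (t - s)) \<le> K' * (\<delta> powr (\<theta> - 1) * (t - s))"
      using that assms(1) K' by (intro mult_left_mono mult_right_mono powr_mono2) auto
    finally show ?thesis using K' by (simp add: \<delta>2)
  qed
  then show "\<exists>\<delta>>0. \<forall>s t. 0 \<le> s \<and> s \<le> t \<and> t \<le> T \<and> t - s < \<delta> \<longrightarrow> norm (f s t) \<le> \<epsilon> * (t - s)"
    using \<delta> by blast
qed

text \<open>The bound makes the derivative vanish at every point of the interval, from either side.
  This is also how the flow and its inverse are later recognised as inverse to each other.\<close>

lemma small_o_imp_constant:
  assumes "small_o T (\<lambda>s t. f t - f s)" "0 \<le> t" "t \<le> T"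
  shows "f t = f 0"
proof -
  have "(f has_derivative (\<lambda>h. 0)) (at x within {0..T})" if x: "x \<in> {0..T}" for x
    unfolding has_derivative_within_alt
  proof (intro conjI allI impI)
    fix e :: real assume "e > 0"
    then obtain \<delta> where \<delta>: "\<delta> > 0"
      "\<And>s t. \<lbrakk>0 \<le> s; s \<le> t; t \<le> T; t - s < \<delta>\<rbrakk> \<Longrightarrow> norm (f t - f s) \<le> e * (t - s)"
      using assms(1) unfolding small_o_def by meson
    have "norm (f y - f x) \<le> e * norm (y - x)" if "y \<in> {0..T}" "norm (y - x) < \<delta>" for y
      using \<delta>(2)[of x y] \<delta>(2)[of y x] x that by (cases "x \<le> y") (auto simp: norm_minus_commute)
    then show "\<exists>d>0. \<forall>y\<in>{0..T}. norm (y - x) < d \<longrightarrow> norm (f y - f x - 0) \<le> e * norm (y - x)"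
      using \<delta>(1) by auto
  qed simp
  then obtain c where "\<forall>x\<in>{0..T}. f x = c"
    using has_derivative_zero_constant[of "{0..T}" f] by auto
  then show ?thesis using assms by auto
qed

text \<open>Additive interval functions that are \<open>o(t - s)\<close> vanish, so the calculus rules for \<open>prim\<close> need no
  almost everywhere differentiability.\<close>

definition prim :: "real \<Rightarrow> (real \<Rightarrow> 'a::euclidean_space) \<Rightarrow> (real \<Rightarrow> 'a) \<Rightarrow> bool" where
  "prim T f f' \<longleftrightarrow> bmeas T f' \<and>
     (\<forall>s t. 0 \<le> s \<and> s \<le> t \<and> t \<le> T \<longrightarrow> f t - f s = integral {s..t} f')"

lemma primD: "\<lbrakk>prim T f f'; 0 \<le> s; s \<le> t; t \<le> T\<rbrakk> \<Longrightarrow> f t - f s = integral {s..t} f'"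
  by (simp add: prim_def)

lemma prim_bmeas: "prim T f f' \<Longrightarrow> bmeas T f'"
  by (simp add: prim_def)

text \<open>Subtracting the indefinite integral of \<open>f'\<close> leaves a path whose increments
  are o(t - s), hence a constant.\<close>

lemma primI_small_o:
  assumes "bmeas T f'" "small_o T (\<lambda>s t. f t - f s - integral {s..t} f')"
  shows "prim T f f'"
  unfolding prim_def
proof (intro conjI allI impI)
  fix s t assume st: "0 \<le> s \<and> s \<le> t \<and> t \<le> T"
  define F where "F t = f t - integral {0..t} f'" for t
  have int: "integral {0..t} f' = integral {0..s} f' + integral {s..t} f'"
    if "0 \<le> s" "s \<le> t" "t \<le> T" for s t
    using that assms(1) by (intro integral_additive[of T]) auto
  have "small_o T (\<lambda>s t. F t - F s)"
  proof (rule small_o_cong[OF assms(2)])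
    fix s t assume "0 \<le> s" "s \<le> t" "t \<le> T"
    from int[OF this] show "F t - F s = f t - f s - integral {s..t} f'"
      by (simp add: F_def)
  qed
  from small_o_imp_constant[OF this, of t] small_o_imp_constant[OF this, of s]
  have "F t = F 0" "F s = F 0"
    using st by auto
  then show "f t - f s = integral {s..t} f'"
    using int[of s t] st by (simp add: F_def algebra_simps)
qed fact

lemma prim_lipschitz:
  assumes "prim T f f'"
  obtains K where "0 < K" "\<And>s t. \<lbrakk>0 \<le> s; s \<le> t; t \<le> T\<rbrakk> \<Longrightarrow> norm (f t - f s) \<le> K * (t - s)"
proof -
  obtain K where K: "0 < K" "\<And>t. \<lbrakk>0 \<le> t; t \<le> T\<rbrakk> \<Longrightarrow> norm (f' t) \<le> K"
    using bmeas_bound[OF prim_bmeas[OF assms]] by blast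
  have "norm (f t - f s) \<le> K * (t - s)" if "0 \<le> s" "s \<le> t" "t \<le> T" for s t
    unfolding primD[OF assms that]
    using that K bmeas_integrable[OF prim_bmeas[OF assms]] by (intro integral_norm_le) auto
  with K(1) show ?thesis using that by blast
qed

lemma lipschitz_continuous_on:
  fixes f :: "real \<Rightarrow> 'a::real_normed_vector"
  assumes "\<And>s t. \<lbrakk>0 \<le> s; s \<le> t; t \<le> T\<rbrakk> \<Longrightarrow> norm (f t - f s) \<le> K * (t - s)"
  shows "continuous_on {0..T} f"
proof (rule lipschitz_on_continuous_on, rule lipschitz_onI)
  fix x y assume xy: "x \<in> {0..T}" "y \<in> {0..T}"
  have "norm (f x - f y) \<le> K * \<bar>x - y\<bar>"
    using assms[of x y] assms[of y x] xy by (cases "x \<le> y") (auto simp: norm_minus_commute)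
  also have "\<dots> \<le> \<bar>K\<bar> * \<bar>x - y\<bar>" by (intro mult_right_mono) auto
  finally show "dist (f x) (f y) \<le> \<bar>K\<bar> * dist x y" by (simp add: dist_norm)
qed simp

lemma prim_continuous: "prim T f f' \<Longrightarrow> continuous_on {0..T} f"
proof -
  assume "prim T f f'"
  then obtain K where "0 < K"
    "\<And>s t. \<lbrakk>0 \<le> s; s \<le> t; t \<le> T\<rbrakk> \<Longrightarrow> norm (f t - f s) \<le> K * (t - s)"
    by (rule prim_lipschitz) (rule that)
  from this(2) show ?thesis by (rule lipschitz_continuous_on)
qed

text \<open>The integrand on \<open>[s, t]\<close> may depend on both end points, as happens when a
  factor is frozen at one of them; the integration variable \<open>r\<close> is the last argument of
  \<open>h\<close>.\<close>

definition vanish :: "real \<Rightarrow> (real \<Rightarrow> real \<Rightarrow> real \<Rightarrow> 'a::real_normed_vector) \<Rightarrow> bool" where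
  "vanish T h \<longleftrightarrow> (\<forall>\<epsilon>>0. \<exists>\<delta>>0. \<forall>s r t. 0 \<le> s \<and> s \<le> r \<and> r \<le> t \<and> t \<le> T \<and> t - s < \<delta> \<longrightarrow>
     norm (h s t r) \<le> \<epsilon>)"

lemma small_o_integral_vanish:
  fixes h :: "real \<Rightarrow> real \<Rightarrow> real \<Rightarrow> 'a::euclidean_space"
  assumes "vanish T h" "\<And>s t. \<lbrakk>0 \<le> s; s \<le> t; t \<le> T\<rbrakk> \<Longrightarrow> h s t integrable_on {s..t}"
  shows "small_o T (\<lambda>s t. integral {s..t} (h s t))"
  unfolding small_o_def
proof (intro allI impI)
  fix \<epsilon> :: real assume "\<epsilon> > 0"
  then obtain \<delta> where \<delta>: "\<delta> > 0"
    "\<And>s r t. \<lbrakk>0 \<le> s; s \<le> r; r \<le> t; t \<le> T; t - s < \<delta>\<rbrakk> \<Longrightarrow> norm (h s t r) \<le> \<epsilon>"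
    using assms(1) unfolding vanish_def by meson
  have "norm (integral {s..t} (h s t)) \<le> \<epsilon> * (t - s)"
    if "0 \<le> s" "s \<le> t" "t \<le> T" "t - s < \<delta>" for s t
    using that assms(2) \<delta>(2) by (intro integral_norm_le) auto
  then show "\<exists>\<delta>>0. \<forall>s t. 0 \<le> s \<and> s \<le> t \<and> t \<le> T \<and> t - s < \<delta> \<longrightarrow>
      norm (integral {s..t} (h s t)) \<le> \<epsilon> * (t - s)"
    using \<delta>(1) by blast
qed

lemma vanish_dominated:
  assumes "vanish T f"
    "\<And>s r t. \<lbrakk>0 \<le> s; s \<le> r; r \<le> t; t \<le> T\<rbrakk> \<Longrightarrow> norm (g s t r) \<le> K * norm (f s t r)"
  shows "vanish T g"
  unfolding vanish_def
proof (intro allI impI)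
  fix \<epsilon> :: real assume \<epsilon>: "\<epsilon> > 0"
  define K' where "K' = \<bar>K\<bar> + 1"
  have K': "K' > 0" "K \<le> K'" by (auto simp: K'_def)
  then have "\<epsilon> / K' > 0" using \<epsilon> by simp
  then obtain \<delta> where \<delta>: "\<delta> > 0"
    "\<And>s r t. \<lbrakk>0 \<le> s; s \<le> r; r \<le> t; t \<le> T; t - s < \<delta>\<rbrakk> \<Longrightarrow> norm (f s t r) \<le> \<epsilon> / K'"
    using assms(1) unfolding vanish_def by meson
  have "norm (g s t r) \<le> \<epsilon>" if "0 \<le> s" "s \<le> r" "r \<le> t" "t \<le> T" "t - s < \<delta>" for s r t
  proof -
    have "norm (g s t r) \<le> K * norm (f s t r)" using that by (intro assms(2))
    also have "\<dots> \<le> K' * norm (f s t r)" using K' by (intro mult_right_mono) auto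
    also have "\<dots> \<le> K' * (\<epsilon> / K')" using that K' \<delta> by (intro mult_left_mono) auto
    finally show ?thesis using K' by simp
  qed
  then show "\<exists>\<delta>>0. \<forall>s r t. 0 \<le> s \<and> s \<le> r \<and> r \<le> t \<and> t \<le> T \<and> t - s < \<delta> \<longrightarrow> norm (g s t r) \<le> \<epsilon>"
    using \<delta>(1) by blast
qed

lemma vanish_add:
  assumes "vanish T f" "vanish T g"
  shows "vanish T (\<lambda>s t r. f s t r + g s t r)"
  unfolding vanish_def
proof (intro allI impI)
  fix \<epsilon> :: real assume "\<epsilon> > 0"
  then have e2: "\<epsilon> / 2 > 0" by simp
  obtain \<delta> where \<delta>: "\<delta> > 0"
    "\<And>s r t. \<lbrakk>0 \<le> s; s \<le> r; r \<le> t; t \<le> T; t - s < \<delta>\<rbrakk> \<Longrightarrow> norm (f s t r) \<le> \<epsilon> / 2"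
    using assms(1) e2 unfolding vanish_def by meson
  obtain \<delta>' where \<delta>': "\<delta>' > 0"
    "\<And>s r t. \<lbrakk>0 \<le> s; s \<le> r; r \<le> t; t \<le> T; t - s < \<delta>'\<rbrakk> \<Longrightarrow> norm (g s t r) \<le> \<epsilon> / 2"
    using assms(2) e2 unfolding vanish_def by meson
  have "norm (f s t r + g s t r) \<le> \<epsilon>"
    if "0 \<le> s" "s \<le> r" "r \<le> t" "t \<le> T" "t - s < min \<delta> \<delta>'" for s r t
    using norm_triangle_mono[OF \<delta>(2)[of s r t] \<delta>'(2)[of s r t]] that by simp
  then show "\<exists>\<delta>>0. \<forall>s r t. 0 \<le> s \<and> s \<le> r \<and> r \<le> t \<and> t \<le> T \<and> t - s < \<delta> \<longrightarrow> norm (f s t r + g s t r) \<le> \<epsilon>"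
    using \<delta>(1) \<delta>'(1) by (metis min_less_iff_conj)
qed

lemma vanish_uminus: "vanish T f \<Longrightarrow> vanish T (\<lambda>s t r. - f s t r)"
  by (simp add: vanish_def)

lemma vanish_diff: "vanish T f \<Longrightarrow> vanish T g \<Longrightarrow> vanish T (\<lambda>s t r. f s t r - g s t r)"
  using vanish_add[OF _ vanish_uminus] by force

lemma vanish_sum:
  assumes "\<And>k. k \<in> S \<Longrightarrow> vanish T (f k)"
  shows "vanish T (\<lambda>s t r. \<Sum>k\<in>S. f k s t r)"
  using assms
proof (induction S rule: infinite_finite_induct)
  case (insert x F)
  then show ?case by (simp add: vanish_add)
qed (auto simp: vanish_def intro!: exI[of _ "1::real"])

lemma vanish_linear:
  assumes "bounded_linear F" "vanish T f"
  shows "vanish T (\<lambda>s t r. F (f s t r))"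
proof -
  obtain K where "\<And>x. norm (F x) \<le> norm x * K"
    using bounded_linear.bounded[OF assms(1)] by blast
  then show ?thesis
    by (intro vanish_dominated[OF assms(2), of _ K]) (simp add: mult.commute)
qed

lemma continuous_imp_vanish:
  fixes f :: "real \<Rightarrow> 'a::real_normed_vector"
  assumes "continuous_on {0..T} f"
  shows "vanish T (\<lambda>s t r. f r - f s)" "vanish T (\<lambda>s t r. f t - f r)" "vanish T (\<lambda>s t r. f t - f s)"
proof -
  have "uniformly_continuous_on {0..T} f"
    using assms by (simp add: compact_uniformly_continuous)
  then have *: "\<exists>\<delta>>0. \<forall>x\<in>{0..T}. \<forall>y\<in>{0..T}. dist y x < \<delta> \<longrightarrow> dist (f y) (f x) < \<epsilon>" if "\<epsilon> > 0" for \<epsilon>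
    using that unfolding uniformly_continuous_on_def by blast
  have "\<exists>\<delta>>0. \<forall>s r t. 0 \<le> s \<and> s \<le> r \<and> r \<le> t \<and> t \<le> T \<and> t - s < \<delta> \<longrightarrow>
      norm (f r - f s) \<le> \<epsilon> \<and> norm (f t - f r) \<le> \<epsilon> \<and> norm (f t - f s) \<le> \<epsilon>" if "\<epsilon> > 0" for \<epsilon>
  proof -
    obtain \<delta> where \<delta>: "\<delta> > 0"
      "\<And>x y. \<lbrakk>x \<in> {0..T}; y \<in> {0..T}; dist y x < \<delta>\<rbrakk> \<Longrightarrow> dist (f y) (f x) < \<epsilon>"
      using *[OF \<open>\<epsilon> > 0\<close>] by blast
    have "norm (f y - f x) \<le> \<epsilon>" if "x \<in> {0..T}" "y \<in> {0..T}" "\<bar>y - x\<bar> < \<delta>" for x y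
      using \<delta>(2)[of x y] that by (simp add: dist_norm)
    then show ?thesis
      using \<delta>(1) by (intro exI[of _ \<delta>]) auto
  qed
  then show "vanish T (\<lambda>s t r. f r - f s)" "vanish T (\<lambda>s t r. f t - f r)" "vanish T (\<lambda>s t r. f t - f s)"
    unfolding vanish_def by meson+
qed

definition bounded3 :: "real \<Rightarrow> (real \<Rightarrow> real \<Rightarrow> real \<Rightarrow> 'a::real_normed_vector) \<Rightarrow> bool" where
  "bounded3 T h \<longleftrightarrow> (\<exists>K. \<forall>s r t. 0 \<le> s \<and> s \<le> r \<and> r \<le> t \<and> t \<le> T \<longrightarrow> norm (h s t r) \<le> K)"

lemma bounded3_bmeas:
  assumes "bmeas T f"
  shows "bounded3 T (\<lambda>s t r. f r)" "bounded3 T (\<lambda>s t r. f s)" "bounded3 T (\<lambda>s t r. f t)"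
proof -
  obtain K where "\<And>t. \<lbrakk>0 \<le> t; t \<le> T\<rbrakk> \<Longrightarrow> norm (f t) \<le> K"
    using bmeas_bound[OF assms] by blast
  then show "bounded3 T (\<lambda>s t r. f r)" "bounded3 T (\<lambda>s t r. f s)" "bounded3 T (\<lambda>s t r. f t)"
    unfolding bounded3_def by (auto intro!: exI[of _ K])
qed

lemma bounded3_bilinear:
  assumes "bounded_bilinear B" "bounded3 T f" "bounded3 T g"
  shows "bounded3 T (\<lambda>s t r. B (f s t r) (g s t r))"
proof -
  obtain C where C: "C > 0" "\<And>x y. norm (B x y) \<le> norm x * norm y * C"
    using bounded_bilinear.pos_bounded[OF assms(1)] by blast
  obtain K where K: "\<And>s r t. \<lbrakk>0 \<le> s; s \<le> r; r \<le> t; t \<le> T\<rbrakk> \<Longrightarrow> norm (f s t r) \<le> K"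
    using assms(2) unfolding bounded3_def by blast
  obtain L where L: "\<And>s r t. \<lbrakk>0 \<le> s; s \<le> r; r \<le> t; t \<le> T\<rbrakk> \<Longrightarrow> norm (g s t r) \<le> L"
    using assms(3) unfolding bounded3_def by blast
  have "norm (B (f s t r) (g s t r)) \<le> K * L * C" if "0 \<le> s" "s \<le> r" "r \<le> t" "t \<le> T" for s r t
    using C order_trans[OF norm_ge_zero K[OF that]]
    by (intro order_trans[OF C(2)] mult_right_mono mult_mono K L that) auto
  then show ?thesis unfolding bounded3_def by blast
qed

lemma vanish_bilinear_left:
  assumes "bounded_bilinear B" "vanish T f" "bounded3 T g"
  shows "vanish T (\<lambda>s t r. B (f s t r) (g s t r))"
proof -
  obtain C where C: "C > 0" "\<And>x y. norm (B x y) \<le> norm x * norm y * C"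
    using bounded_bilinear.pos_bounded[OF assms(1)] by blast
  obtain L where L: "\<And>s r t. \<lbrakk>0 \<le> s; s \<le> r; r \<le> t; t \<le> T\<rbrakk> \<Longrightarrow> norm (g s t r) \<le> L"
    using assms(3) unfolding bounded3_def by blast
  show ?thesis
  proof (rule vanish_dominated[OF assms(2)])
    fix s r t assume *: "0 \<le> s" "s \<le> r" "r \<le> t" "t \<le> T"
    have "norm (B (f s t r) (g s t r)) \<le> norm (f s t r) * L * C"
      using C by (intro order_trans[OF C(2)] mult_right_mono mult_left_mono L *) auto
    then show "norm (B (f s t r) (g s t r)) \<le> (L * C) * norm (f s t r)" by (simp add: mult_ac)
  qed
qed

lemma vanish_bilinear_right:
  assumes "bounded_bilinear B" "bounded3 T f" "vanish T g"
  shows "vanish T (\<lambda>s t r. B (f s t r) (g s t r))"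
  using vanish_bilinear_left[OF bounded_bilinear.flip[OF assms(1)] assms(3,2)] .

lemma small_o_bilinear_left:
  assumes "bounded_bilinear B" "small_o T f" "bounded3 T (\<lambda>s t r. g s t)"
  shows "small_o T (\<lambda>s t. B (f s t) (g s t))"
proof -
  obtain C where C: "C > 0" "\<And>x y. norm (B x y) \<le> norm x * norm y * C"
    using bounded_bilinear.pos_bounded[OF assms(1)] by blast
  obtain L where L: "\<And>s r t. \<lbrakk>0 \<le> s; s \<le> r; r \<le> t; t \<le> T\<rbrakk> \<Longrightarrow> norm (g s t) \<le> L"
    using assms(3) unfolding bounded3_def by blast
  show ?thesis
  proof (rule small_o_dominated[OF assms(2)])
    fix s t assume *: "0 \<le> s" "s \<le> t" "t \<le> T"
    have "norm (B (f s t) (g s t)) \<le> norm (f s t) * L * C"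
      using C * by (intro order_trans[OF C(2)] mult_right_mono mult_left_mono L[of s s t]) auto
    then show "norm (B (f s t) (g s t)) \<le> (L * C) * norm (f s t)" by (simp add: mult_ac)
  qed
qed

lemma small_o_bilinear_right:
  assumes "bounded_bilinear B" "bounded3 T (\<lambda>s t r. f s t)" "small_o T g"
  shows "small_o T (\<lambda>s t. B (f s t) (g s t))"
  using small_o_bilinear_left[OF bounded_bilinear.flip[OF assms(1)] assms(3,2)] .

lemma prim_linear:
  fixes F :: "'a::euclidean_space \<Rightarrow> 'b::euclidean_space"
  assumes F: "bounded_linear F" and f: "prim T f f'"
  shows "prim T (\<lambda>t. F (f t)) (\<lambda>t. F (f' t))"
  unfolding prim_def
proof (intro conjI allI impI)
  fix s t assume "0 \<le> s \<and> s \<le> t \<and> t \<le> T"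
  then have st: "0 \<le> s" "s \<le> t" "t \<le> T" by auto
  have "F (f t) - F (f s) = F (f t - f s)"
    using linear_diff[OF bounded_linear.linear[OF F]] by simp
  also have "\<dots> = integral {s..t} (\<lambda>t. F (f' t))"
    unfolding primD[OF f st] using st bmeas_integrable[OF prim_bmeas[OF f]]
    by (intro integral_bounded_linear_comp[symmetric] F) auto
  finally show "F (f t) - F (f s) = integral {s..t} (\<lambda>t. F (f' t))" .
qed (rule bmeas_linear[OF F prim_bmeas[OF f]])

lemma prim_add:
  assumes "prim T f f'" "prim T g g'"
  shows "prim T (\<lambda>t. f t + g t) (\<lambda>t. f' t + g' t)"
  unfolding prim_def
proof (intro conjI allI impI)
  fix s t assume "0 \<le> s \<and> s \<le> t \<and> t \<le> T"
  then have st: "0 \<le> s" "s \<le> t" "t \<le> T" by auto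
  show "f t + g t - (f s + g s) = integral {s..t} (\<lambda>t. f' t + g' t)"
    using primD[OF assms(1) st] primD[OF assms(2) st] st
      bmeas_integrable[OF prim_bmeas[OF assms(1)]] bmeas_integrable[OF prim_bmeas[OF assms(2)]]
    by (simp add: Henstock_Kurzweil_Integration.integral_add algebra_simps)
qed (use assms prim_bmeas bmeas_add in blast)

lemma prim_diff:
  assumes "prim T f f'" "prim T g g'"
  shows "prim T (\<lambda>t. f t - g t) (\<lambda>t. f' t - g' t)"
  using prim_add[OF assms(1) prim_linear[OF bounded_linear_minus[OF bounded_linear_ident] assms(2)]]
  by (simp only: diff_conv_add_uminus)

text \<open>The increment of a product is an exact integral with \<open>g\<close> frozen at
  \<open>t\<close> and \<open>f\<close> frozen at \<open>s\<close>. Unfreezing them changes the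
  integrand by increments of continuous paths times bounded factors, so the product rule holds up to
  o(t - s), and therefore exactly.\<close>

lemma prim_bilinear:
  fixes B :: "'a::euclidean_space \<Rightarrow> 'b::euclidean_space \<Rightarrow> 'c::euclidean_space"
  assumes B: "bounded_bilinear B" and f: "prim T f f'" and g: "prim T g g'"
  shows "prim T (\<lambda>t. B (f t) (g t)) (\<lambda>t. B (f' t) (g t) + B (f t) (g' t))"
proof (rule primI_small_o)
  interpret B: bounded_bilinear B by fact
  note fc = prim_continuous[OF f] and gc = prim_continuous[OF g]
  note fm = bmeas_continuous[OF fc] and gm = bmeas_continuous[OF gc]
  note f'm = prim_bmeas[OF f] and g'm = prim_bmeas[OF g]
  show bm: "bmeas T (\<lambda>t. B (f' t) (g t) + B (f t) (g' t))"
    by (intro bmeas_add bmeas_bilinear[OF B] fm gm f'm g'm)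
  let ?h = "\<lambda>s t r. B (f' r) (g t - g r) - B (f r - f s) (g' r)"
  have "vanish T ?h"
    by (intro vanish_diff vanish_bilinear_right[OF B] vanish_bilinear_left[OF B]
        bounded3_bmeas continuous_imp_vanish fc gc f'm g'm)
  moreover have h_int: "?h s t integrable_on {s..t}" if "0 \<le> s" "s \<le> t" "t \<le> T" for s t
    using that by (intro bmeas_integrable[of T] bmeas_diff bmeas_bilinear[OF B] bmeas_const fm gm f'm g'm)
  ultimately have "small_o T (\<lambda>s t. integral {s..t} (?h s t))"
    by (rule small_o_integral_vanish)
  then show "small_o T (\<lambda>s t. B (f t) (g t) - B (f s) (g s) -
     integral {s..t} (\<lambda>t. B (f' t) (g t) + B (f t) (g' t)))"
  proof (rule small_o_cong)
    fix s t assume st: "0 \<le> s" "s \<le> t" "t \<le> T"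
    have f'i: "f' integrable_on {s..t}" and g'i: "g' integrable_on {s..t}"
      using st bmeas_integrable f'm g'm by auto
    have "B (f t) (g t) - B (f s) (g s) = B (f t - f s) (g t) + B (f s) (g t - g s)"
      by (simp add: B.diff_left B.diff_right)
    also have "\<dots> = integral {s..t} (\<lambda>r. B (f' r) (g t)) + integral {s..t} (\<lambda>r. B (f s) (g' r))"
      using primD[OF f st] primD[OF g st]
        integral_bounded_linear_comp[OF B.bounded_linear_left f'i]
        integral_bounded_linear_comp[OF B.bounded_linear_right g'i] by simp
    also have "\<dots> = integral {s..t} (\<lambda>r. B (f' r) (g t) + B (f s) (g' r))"
      using st by (intro Henstock_Kurzweil_Integration.integral_add[symmetric] bmeas_integrable[of T]
          bmeas_bilinear[OF B] bmeas_const f'm g'm)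
    finally have 1: "B (f t) (g t) - B (f s) (g s) = integral {s..t} (\<lambda>r. B (f' r) (g t) + B (f s) (g' r))" .
    have "integral {s..t} (\<lambda>r. B (f' r) (g t) + B (f s) (g' r)) -
        integral {s..t} (\<lambda>t. B (f' t) (g t) + B (f t) (g' t))
      = integral {s..t} (\<lambda>r. (B (f' r) (g t) + B (f s) (g' r)) - (B (f' r) (g r) + B (f r) (g' r)))"
      using st by (intro Henstock_Kurzweil_Integration.integral_diff[symmetric] bmeas_integrable[of T] bmeas_add
          bmeas_bilinear[OF B] bmeas_const f'm g'm fm gm)
    then show "B (f t) (g t) - B (f s) (g s) - integral {s..t} (\<lambda>t. B (f' t) (g t) + B (f t) (g' t))
      = integral {s..t} (?h s t)"
      unfolding 1 by (simp add: B.diff_left B.diff_right algebra_simps)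
  qed
qed

section \<open>Gronwall's inequality and linear ordinary equations\<close>

lemma gronwall_integral:
  fixes u :: "real \<Rightarrow> real"
  assumes u: "continuous_on {0..T} u"
    and le: "\<And>t. \<lbrakk>0 \<le> t; t \<le> T\<rbrakk> \<Longrightarrow> u t \<le> a + b * integral {0..t} u"
    and b: "0 \<le> b" and t: "0 \<le> t" "t \<le> T"
  shows "u t \<le> a * exp (b * t)"
proof -
  define U where "U t = a + b * integral {0..t} u" for t
  have dU: "(U has_real_derivative b * u x) (at x within {0..T})" if "x \<in> {0..T}" for x
    unfolding U_def using integral_has_real_derivative[OF u that]
    by (auto intro!: derivative_eq_intros)
  let ?G = "\<lambda>x. U x * exp (- (b * x))"
  have dG: "(?G has_real_derivative (b * u x - b * U x) * exp (- (b * x))) (at x within {0..T})"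
    if "x \<in> {0..T}" for x
    by (rule derivative_eq_intros dU that refl | simp add: algebra_simps)+
  have "?G t \<le> ?G 0"
  proof (rule DERIV_nonpos_imp_decreasing_open[of 0 t])
    show "0 \<le> t" by fact
    fix x assume x: "0 < x" "x < t"
    then have "x \<in> interior {0..T}" using t by simp
    then have "at x within {0..T} = at x" by (rule at_within_interior)
    moreover have "x \<in> {0..T}" using x t by simp
    ultimately have "(?G has_real_derivative (b * u x - b * U x) * exp (- (b * x))) (at x)"
      using dG[of x] by metis
    moreover have "(b * u x - b * U x) * exp (- (b * x)) \<le> 0"
    proof (rule mult_nonpos_nonneg)
      have "b * u x \<le> b * U x"
        unfolding U_def using le[of x] x t b by (intro mult_left_mono) auto
      then show "b * u x - b * U x \<le> 0" by simp
    qed simp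
    ultimately show "\<exists>y. (?G has_real_derivative y) (at x) \<and> y \<le> 0" by blast
  next
    have "continuous_on {0..T} ?G" by (rule DERIV_continuous_on[OF dG])
    then show "continuous_on {0..t} ?G" by (rule continuous_on_subset) (use t in auto)
  qed
  then have "U t * exp (- (b * t)) \<le> a" by (simp add: U_def)
  then have "U t \<le> a * exp (b * t)"
    by (simp add: exp_minus field_simps)
  with le[OF t] show ?thesis by (simp add: U_def)
qed

lemma prim_gronwall:
  assumes z: "prim T z z'" and le: "\<And>t. \<lbrakk>0 \<le> t; t \<le> T\<rbrakk> \<Longrightarrow> norm (z' t) \<le> b * norm (z t) + c"
    and bc: "0 \<le> b" "0 \<le> c" and t: "0 \<le> t" "t \<le> T"
  shows "norm (z t) \<le> (norm (z 0) + c * T) * exp (b * T)"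
proof -
  note zc = prim_continuous[OF z]
  have nc: "continuous_on {0..T} (\<lambda>t. norm (z t))" by (intro continuous_intros zc)
  have "norm (z t) \<le> (norm (z 0) + c * T) * exp (b * t)"
  proof (rule gronwall_integral[OF nc _ bc(1) t])
    fix t assume t: "0 \<le> t" "t \<le> T"
    have i: "(\<lambda>t. norm (z t)) integrable_on {0..t}"
      using bmeas_continuous[OF nc] t by (intro bmeas_integrable[of T]) auto
    have ib: "(\<lambda>t. b * norm (z t)) integrable_on {0..t}"
      using integrable_cmul[OF i, of b] by simp
    have "norm (z t - z 0) = norm (integral {0..t} z')" using primD[OF z] t by auto
    moreover have "norm (integral {0..t} z') \<le> integral {0..t} (\<lambda>t. b * norm (z t) + c)"
      using t le ib bmeas_integrable[OF prim_bmeas[OF z]]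
      by (intro Henstock_Kurzweil_Integration.integral_norm_bound_integral integrable_add) auto
    moreover have "integral {0..t} (\<lambda>t. b * norm (z t) + c) = b * integral {0..t} (\<lambda>t. norm (z t)) + c * t"
      using Henstock_Kurzweil_Integration.integral_add[OF ib integrable_const_ivl[of c]] t
      by (simp add: mult.commute)
    moreover have "c * t \<le> c * T" using t bc by (intro mult_left_mono) auto
    ultimately show "norm (z t) \<le> norm (z 0) + c * T + b * integral {0..t} (\<lambda>t. norm (z t))"
      using norm_triangle_sub[of "z t" "z 0"] by linarith
  qed
  also have "\<dots> \<le> (norm (z 0) + c * T) * exp (b * T)"
    using t bc by (intro mult_left_mono) (auto intro!: mult_left_mono add_nonneg_nonneg mult_nonneg_nonneg)
  finally show ?thesis .
qed

text \<open>A linear equation with bounded measurable coefficient is the case \<open>a = 1\<close>,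
  \<theta> = 2 of the abstract scheme: the one-step map is the identity plus the integral of
  \<open>f\<close>, and its defect is a product of two integrals. Existence thus comes from the same
  compactness argument as for the rough equation.\<close>

lemma linear_ode_exists:
  fixes act :: "'m::euclidean_space \<Rightarrow> 'v::euclidean_space \<Rightarrow> 'v"
  assumes act: "bounded_bilinear act" and f: "bmeas T f" and T: "0 < T"
  shows "\<exists>y. y 0 = y0 \<and> prim T y (\<lambda>t. act (f t) (y t))"
proof -
  interpret act: bounded_bilinear act by fact
  obtain Ka where Ka: "Ka > 0" "\<And>x y. norm (act x y) \<le> norm x * norm y * Ka"
    using act.pos_bounded by blast
  obtain K where K: "0 < K" "\<And>t. \<lbrakk>0 \<le> t; t \<le> T\<rbrakk> \<Longrightarrow> norm (f t) \<le> K"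
    using bmeas_bound[OF f] by blast
  define I where "I s t = integral {s..t} f" for s t
  have I_bound: "norm (I s t) \<le> K * (t - s)" if "0 \<le> s" "s \<le> t" "t \<le> T" for s t
    unfolding I_def using that K bmeas_integrable[OF f] by (intro integral_norm_le) auto
  have I_add: "I s t = I s u + I u t" if "0 \<le> s" "s \<le> u" "u \<le> t" "t \<le> T" for s u t
    unfolding I_def using that f by (intro integral_additive[of T]) auto
  define L where "L s t v = v + act (I s t) v" for s t v
  define C where "C = K * Ka + K * Ka * (K * Ka)"
  have "rough_flow L C 1 2 T"
  proof (rule rough_flow.intro)
    fix s t assume "0 \<le> s" "s \<le> t" "t \<le> T"
    show "linear (L s t)"
      unfolding L_def by (intro linearI) (simp_all add: act.add_right act.scaleR_right scaleR_add_right)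
  next
    fix s t v assume st: "0 \<le> s" "s \<le> t" "t \<le> T"
    have "norm (L s t v - v) \<le> norm (I s t) * norm v * Ka"
      unfolding L_def using Ka(2)[of "I s t" v] by simp
    also have "\<dots> \<le> (K * (t - s)) * norm v * Ka"
      using I_bound[OF st] Ka by (intro mult_right_mono) auto
    also have "\<dots> = (K * Ka) * ((t - s) * norm v)" by simp
    also have "\<dots> \<le> C * ((t - s) * norm v)"
      using st K Ka by (intro mult_right_mono) (auto simp: C_def)
    finally show "norm (L s t v - v) \<le> C * (t - s) powr 1 * norm v"
      using st by simp
  next
    fix s u t v assume st: "0 \<le> s" "s \<le> u" "u \<le> t" "t \<le> T"
    have "L s t v - L u t (L s u v) = - act (I u t) (act (I s u) v)"
      using I_add[OF st] by (simp add: L_def act.add_left act.add_right)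
    also have "norm \<dots> \<le> norm (I u t) * (norm (I s u) * norm v * Ka) * Ka"
      using Ka(1) by (auto intro!: order_trans[OF Ka(2)] mult_right_mono mult_left_mono Ka(2))
    also have "\<dots> \<le> (K * (t - s)) * ((K * (t - s)) * norm v * Ka) * Ka"
    proof -
      have "K * (t - u) \<le> K * (t - s)" "K * (u - s) \<le> K * (t - s)"
        using st K by (auto intro!: mult_left_mono)
      then have "norm (I u t) \<le> K * (t - s)" "norm (I s u) \<le> K * (t - s)"
        using I_bound[of u t] I_bound[of s u] st by auto
      then show ?thesis
        using st Ka(1) K(1) by (intro mult_right_mono mult_mono) auto
    qed
    also have "\<dots> = (K * Ka * (K * Ka)) * ((t - s) * (t - s) * norm v)" by simp
    also have "\<dots> \<le> C * ((t - s) * (t - s) * norm v)"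
      using st K Ka by (intro mult_right_mono) (auto simp: C_def)
    also have "(t - s) * (t - s) = (t - s) powr 2"
      using st by (simp add: power2_eq_square)
    finally show "norm (L s t v - L u t (L s u v)) \<le> C * (t - s) powr 2 * norm v" by simp
  qed (use K Ka T in \<open>auto simp: C_def\<close>)
  from rough_flow.solution_exists[OF this]
  obtain y M where y: "y 0 = y0" "0 \<le> M"
    "\<And>s t. \<lbrakk>0 \<le> s; s \<le> t; t \<le> T\<rbrakk> \<Longrightarrow> norm (y t - L s t (y s)) \<le> M * (t - s) powr 2"
    by metis
  have so: "small_o T (\<lambda>s t. y t - L s t (y s))"
    by (rule small_o_powr[of 2]) (use y in auto)
  have "\<exists>B. \<forall>t. 0 \<le> t \<and> t \<le> T \<longrightarrow> norm (y t) \<le> B"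
  proof (intro exI allI impI)
    fix t assume t: "0 \<le> t \<and> t \<le> T"
    have "norm (y t) \<le> norm (y t - L 0 t y0) + norm y0 + norm (act (I 0 t) y0)"
      unfolding L_def using norm_triangle_ineq[of "y t - (y0 + act (I 0 t) y0)" "y0 + act (I 0 t) y0"]
        norm_triangle_ineq[of y0 "act (I 0 t) y0"] by simp
    also have "\<dots> \<le> M * T powr 2 + norm y0 + K * T * norm y0 * Ka"
    proof (intro add_mono order.refl)
      have "M * (t - 0) powr 2 \<le> M * T powr 2" using t y by (intro mult_left_mono powr_mono2) auto
      then show "norm (y t - L 0 t y0) \<le> M * T powr 2" using y(3)[of 0 t] y(1) t by simp
      have "norm (I 0 t) \<le> K * t" using I_bound[of 0 t] t by auto
      also have "\<dots> \<le> K * T" using t K by (intro mult_left_mono) auto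
      finally have "norm (I 0 t) \<le> K * T" .
      then show "norm (act (I 0 t) y0) \<le> K * T * norm y0 * Ka"
        using Ka(1) by (intro order_trans[OF Ka(2)] mult_right_mono) auto
    qed
    finally show "norm (y t) \<le> M * T powr 2 + norm y0 + K * T * norm y0 * Ka" .
  qed
  then obtain B where B: "\<And>t. \<lbrakk>0 \<le> t; t \<le> T\<rbrakk> \<Longrightarrow> norm (y t) \<le> B" by blast
  have B0: "0 \<le> B" using B[of 0] T norm_ge_zero[of "y 0"] by linarith
  have lip: "norm (y t - y s) \<le> (M * T + K * B * Ka) * (t - s)" if st: "0 \<le> s" "s \<le> t" "t \<le> T" for s t
  proof -
    have "norm (y t - y s) \<le> norm (y t - L s t (y s)) + norm (act (I s t) (y s))"
      unfolding L_def using norm_triangle_ineq[of "y t - (y s + act (I s t) (y s))" "act (I s t) (y s)"]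
      by (simp add: algebra_simps)
    also have "\<dots> \<le> M * (T * (t - s)) + (K * (t - s)) * B * Ka"
    proof (intro add_mono)
      have "(t - s) powr 2 = (t - s) * (t - s)" using st by (simp add: power2_eq_square)
      also have "\<dots> \<le> T * (t - s)" using st by (intro mult_right_mono) auto
      finally show "norm (y t - L s t (y s)) \<le> M * (T * (t - s))"
        using y(3)[OF st] y(2) mult_left_mono[of "(t - s) powr 2" "T * (t - s)" M] by linarith
      show "norm (act (I s t) (y s)) \<le> (K * (t - s)) * B * Ka"
        using I_bound[OF st] B[of s] st Ka(1) K(1)
        by (intro order_trans[OF Ka(2)] mult_right_mono mult_mono) auto
    qed
    finally show ?thesis by (simp add: algebra_simps)
  qed
  then have yc: "continuous_on {0..T} y" by (rule lipschitz_continuous_on)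
  note ym = bmeas_continuous[OF yc]
  \<comment> \<open>The scheme freezes \<open>y\<close> at \<open>s\<close>. Since \<open>y\<close>
    is continuous, letting it run inside the integral costs only o(t - s).\<close>
  have "vanish T (\<lambda>s t r. act (f r) (y r - y s))"
    by (intro vanish_bilinear_right[OF act] bounded3_bmeas continuous_imp_vanish f yc)
  then have "small_o T (\<lambda>s t. integral {s..t} (\<lambda>r. act (f r) (y r - y s)))"
    by (rule small_o_integral_vanish)
      (intro bmeas_integrable[of T] bmeas_bilinear[OF act] bmeas_diff bmeas_const f ym, auto)
  from small_o_diff[OF so this]
  have "small_o T (\<lambda>s t. y t - y s - integral {s..t} (\<lambda>t. act (f t) (y t)))"
  proof (rule small_o_cong)
    fix s t assume st: "0 \<le> s" "s \<le> t" "t \<le> T"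
    have fi: "f integrable_on {s..t}" using st by (intro bmeas_integrable[OF f])
    have "integral {s..t} (\<lambda>r. act (f r) (y r - y s)) =
      integral {s..t} (\<lambda>r. act (f r) (y r)) - integral {s..t} (\<lambda>r. act (f r) (y s))"
      unfolding act.diff_right using st
      by (intro Henstock_Kurzweil_Integration.integral_diff bmeas_integrable[of T]
          bmeas_bilinear[OF act] bmeas_const f ym)
    then show "y t - y s - integral {s..t} (\<lambda>t. act (f t) (y t)) =
      y t - L s t (y s) - integral {s..t} (\<lambda>r. act (f r) (y r - y s))"
      using integral_bounded_linear_comp[OF act.bounded_linear_left fi, of "y s"]
      by (simp add: L_def I_def)
  qed
  then have "prim T y (\<lambda>t. act (f t) (y t))"
    by (intro primI_small_o bmeas_bilinear[OF act] f ym)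
  with y(1) show ?thesis by blast
qed

section \<open>The matrix Riccati equation\<close>

lemma bounded_bilinear_matrix_mult:
  "bounded_bilinear ((**) :: real^'n^'m \<Rightarrow> real^'p^'n \<Rightarrow> real^'p^'m)"
proof -
  have "bilinear ((**) :: real^'n^'m \<Rightarrow> real^'p^'n \<Rightarrow> real^'p^'m)"
    unfolding bilinear_def
    by (auto intro!: linearI simp: matrix_matrix_mult_def vec_eq_iff sum.distrib algebra_simps
        sum_distrib_left)
  then show ?thesis by (simp add: bilinear_conv_bounded_bilinear)
qed

interpretation mm: bounded_bilinear "(**) :: real^'n^'m \<Rightarrow> real^'p^'n \<Rightarrow> real^'p^'m"
  by (rule bounded_bilinear_matrix_mult)

lemma bounded_linear_transpose: "bounded_linear (transpose :: real^'n^'m \<Rightarrow> real^'m^'n)"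
  by (simp add: linear_conv_bounded_linear[symmetric] linearI transpose_def vec_eq_iff)

lemma transpose_add: "transpose (A + B) = transpose A + transpose (B :: real^'n^'m)"
  by (rule linear_add[OF bounded_linear.linear[OF bounded_linear_transpose]])

lemma bounded_linear_matrix_vector: "bounded_linear (\<lambda>M :: real^'n^'m. M *v x)"
  by (simp add: linear_conv_bounded_linear[symmetric] linearI matrix_vector_mult_def vec_eq_iff
      algebra_simps sum.distrib sum_distrib_left)

lemma inner_transpose_matrix_vector:
  fixes A :: "real^'n^'m"
  shows "x \<bullet> (transpose A *v z) = (A *v x) \<bullet> z"
  by (metis dot_lmul_matrix inner_commute transpose_matrix_vector)

text \<open>As a simp rule it turns \<open>transpose A *v x\<close> into \<open>x v* A\<close>, and
  \<open>inner_transpose_matrix_vector\<close> would no longer match.\<close>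

declare transpose_matrix_vector [simp del]

lemma quadratic_form_congruence:
  fixes A :: "real^'n^'m"
  shows "x \<bullet> ((transpose A ** M ** A) *v x) = (A *v x) \<bullet> (M *v (A *v x))"
  by (simp only: matrix_vector_mul_assoc[symmetric] inner_transpose_matrix_vector)

lemma psd_congruence:
  fixes A :: "real^'n^'m"
  assumes "psd M"
  shows "psd (transpose A ** M ** A)"
  using assms unfolding psd_def
  by (simp add: quadratic_form_congruence matrix_transpose_mul matrix_mul_assoc)

lemma psd_add: "psd M \<Longrightarrow> psd N \<Longrightarrow> psd (M + N)"
  by (simp add: psd_def transpose_add matrix_vector_mult_add_rdistrib inner_add_right)

lemma psd_integral:
  fixes f :: "real \<Rightarrow> real^'n^'n"
  assumes f: "f integrable_on {s..t}" and psd: "\<And>r. \<lbrakk>s \<le> r; r \<le> t\<rbrakk> \<Longrightarrow> psd (f r)"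
  shows "psd (integral {s..t} f)"
  unfolding psd_def
proof (intro conjI allI)
  have "integral {s..t} (\<lambda>r. transpose (f r)) = integral {s..t} f"
    using psd by (intro Henstock_Kurzweil_Integration.integral_cong) (auto simp: psd_def)
  then show "transpose (integral {s..t} f) = integral {s..t} f"
    using integral_bounded_linear_comp[OF bounded_linear_transpose f] by simp
  fix x :: "real^'n"
  have lin: "bounded_linear (\<lambda>M. x \<bullet> (M *v x))"
    by (intro bounded_linear_inner_right_comp bounded_linear_matrix_vector)
  have "0 \<le> integral {s..t} (\<lambda>r. x \<bullet> (f r *v x))"
    using psd integrable_linear[OF f lin]
    by (intro Henstock_Kurzweil_Integration.integral_nonneg) (auto simp: psd_def o_def)
  then show "0 \<le> x \<bullet> (integral {s..t} f *v x)"
    using integral_bounded_linear_comp[OF lin f] by simp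
qed

lemma norm_le_sum_entries:
  fixes A :: "real^'n^'m"
  shows "norm A \<le> (\<Sum>i\<in>UNIV. \<Sum>j\<in>UNIV. \<bar>A $ i $ j\<bar>)"
proof -
  have "norm A \<le> (\<Sum>i\<in>UNIV. norm (A $ i))"
    unfolding norm_vec_def by (rule L2_set_le_sum) simp
  also have "\<dots> \<le> (\<Sum>i\<in>UNIV. \<Sum>j\<in>UNIV. \<bar>A $ i $ j\<bar>)"
    by (intro sum_mono norm_le_l1_cart)
  finally show ?thesis .
qed

lemma norm_le_entries:
  fixes A :: "real^'n^'m"
  assumes "\<And>i j. \<bar>A $ i $ j\<bar> \<le> K"
  shows "norm A \<le> real CARD('m) * (real CARD('n) * K)"
proof -
  have "norm A \<le> (\<Sum>i\<in>(UNIV::'m set). \<Sum>j\<in>(UNIV::'n set). K)"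
    using assms by (intro order_trans[OF norm_le_sum_entries] sum_mono)
  then show ?thesis by simp
qed

text \<open>Testing the form on \<open>axis i 1 + axis j 1\<close> and
  \<open>axis i 1 - axis j 1\<close> bounds an off-diagonal entry by the mean of two diagonal ones.
  Upper bounds on the diagonal therefore suffice, and these are what the Riccati equation
  provides.\<close>

lemma psd_norm_le:
  fixes M :: "real^'n^'n"
  assumes psd: "psd M" and diag: "\<And>i. M $ i $ i \<le> K"
  shows "norm M \<le> real CARD('n) * (real CARD('n) * K)"
proof (rule norm_le_entries)
  fix i j :: 'n
  have sym: "M $ j $ i = M $ i $ j"
  proof -
    have "transpose M $ i $ j = M $ i $ j" using psd by (simp add: psd_def)
    then show ?thesis by (simp add: transpose_def)
  qed
  have q: "axis a (1::real) \<bullet> (M *v axis b 1) = M $ a $ b" for a b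
    by (simp add: inner_axis' matrix_vector_mult_basis column_def)
  have "0 \<le> (axis i 1 + axis j 1) \<bullet> (M *v (axis i 1 + axis j 1))"
    "0 \<le> (axis i 1 - axis j 1) \<bullet> (M *v (axis i 1 - axis j 1))"
    using psd by (auto simp: psd_def)
  then have "0 \<le> M $ i $ i + M $ j $ j + 2 * M $ i $ j" "0 \<le> M $ i $ i + M $ j $ j - 2 * M $ i $ j"
    by (simp_all add: inner_add_left inner_diff_left matrix_vector_right_distrib
        matrix_vector_mult_diff_distrib inner_add_right inner_diff_right q sym)
  then show "\<bar>M $ i $ j\<bar> \<le> K"
    using diag[of i] diag[of j] by linarith
qed

text \<open>The identity \<open>Z t - Z s = - (Z t ** (X t - X s) ** Z s)\<close> with bounded
  \<open>Z\<close> first makes \<open>Z\<close> Lipschitz and then, once the outer factors are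
  unfrozen, gives its derivative.\<close>

lemma prim_matrix_inverse:
  fixes X :: "real \<Rightarrow> real^'n^'n"
  assumes X: "prim T X X'"
    and inv: "\<And>t. \<lbrakk>0 \<le> t; t \<le> T\<rbrakk> \<Longrightarrow> X t ** Z t = mat 1" "\<And>t. \<lbrakk>0 \<le> t; t \<le> T\<rbrakk> \<Longrightarrow> Z t ** X t = mat 1"
    and bdd: "\<And>t. \<lbrakk>0 \<le> t; t \<le> T\<rbrakk> \<Longrightarrow> norm (Z t) \<le> B"
  shows "prim T Z (\<lambda>t. - (Z t ** X' t ** Z t))"
proof (rule primI_small_o)
  note mb = bounded_bilinear_matrix_mult
  have diff: "Z t - Z s = - (Z t ** (X t - X s) ** Z s)" if "0 \<le> s" "s \<le> t" "t \<le> T" for s t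
  proof -
    have "Z t ** (X t - X s) ** Z s = Z t ** X t ** Z s - Z t ** (X s ** Z s)"
      by (simp add: mm.diff_left mm.diff_right matrix_mul_assoc)
    then show ?thesis using inv[of t] inv[of s] that by simp
  qed
  obtain C :: real where C: "C > 0" "\<And>(x::real^'n^'n) (y::real^'n^'n). norm (x ** y) \<le> norm x * norm y * C"
    using mm.pos_bounded by blast
  obtain K where K: "0 < K" "\<And>s t. \<lbrakk>0 \<le> s; s \<le> t; t \<le> T\<rbrakk> \<Longrightarrow> norm (X t - X s) \<le> K * (t - s)"
    by (rule prim_lipschitz[OF X]) (rule that)
  have "norm (Z t - Z s) \<le> (B * K * C * B * C) * (t - s)" if st: "0 \<le> s" "s \<le> t" "t \<le> T" for s t
  proof -
    have B0: "0 \<le> B" using order_trans[OF norm_ge_zero bdd[of s]] st by simp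
    have "norm (Z t - Z s) \<le> norm (Z t ** (X t - X s)) * norm (Z s) * C"
      unfolding diff[OF st] norm_minus_cancel by (rule C)
    also have "\<dots> \<le> ((B * (K * (t - s)) * C) * B) * C"
      using st C B0 K bdd[of t] bdd[of s]
      by (intro mult_right_mono mult_mono order_trans[OF C(2)]) auto
    finally show ?thesis by (simp add: mult_ac)
  qed
  then have Zc: "continuous_on {0..T} Z" by (rule lipschitz_continuous_on)
  note Zm = bmeas_continuous[OF Zc] and X'm = prim_bmeas[OF X]
  show "bmeas T (\<lambda>t. - (Z t ** X' t ** Z t))"
    by (rule bmeas_linear[OF bounded_linear_minus[OF bounded_linear_ident]])
      (intro bmeas_bilinear[OF mb] Zm X'm)
  \<comment> \<open>This equals \<open>Z r ** X' r ** Z r - Z t ** X' r ** Z s\<close>, arranged so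
    that every summand contains an increment of \<open>Z\<close>.\<close>
  let ?h = "\<lambda>s t r. (Z r - Z s) ** X' r ** Z r - (Z t - Z s) ** X' r ** Z s + Z s ** X' r ** (Z r - Z s)"
  have "vanish T ?h"
    by (intro vanish_diff vanish_add vanish_bilinear_left[OF mb] vanish_bilinear_right[OF mb]
        bounded3_bilinear[OF mb] bounded3_bmeas continuous_imp_vanish Zc Zm X'm)
  then have "small_o T (\<lambda>s t. integral {s..t} (?h s t))"
    by (rule small_o_integral_vanish)
      (intro bmeas_integrable[of T] bmeas_add bmeas_diff bmeas_bilinear[OF mb] bmeas_const Zm X'm, auto)
  then show "small_o T (\<lambda>s t. Z t - Z s - integral {s..t} (\<lambda>t. - (Z t ** X' t ** Z t)))"
  proof (rule small_o_cong)
    fix s t assume st: "0 \<le> s" "s \<le> t" "t \<le> T"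
    have X'i: "X' integrable_on {s..t}" using st bmeas_integrable[OF X'm] by auto
    have lin: "bounded_linear (\<lambda>Y. Z t ** Y ** Z s)"
      by (intro bounded_linear_compose[OF mm.bounded_linear_left] mm.bounded_linear_right)
    have "Z t - Z s = - integral {s..t} (\<lambda>r. Z t ** X' r ** Z s)"
      unfolding diff[OF st] primD[OF X st] integral_bounded_linear_comp[OF lin X'i] by simp
    moreover have "integral {s..t} (\<lambda>t. - (Z t ** X' t ** Z t)) = - integral {s..t} (\<lambda>r. Z r ** X' r ** Z r)"
      by simp
    moreover have "integral {s..t} (\<lambda>r. Z r ** X' r ** Z r - Z t ** X' r ** Z s) =
        integral {s..t} (\<lambda>r. Z r ** X' r ** Z r) - integral {s..t} (\<lambda>r. Z t ** X' r ** Z s)"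
      using st by (intro Henstock_Kurzweil_Integration.integral_diff bmeas_integrable[of T]
          bmeas_bilinear[OF mb] bmeas_const Zm X'm)
    moreover have "?h s t = (\<lambda>r. Z r ** X' r ** Z r - Z t ** X' r ** Z s)"
      by (simp add: fun_eq_iff mm.diff_left mm.diff_right)
    ultimately show "Z t - Z s - integral {s..t} (\<lambda>t. - (Z t ** X' t ** Z t)) = integral {s..t} (?h s t)"
      by simp
  qed
qed

text \<open>The Hamiltonian system \<open>X' = S P\<close>, \<open>P' = q X\<close>, \<open>X\<^sub>0 = 1\<close>, \<open>P\<^sub>0 = w\<^sub>0\<close> linearises the Riccati
  equation through \<open>w = P X\<^sup>-\<^sup>1\<close>. The matrix \<open>X\<^sup>T P\<close> is non-decreasing, and its growth controls
  \<open>S P x\<close>; hence \<open>X\<^sub>t x = 0\<close> would force \<open>X\<^sub>t x = x\<close>.\<close>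

lemma riccati_ode_exists:
  fixes q S :: "real \<Rightarrow> real^'n^'n"
  assumes q: "bmeas T q" and S: "bmeas T S" and T: "0 < T" and w0: "psd w0"
    and q_psd: "\<And>t. \<lbrakk>0 \<le> t; t \<le> T\<rbrakk> \<Longrightarrow> psd (q t)" and S_psd: "\<And>t. \<lbrakk>0 \<le> t; t \<le> T\<rbrakk> \<Longrightarrow> psd (S t)"
  shows "\<exists>w. w 0 = w0 \<and> prim T w (\<lambda>t. q t - w t ** S t ** w t) \<and> (\<forall>t. 0 \<le> t \<and> t \<le> T \<longrightarrow> psd (w t))"
proof -
  note mb = bounded_bilinear_matrix_mult
  \<comment> \<open>The pair \<open>(S, q)\<close> acts on \<open>(X, P)\<close> by
    \<open>(S ** P, q ** X)\<close>, which makes the Hamiltonian system a single linear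
    equation.\<close>
  define act where "act c y = (fst c ** snd y, snd c ** fst y)" for c y :: "(real^'n^'n) \<times> (real^'n^'n)"
  have act: "bounded_bilinear act"
  proof -
    have "bilinear act"
      unfolding bilinear_def act_def
      by (auto intro!: linearI simp: mm.add_left mm.add_right mm.scaleR_left mm.scaleR_right)
    then show ?thesis by (simp add: bilinear_conv_bounded_bilinear)
  qed
  have "bmeas T (\<lambda>t. (S t, 0) + (0, q t))"
    by (intro bmeas_add bmeas_linear[OF bounded_linear_Pair[OF bounded_linear_ident bounded_linear_zero] S]
        bmeas_linear[OF bounded_linear_Pair[OF bounded_linear_zero bounded_linear_ident] q])
  then have "bmeas T (\<lambda>t. (S t, q t))" by simp
  from linear_ode_exists[OF act this T, of "(mat 1, w0)"]
  obtain y where y: "y 0 = (mat 1, w0)" "prim T y (\<lambda>t. act (S t, q t) (y t))" by blast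
  define X P where "X = (\<lambda>t. fst (y t))" and "P = (\<lambda>t. snd (y t))"
  have X: "prim T X (\<lambda>t. S t ** P t)" and P: "prim T P (\<lambda>t. q t ** X t)"
    using prim_linear[OF bounded_linear_fst y(2)] prim_linear[OF bounded_linear_snd y(2)]
    by (simp_all add: X_def P_def act_def)
  have X0: "X 0 = mat 1" and P0: "P 0 = w0" by (simp_all add: X_def P_def y)
  note Xc = prim_continuous[OF X] and Pc = prim_continuous[OF P]
  note Xm = bmeas_continuous[OF Xc] and Pm = bmeas_continuous[OF Pc]
  define E where "E t = transpose (X t) ** P t" for t
  \<comment> \<open>\<open>G\<close> and \<open>H\<close> are the two parts of the derivative of
    \<open>E\<close>, both congruences of positive semi-definite matrices.\<close>
  define G where "G t = transpose (P t) ** S t ** P t" for t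
  define H where "H t = transpose (X t) ** q t ** X t" for t
  have Gm: "bmeas T G" and Hm: "bmeas T H"
    unfolding G_def H_def
    by (intro bmeas_bilinear[OF mb] bmeas_linear[OF bounded_linear_transpose] q S Xm Pm)+
  have G_psd: "psd (G t)" and H_psd: "psd (H t)" if "0 \<le> t" "t \<le> T" for t
    unfolding G_def H_def using that by (auto intro: psd_congruence q_psd S_psd)
  have E_eq: "E t = w0 + (integral {0..t} G + integral {0..t} H)" if t: "0 \<le> t" "t \<le> T" for t
  proof -
    have "prim T E (\<lambda>t. transpose (S t ** P t) ** P t + transpose (X t) ** (q t ** X t))"
      unfolding E_def by (intro prim_bilinear[OF mb] prim_linear[OF bounded_linear_transpose] X P)
    then have "E t - E 0 = integral {0..t} (\<lambda>t. transpose (S t ** P t) ** P t + transpose (X t) ** (q t ** X t))"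
      using t by (intro primD) auto
    also have "\<dots> = integral {0..t} (\<lambda>t. G t + H t)"
      using S_psd t by (intro Henstock_Kurzweil_Integration.integral_cong)
        (auto simp: G_def H_def matrix_transpose_mul matrix_mul_assoc psd_def)
    also have "\<dots> = integral {0..t} G + integral {0..t} H"
      using t by (intro Henstock_Kurzweil_Integration.integral_add bmeas_integrable[OF Gm]
          bmeas_integrable[OF Hm]) auto
    finally show ?thesis by (simp add: E_def X0 P0 algebra_simps)
  qed
  have E_psd: "psd (E t)" if t: "0 \<le> t" "t \<le> T" for t
    unfolding E_eq[OF t] using t
    by (intro psd_add w0 psd_integral bmeas_integrable[OF Gm] bmeas_integrable[OF Hm] G_psd H_psd) auto
  have X_inj: "x = 0" if t: "0 \<le> t" "t \<le> T" and x: "X t *v x = 0" for t x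
  proof -
    have lin: "bounded_linear (\<lambda>M. x \<bullet> (M *v x))" for x :: "real^'n"
      by (intro bounded_linear_inner_right_comp bounded_linear_matrix_vector)
    have Gi: "G integrable_on {0..t}" and Hi: "H integrable_on {0..t}" and Si: "S integrable_on {0..t}"
      using t bmeas_integrable[OF Gm] bmeas_integrable[OF Hm] bmeas_integrable[OF S] by auto
    have "x \<bullet> (E t *v x) = 0"
      using x by (simp add: E_def inner_transpose_matrix_vector flip: matrix_vector_mul_assoc)
    then have "x \<bullet> (w0 *v x) + (x \<bullet> (integral {0..t} G *v x) + x \<bullet> (integral {0..t} H *v x)) = 0"
      using E_eq[OF t] by (simp add: matrix_vector_mult_add_rdistrib inner_add_right)
    moreover have "psd (integral {0..t} G)" "psd (integral {0..t} H)"
      using t Gi Hi G_psd H_psd by (auto intro!: psd_integral)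
    moreover have "0 \<le> x \<bullet> (w0 *v x)" using w0 by (simp add: psd_def)
    ultimately have "x \<bullet> (integral {0..t} G *v x) = 0"
      unfolding psd_def by (metis add_nonneg_eq_0_iff add_nonneg_nonneg)
    \<comment> \<open>On the kernel of \<open>X t\<close> the form of \<open>E t\<close> vanishes,
      hence so does each of its three nonnegative parts, coming from \<open>w0\<close>,
      \<open>G\<close> and \<open>H\<close>.\<close>
    then have intG: "integral {0..t} (\<lambda>r. x \<bullet> (G r *v x)) = 0"
      using integral_bounded_linear_comp[OF lin Gi] by simp
    define c where "c = integral {0..t} (\<lambda>r. x \<bullet> (S r *v x))"
    have SPm: "bmeas T (\<lambda>r. S r ** P r)" by (intro bmeas_bilinear[OF mb] S Pm)
    have SPi: "(\<lambda>r. S r ** P r) integrable_on {0..t}" using t by (intro bmeas_integrable[OF SPm]) auto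
    have "integral {0..t} (\<lambda>r. x \<bullet> ((S r ** P r) *v x)) = x \<bullet> ((X t - X 0) *v x)"
      using primD[OF X, of 0 t] t integral_bounded_linear_comp[OF lin SPi] by simp
    also have "\<dots> = - (x \<bullet> x)"
      by (simp add: matrix_vector_mult_diff_rdistrib x X0 inner_diff_right)
    finally have intSP: "integral {0..t} (\<lambda>r. x \<bullet> ((S r ** P r) *v x)) = - (x \<bullet> x)" .
    \<comment> \<open>Cauchy-Schwarz for the integrated form of \<open>S\<close>, written with a
      free parameter: the form is nonnegative at \<open>l x + P x\<close>, its pure \<open>P\<close>
      part integrates to 0 and its mixed part to \<open>- 2 l (x \<bullet> x)\<close>.\<close>
    have key: "2 * (x \<bullet> x) \<le> l * c" if l: "0 < l" for l
    proof -
      let ?f = "\<lambda>r. (l * l) * (x \<bullet> (S r *v x))" and ?g = "\<lambda>r. x \<bullet> (G r *v x)"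
        and ?h = "\<lambda>r. (2 * l) * (x \<bullet> ((S r ** P r) *v x))"
      have f: "?f integrable_on {0..t}"
        using integrable_cmul[OF integrable_linear[OF Si lin[of x]], of "l * l"] by (simp add: o_def)
      have g: "?g integrable_on {0..t}"
        using integrable_linear[OF Gi lin[of x]] by (simp add: o_def)
      have h: "?h integrable_on {0..t}"
        using integrable_cmul[OF integrable_linear[OF SPi lin[of x]], of "2 * l"] by (simp add: o_def)
      have "0 \<le> integral {0..t} (\<lambda>r. ?f r + ?g r + ?h r)"
      proof (rule Henstock_Kurzweil_Integration.integral_nonneg)
        show "(\<lambda>r. ?f r + ?g r + ?h r) integrable_on {0..t}"
          by (intro integrable_add f g h)
        fix r assume r: "r \<in> {0..t}"
        have sp: "psd (S r)" using r t S_psd by auto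
        have sym: "(P r *v x) \<bullet> (S r *v x) = x \<bullet> (S r *v (P r *v x))"
          using sp inner_transpose_matrix_vector[of "P r *v x" "S r" x]
          by (simp add: psd_def inner_commute)
        have "0 \<le> (l *\<^sub>R x + P r *v x) \<bullet> (S r *v (l *\<^sub>R x + P r *v x))"
          using sp by (simp add: psd_def)
        also have "\<dots> = ?f r + ?g r + ?h r"
          using sym by (simp add: G_def inner_transpose_matrix_vector matrix_vector_right_distrib inner_add_left
            inner_add_right matrix_vector_mult_scaleR algebra_simps flip: matrix_vector_mul_assoc)
        finally show "0 \<le> ?f r + ?g r + ?h r" .
      qed
      also have "\<dots> = integral {0..t} ?f + integral {0..t} ?g + integral {0..t} ?h"
        using Henstock_Kurzweil_Integration.integral_add[OF integrable_add[OF f g] h]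
          Henstock_Kurzweil_Integration.integral_add[OF f g] by simp
      also have "integral {0..t} ?g = 0" by (rule intG)
      also have "integral {0..t} ?h = (2 * l) * (- (x \<bullet> x))"
        unfolding intSP[symmetric] by (rule Henstock_Kurzweil_Integration.integral_mult_right)
      also have "integral {0..t} ?f = (l * l) * c"
        unfolding c_def by (rule Henstock_Kurzweil_Integration.integral_mult_right)
      finally have "l * (2 * (x \<bullet> x)) \<le> l * (l * c)" by (simp add: algebra_simps)
      then show ?thesis using l by simp
    qed
    have "2 * (x \<bullet> x) \<le> 0"
    proof (rule ccontr)
      assume "\<not> ?thesis"
      then have pos: "0 < x \<bullet> x" by linarith
      \<comment> \<open>Small enough that \<open>l * c\<close> is at most
        \<open>x \<bullet> x\<close>; the summand 1 avoids division by 0.\<close>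
      define l where "l = (x \<bullet> x) / (\<bar>c\<bar> + 1)"
      have "0 < l" using pos by (simp add: l_def)
      from key[OF this] have "2 * (x \<bullet> x) \<le> l * c" .
      also have "\<dots> \<le> l * (\<bar>c\<bar> + 1)" using \<open>0 < l\<close> by (intro mult_left_mono) auto
      also have "\<dots> = x \<bullet> x" by (simp add: l_def)
      finally show False using pos by simp
    qed
    then have "x \<bullet> x = 0" using inner_ge_zero[of x] by linarith
    then show "x = 0" by simp
  qed
  define Z where "Z t = (SOME Z. Z ** X t = mat 1)" for t
  have Z: "Z t ** X t = mat 1" if "0 \<le> t" "t \<le> T" for t
  proof -
    have "\<exists>Z. Z ** X t = mat 1"
      using X_inj[OF that] by (simp add: matrix_left_invertible_ker)
    then show ?thesis unfolding Z_def by (rule someI_ex)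
  qed
  then have Z': "X t ** Z t = mat 1" if "0 \<le> t" "t \<le> T" for t
    using that by (simp add: matrix_left_right_inverse)
  have "\<exists>B. \<forall>t. 0 \<le> t \<and> t \<le> T \<longrightarrow> norm (Z t) \<le> B"
  proof -
    \<comment> \<open>Pointwise invertibility is not enough, \<open>Z\<close> has to be bounded on
      \<open>[0, T]\<close>. The minimum of \<open>norm (X t *v x)\<close> over times and unit
      vectors is attained and positive, and its reciprocal bounds the entries of
      \<open>Z\<close>.\<close>
    let ?D = "{0..T} \<times> sphere (0::real^'n) 1"
    let ?g = "\<lambda>p. norm (X (fst p) *v snd p)"
    have bmv: "bounded_bilinear ((*v) :: real^'n^'n \<Rightarrow> real^'n \<Rightarrow> real^'n)"
      by (simp add: bilinear_conv_bounded_bilinear[symmetric] bilinear_def linear_conv_bounded_linear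
          bounded_linear_matrix_vector)
    have "continuous_on ?D (\<lambda>p. X (fst p))"
      by (rule continuous_on_compose2[OF Xc continuous_on_fst[OF continuous_on_id]]) auto
    then have "continuous_on ?D ?g"
      by (intro continuous_on_norm bounded_bilinear.continuous_on[OF bmv] continuous_on_snd continuous_on_id)
    moreover have "compact ?D" by (intro compact_Times) auto
    moreover have "(0, axis undefined 1) \<in> ?D" using T by (simp add: norm_axis_1)
    ultimately obtain p where p: "p \<in> ?D" "\<And>p'. p' \<in> ?D \<Longrightarrow> ?g p \<le> ?g p'"
      using continuous_attains_inf[of ?D ?g] by blast
    define c where "c = ?g p"
    have c: "0 < c"
      using p(1) X_inj[of "fst p" "snd p"] by (auto simp: c_def mem_Times_iff)
    have low: "c * norm x \<le> norm (X t *v x)" if "0 \<le> t" "t \<le> T" for t x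
    proof (cases "x = 0")
      case False
      have "c \<le> ?g (t, x /\<^sub>R norm x)"
        unfolding c_def using that False by (intro p) auto
      also have "\<dots> = norm (X t *v x) / norm x"
        by (simp add: matrix_vector_mult_scaleR divide_inverse_commute)
      finally show ?thesis using False by (simp add: field_simps)
    qed simp
    have "norm (Z t) \<le> real CARD('n) * (real CARD('n) * (1 / c))" if t: "0 \<le> t" "t \<le> T" for t
    proof (rule norm_le_entries)
      fix i j
      have "Z t $ i $ j = (Z t *v axis j 1) $ i"
        by (simp add: matrix_vector_mult_basis column_def)
      also have "\<bar>\<dots>\<bar> \<le> norm (Z t *v axis j 1)" by (rule component_le_norm_cart)
      finally have "c * \<bar>Z t $ i $ j\<bar> \<le> c * norm (Z t *v axis j 1)" using c by simp
      also have "\<dots> \<le> norm (X t *v (Z t *v axis j 1))" using low[OF t] .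
      also have "\<dots> = 1" using Z'[OF t] by (simp add: matrix_vector_mul_assoc)
      finally show "\<bar>Z t $ i $ j\<bar> \<le> 1 / c" using c by (simp add: field_simps)
    qed
    then show ?thesis by blast
  qed
  then obtain B where B: "\<And>t. \<lbrakk>0 \<le> t; t \<le> T\<rbrakk> \<Longrightarrow> norm (Z t) \<le> B" by blast
  have Zp: "prim T Z (\<lambda>t. - (Z t ** (S t ** P t) ** Z t))"
    by (rule prim_matrix_inverse[OF X Z' Z B])
  define w where "w t = P t ** Z t" for t
  have wp: "prim T w (\<lambda>t. q t ** X t ** Z t + P t ** (- (Z t ** (S t ** P t) ** Z t)))"
    unfolding w_def by (rule prim_bilinear[OF mb P Zp])
  note wc = prim_continuous[OF wp]
  note wm = bmeas_continuous[OF wc]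
  have "prim T w (\<lambda>t. q t - w t ** S t ** w t)"
    unfolding prim_def
  proof (intro conjI allI impI)
    show "bmeas T (\<lambda>t. q t - w t ** S t ** w t)"
      by (intro bmeas_diff bmeas_bilinear[OF mb] q S wm)
    fix s t assume st: "0 \<le> s \<and> s \<le> t \<and> t \<le> T"
    then have "w t - w s = integral {s..t} (\<lambda>t. q t ** X t ** Z t + P t ** (- (Z t ** (S t ** P t) ** Z t)))"
      by (intro primD[OF wp]) auto
    also have "\<dots> = integral {s..t} (\<lambda>t. q t - w t ** S t ** w t)"
    proof (rule Henstock_Kurzweil_Integration.integral_cong)
      fix r assume "r \<in> {s..t}"
      then have "X r ** Z r = mat 1" using st Z' by auto
      then show "q r ** X r ** Z r + P r ** (- (Z r ** (S r ** P r) ** Z r)) = q r - w r ** S r ** w r"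
        by (simp add: w_def mm.minus_right matrix_mul_assoc flip: matrix_mul_assoc[of "q r"])
    qed
    finally show "w t - w s = integral {s..t} (\<lambda>t. q t - w t ** S t ** w t)" .
  qed
  moreover have "w 0 = w0"
    using Z'[of 0] T by (simp add: w_def X0 P0)
  moreover have "psd (w t)" if t: "0 \<le> t" "t \<le> T" for t
  proof -
    \<comment> \<open>\<open>E\<close> is \<open>transpose X ** P\<close>, so congruence with
      \<open>Z\<close> turns it into \<open>P ** Z\<close>; symmetry and positivity of
      \<open>w\<close> are both inherited from \<open>E\<close>.\<close>
    have "transpose (Z t) ** E t ** Z t = transpose (X t ** Z t) ** (P t ** Z t)"
      by (simp add: E_def matrix_transpose_mul matrix_mul_assoc)
    also have "\<dots> = w t"
      using Z'[OF t] by (simp add: w_def)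
    finally show ?thesis
      using psd_congruence[OF E_psd[OF t], of "Z t"] by simp
  qed
  ultimately show ?thesis by blast
qed

text \<open>The difference of the quadratic terms telescopes into three products, each linear in one
  difference. The estimate serves twice: with \<eta> = 0 it is uniqueness, with \<eta> proportional
  to the distance of data it is Lipschitz dependence.\<close>

lemma riccati_ode_compare:
  fixes w v :: "real \<Rightarrow> real^'n^'n"
  assumes C: "C \<ge> 0" "\<And>(x::real^'n^'n) (y::real^'n^'n). norm (x ** y) \<le> norm x * norm y * C"
    and w: "prim T w (\<lambda>t. q t - w t ** S t ** w t)" and v: "prim T v (\<lambda>t. p t - v t ** R t ** v t)"
    and B: "\<And>t. \<lbrakk>0 \<le> t; t \<le> T\<rbrakk> \<Longrightarrow> norm (w t) \<le> B \<and> norm (v t) \<le> B \<and> norm (S t) \<le> B \<and> norm (R t) \<le> B"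
    and \<eta>: "\<And>t. \<lbrakk>0 \<le> t; t \<le> T\<rbrakk> \<Longrightarrow> norm (q t - p t) \<le> \<eta> \<and> norm (S t - R t) \<le> \<eta>"
    and t: "0 \<le> t" "t \<le> T"
  shows "norm (w t - v t) \<le> (norm (w 0 - v 0) + (1 + B * B * C * C) * \<eta> * T) * exp (2 * (B * B * C * C) * T)"
proof (rule prim_gronwall[OF prim_diff[OF w v] _ _ _ t])
  have B0: "0 \<le> B" and \<eta>0: "0 \<le> \<eta>"
    using B[of t] \<eta>[of t] t norm_ge_zero order_trans by blast+
  show "0 \<le> 2 * (B * B * C * C)" "0 \<le> (1 + B * B * C * C) * \<eta>"
    using B0 \<eta>0 C by auto
  have 3: "norm (x ** y ** z) \<le> X * Y * C * Z * C" if "norm x \<le> X" "norm y \<le> Y" "norm z \<le> Z"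
    for x y z :: "real^'n^'n" and X Y Z
    using that C order_trans[OF norm_ge_zero that(1)] order_trans[OF norm_ge_zero that(2)]
    by (intro order_trans[OF C(2)] mult_right_mono mult_mono) auto
  fix t assume t: "0 \<le> t" "t \<le> T"
  have "q t - w t ** S t ** w t - (p t - v t ** R t ** v t) = (q t - p t)
    - ((w t - v t) ** S t ** w t + v t ** (S t - R t) ** w t + v t ** R t ** (w t - v t))"
    by (simp add: mm.diff_left mm.diff_right)
  also have "norm \<dots> \<le> \<eta> + ((norm (w t - v t) * B * C * B * C + B * \<eta> * C * B * C) + B * B * C * norm (w t - v t) * C)"
    using B[OF t] \<eta>[OF t]
    by (intro order_trans[OF norm_triangle_ineq4[of "q t - p t"]] add_mono[where a = "norm (q t - p t)"]
        norm_triangle_mono[where b = "v t ** R t ** (w t - v t)"]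
        norm_triangle_mono[where a = "(w t - v t) ** S t ** w t"] 3) (simp_all del: norm_triangle_ineq4)
  also have "\<dots> = 2 * (B * B * C * C) * norm (w t - v t) + (1 + B * B * C * C) * \<eta>"
    by (simp add: algebra_simps)
  finally show "norm (q t - w t ** S t ** w t - (p t - v t ** R t ** v t))
    \<le> 2 * (B * B * C * C) * norm (w t - v t) + (1 + B * B * C * C) * \<eta>" .
qed

lemma riccati_ode_unique:
  fixes w v :: "real \<Rightarrow> real^'n^'n"
  assumes w: "prim T w (\<lambda>t. q t - w t ** S t ** w t)" and v: "prim T v (\<lambda>t. q t - v t ** S t ** v t)"
    and S: "bmeas T S" and "w 0 = v 0" and t: "0 \<le> t" "t \<le> T"
  shows "w t = v t"
proof -
  obtain C :: real where C: "C > 0" "\<And>(x::real^'n^'n) (y::real^'n^'n). norm (x ** y) \<le> norm x * norm y * C"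
    using mm.pos_bounded by blast
  obtain B1 where B1: "0 < B1" "\<And>t. \<lbrakk>0 \<le> t; t \<le> T\<rbrakk> \<Longrightarrow> norm (w t) \<le> B1"
    using bmeas_bound[OF bmeas_continuous[OF prim_continuous[OF w]]] by blast
  obtain B2 where B2: "0 < B2" "\<And>t. \<lbrakk>0 \<le> t; t \<le> T\<rbrakk> \<Longrightarrow> norm (v t) \<le> B2"
    using bmeas_bound[OF bmeas_continuous[OF prim_continuous[OF v]]] by blast
  obtain B3 where B3: "0 < B3" "\<And>t. \<lbrakk>0 \<le> t; t \<le> T\<rbrakk> \<Longrightarrow> norm (S t) \<le> B3"
    using bmeas_bound[OF S] by blast
  let ?B = "B1 + B2 + B3"
  have "norm (w t - v t) \<le> (norm (w 0 - v 0) + (1 + ?B * ?B * C * C) * 0 * T) * exp (2 * (?B * ?B * C * C) * T)"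
  proof (rule riccati_ode_compare[OF _ C(2) w v _ _ t])
    fix t assume "0 \<le> t" "t \<le> T"
    then show "norm (w t) \<le> ?B \<and> norm (v t) \<le> ?B \<and> norm (S t) \<le> ?B \<and> norm (S t) \<le> ?B"
      using B1(1) B1(2)[of t] B2(1) B2(2)[of t] B3(1) B3(2)[of t] by linarith
  qed (use C in auto)
  then show ?thesis using assms by simp
qed

lemma riccati_ode_bound:
  fixes w q :: "real \<Rightarrow> real^'n^'n"
  assumes w: "prim T w (\<lambda>t. q t - w t ** S t ** w t)" and q: "bmeas T q"
    and w_psd: "\<And>t. \<lbrakk>0 \<le> t; t \<le> T\<rbrakk> \<Longrightarrow> psd (w t)" and S_psd: "\<And>t. \<lbrakk>0 \<le> t; t \<le> T\<rbrakk> \<Longrightarrow> psd (S t)"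
    and K: "norm (w 0) \<le> K" "\<And>t. \<lbrakk>0 \<le> t; t \<le> T\<rbrakk> \<Longrightarrow> norm (q t) \<le> K"
    and t: "0 \<le> t" "t \<le> T"
  shows "norm (w t) \<le> real CARD('n) * (real CARD('n) * (K + K * T))"
proof (rule psd_norm_le[OF w_psd[OF t]])
  fix i :: 'n
  let ?e = "axis i (1::real)"
  have lin: "bounded_linear (\<lambda>M :: real^'n^'n. M $ i $ i)"
    by (intro bounded_linear_compose[OF bounded_linear_vec_nth] bounded_linear_vec_nth)
  have entry: "\<bar>M $ i $ i\<bar> \<le> norm M" for M :: "real^'n^'n"
    by (meson component_le_norm_cart Finite_Cartesian_Product.norm_nth_le order_trans)
  have K0: "0 \<le> K" using K(1) norm_ge_zero order_trans by blast
  have wm: "bmeas T (\<lambda>t. q t - w t ** S t ** w t)" by (rule prim_bmeas[OF w])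
  have wi: "(\<lambda>t. q t - w t ** S t ** w t) integrable_on {0..t}"
    using t by (intro bmeas_integrable[OF wm]) auto
  have qi: "q integrable_on {0..t}" using t by (intro bmeas_integrable[OF q]) auto
  have "w t $ i $ i - w 0 $ i $ i = (w t - w 0) $ i $ i" by simp
  also have "\<dots> = integral {0..t} (\<lambda>r. (q r - w r ** S r ** w r) $ i $ i)"
    using primD[OF w, of 0 t] t integral_bounded_linear_comp[OF lin wi] by simp
  also have "\<dots> \<le> integral {0..t} (\<lambda>r. K)"
  proof (rule Henstock_Kurzweil_Integration.integral_le)
    show "(\<lambda>r. (q r - w r ** S r ** w r) $ i $ i) integrable_on {0..t}"
      using integrable_linear[OF wi lin] by (simp add: o_def)
    fix r assume "r \<in> {0..t}"
    then have r: "0 \<le> r" "r \<le> T" using t by auto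
    have wt: "transpose (w r) = w r" using w_psd[OF r] by (simp add: psd_def)
    have "(w r ** S r ** w r) $ i $ i = ?e \<bullet> ((transpose (w r) ** S r ** w r) *v ?e)"
      unfolding wt by (simp add: inner_axis' matrix_vector_mult_basis column_def)
    also have "\<dots> \<ge> 0"
      unfolding quadratic_form_congruence using S_psd[OF r] by (simp add: psd_def)
    finally show "(q r - w r ** S r ** w r) $ i $ i \<le> K"
      using K(2)[OF r] entry[of "q r"] by simp
  qed auto
  also have "\<dots> \<le> K * T" using t K0 by (simp add: mult_left_mono mult.commute)
  finally show "w t $ i $ i \<le> K + K * T"
    using K(1) entry[of "w 0"] by simp
qed

section \<open>The data of the rough Riccati equation\<close>

lemma holder_finite_iff:
  "holder_finite T \<gamma> \<Xi> \<longleftrightarrow>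
    (\<exists>K. \<forall>s t. 0 \<le> s \<and> s < t \<and> t \<le> T \<longrightarrow> norm (\<Xi> s t) \<le> K * (t - s) powr \<gamma>)"
proof -
  have "norm (\<Xi> s t) / (t - s) powr \<gamma> \<le> K \<longleftrightarrow> norm (\<Xi> s t) \<le> K * (t - s) powr \<gamma>" if "s < t" for s t K
    using that by (simp add: pos_divide_le_eq)
  then have "(\<forall>s t. 0 \<le> s \<and> s < t \<and> t \<le> T \<longrightarrow> norm (\<Xi> s t) / (t - s) powr \<gamma> \<le> K) \<longleftrightarrow>
      (\<forall>s t. 0 \<le> s \<and> s < t \<and> t \<le> T \<longrightarrow> norm (\<Xi> s t) \<le> K * (t - s) powr \<gamma>)" for K
    by blast
  moreover have "holder_finite T \<gamma> \<Xi> \<longleftrightarrow>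
      (\<exists>K. \<forall>s t. 0 \<le> s \<and> s < t \<and> t \<le> T \<longrightarrow> norm (\<Xi> s t) / (t - s) powr \<gamma> \<le> K)"
    unfolding holder_finite_def holder_quotients_def bdd_above_def by blast
  ultimately show ?thesis by simp
qed

lemma holder_finite_diff:
  assumes "holder_finite T \<gamma> f" "holder_finite T \<gamma> g"
  shows "holder_finite T \<gamma> (\<lambda>s t. f s t - g s t)"
proof -
  obtain K where K: "\<And>s t. 0 \<le> s \<and> s < t \<and> t \<le> T \<Longrightarrow> norm (f s t) \<le> K * (t - s) powr \<gamma>"
    using assms(1) unfolding holder_finite_iff by blast
  obtain L where L: "\<And>s t. 0 \<le> s \<and> s < t \<and> t \<le> T \<Longrightarrow> norm (g s t) \<le> L * (t - s) powr \<gamma>"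
    using assms(2) unfolding holder_finite_iff by blast
  have "norm (f s t - g s t) \<le> (K + L) * (t - s) powr \<gamma>" if "0 \<le> s \<and> s < t \<and> t \<le> T" for s t
    using order_trans[OF norm_triangle_ineq4 add_mono[OF K[OF that] L[OF that]]]
    by (simp add: distrib_right)
  then show ?thesis unfolding holder_finite_iff by blast
qed

lemma holder_seminorm_bound:
  assumes "holder_finite T \<gamma> \<Xi>" "0 \<le> s" "s < t" "t \<le> T"
  shows "norm (\<Xi> s t) \<le> holder_seminorm T \<gamma> \<Xi> * (t - s) powr \<gamma>"
proof -
  have "norm (\<Xi> s t) / (t - s) powr \<gamma> \<le> holder_seminorm T \<gamma> \<Xi>"
    unfolding holder_seminorm_def using assms
    by (intro cSup_upper) (auto simp: holder_finite_def holder_quotients_def)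
  then show ?thesis using assms by (simp add: pos_divide_le_eq)
qed

lemma holder_seminorm_nonneg:
  assumes "holder_finite T \<gamma> \<Xi>" "0 < T"
  shows "0 \<le> holder_seminorm T \<gamma> \<Xi>"
proof -
  \<comment> \<open>A supremum of nonnegative quotients is nonnegative only if there is a quotient;
    \<open>0 < T\<close> provides the one at \<open>(0, T)\<close>.\<close>
  have "0 \<le> norm (\<Xi> 0 T) / (T - 0) powr \<gamma>" by simp
  also have "\<dots> \<le> holder_seminorm T \<gamma> \<Xi>"
    unfolding holder_seminorm_def
  proof (rule cSup_upper)
    show "norm (\<Xi> 0 T) / (T - 0) powr \<gamma> \<in> holder_quotients T \<gamma> \<Xi>"
      unfolding holder_quotients_def using assms(2) by blast
  qed (use assms(1) in \<open>simp add: holder_finite_def\<close>)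
  finally show ?thesis .
qed

lemma holder_seminorm_zero:
  assumes "0 < T"
  shows "holder_seminorm T \<gamma> (\<lambda>s t. 0) = 0"
proof -
  have "holder_quotients T \<gamma> (\<lambda>s t. 0 :: 'a) = {0}"
    using assms unfolding holder_quotients_def
    by auto
  then show ?thesis by (simp add: holder_seminorm_def)
qed

lemma sup_norm_bound:
  assumes "bounded (f ` {0..T})" "0 \<le> t" "t \<le> T"
  shows "norm (f t) \<le> sup_norm T f"
proof -
  have "bdd_above ((\<lambda>t. norm (f t)) ` {0..T})"
    using assms(1) by (simp add: bdd_above_norm image_image flip: bdd_above_norm)
  then show ?thesis
    unfolding sup_norm_def using assms(2,3) by (intro cSUP_upper) auto
qed

text \<open>The drift names the derivative of the bracket by \<open>vector_derivative\<close> within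
  \<open>[0, T]\<close>; for \<open>0 < T\<close> this agrees with the continuous derivative that
  \<open>C1_on_interval\<close> merely asserts to exist, also at the two end points.\<close>

lemma C1_on_interval_prim:
  assumes "C1_on_interval T f" "0 < T"
  shows "continuous_on {0..T} (\<lambda>t. vector_derivative f (at t within {0..T}))"
    and "prim T f (\<lambda>t. vector_derivative f (at t within {0..T}))"
proof -
  obtain D where D: "continuous_on {0..T} D"
    "\<And>t. t \<in> {0..T} \<Longrightarrow> (f has_vector_derivative D t) (at t within {0..T})"
    using assms(1) unfolding C1_on_interval_def by blast
  have eq: "vector_derivative f (at t within {0..T}) = D t" if "t \<in> {0..T}" for t
    using vector_derivative_within_cbox[of 0 T t f "D t"] D(2)[OF that] that assms(2) by simp
  show 1: "continuous_on {0..T} (\<lambda>t. vector_derivative f (at t within {0..T}))"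
    by (rule continuous_on_eq[OF D(1)]) (rule eq[symmetric])
  show "prim T f (\<lambda>t. vector_derivative f (at t within {0..T}))"
    unfolding prim_def
  proof (intro conjI allI impI bmeas_continuous 1)
    fix s t assume st: "0 \<le> s \<and> s \<le> t \<and> t \<le> T"
    have "(D has_integral f t - f s) {s..t}"
      using st by (intro fundamental_theorem_of_calculus)
        (auto intro: has_vector_derivative_within_subset[OF D(2)])
    then have "integral {s..t} D = f t - f s" by (rule integral_unique)
    moreover have "integral {s..t} (\<lambda>t. vector_derivative f (at t within {0..T})) = integral {s..t} D"
      using st by (intro Henstock_Kurzweil_Integration.integral_cong eq) auto
    ultimately show "f t - f s = integral {s..t} (\<lambda>t. vector_derivative f (at t within {0..T}))"
      by simp
  qed
qed

lemma powr_le_powr_smaller: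
  fixes x T :: real
  assumes "0 \<le> x" "x \<le> T" "a \<le> b"
  shows "x powr b \<le> T powr (b - a) * x powr a"
proof -
  have "x powr b = x powr (b - a) * x powr a"
    by (simp flip: powr_add)
  also have "\<dots> \<le> T powr (b - a) * x powr a"
    using assms by (intro mult_right_mono powr_mono2) auto
  finally show ?thesis .
qed

text \<open>Finitely many of the neighbourhoods cover the compact interval, so local boundedness is
  boundedness.\<close>

lemma coeff_ok_bmeas:
  assumes "coeff_ok T f"
  shows "bmeas T f"
proof -
  have "\<forall>x\<in>{0..T}. \<exists>U. open U \<and> x \<in> U \<and> bounded (f ` (U \<inter> {0..T}))"
    using assms by (simp add: coeff_ok_def locally_bounded_on_def)
  then obtain U where "\<forall>x\<in>{0..T}. open (U x) \<and> x \<in> U x \<and> bounded (f ` (U x \<inter> {0..T}))"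
    unfolding bchoice_iff by blast
  then have U: "\<And>x. x \<in> {0..T} \<Longrightarrow> open (U x) \<and> x \<in> U x \<and> bounded (f ` (U x \<inter> {0..T}))"
    by blast
  have "\<exists>F\<subseteq>{0..T}. finite F \<and> {0..T} \<subseteq> (\<Union>x\<in>F. U x)"
  proof (rule compactE_image[OF compact_Icc[of 0 T], of "{0..T}" U])
    show "open (U x)" if "x \<in> {0..T}" for x using U[OF that] by blast
    show "{0..T} \<subseteq> (\<Union>x\<in>{0..T}. U x)" using U by blast
  qed blast
  then obtain F where F: "finite F" "F \<subseteq> {0..T}" "{0..T} \<subseteq> (\<Union>x\<in>F. U x)"
    by blast
  have "bounded (\<Union>x\<in>F. f ` (U x \<inter> {0..T}))"
    using F U by (intro bounded_UN) auto
  then have "bounded (f ` {0..T})"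
    by (rule bounded_subset) (use F(3) in blast)
  then show ?thesis using assms by (simp add: bmeas_def coeff_ok_def)
qed

lemma chen_refl:
  assumes "chen T Y" "0 \<le> s" "s \<le> T"
  shows "snd Y s s = 0"
proof -
  have "snd Y s s = snd Y s s + snd Y s s + tensor (incr (fst Y) s s) (incr (fst Y) s s)"
    using assms unfolding chen_def by blast
  then show ?thesis by (simp add: incr_def tensor_def vec_eq_iff)
qed

text \<open>The one fact that is not read off the definitions concerns \<open>circ\<close>, which
  adds half a bracket increment to the second level. That increment is Lipschitz, hence of order
  \<open>2 * \<alpha>\<close> on a bounded interval because \<alpha> is at most 1/2.\<close>

lemma admissible_holder:
  assumes E: "admissible T \<alpha> E" and T: "0 < T" and \<alpha>: "\<alpha> \<le> 1/2"
  shows "holder_finite T \<alpha> (incr (fst (dat_Y E)))"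
    "holder_finite T (2 * \<alpha>) (snd (circ (dat_Y E)))"
    "holder_finite T 1 (incr (bracket (dat_Y E)))"
    "holder_finite T \<alpha> (incr (dat_F' E))"
    "holder_finite T (2 * \<alpha>) (ctrl_remainder (fst (dat_Y E)) (dat_F E) (dat_F' E))"
    "chen T (dat_Y E)"
    "bmeas T (dat_C E)" "bmeas T (dat_H E)" "bmeas T (dat_Q E)" "bmeas T (dat_R E)"
proof -
  note * = E[unfolded admissible_def rough_path_C01_def rough_path_def controlled_def]
  show 1: "holder_finite T \<alpha> (incr (fst (dat_Y E)))" "chen T (dat_Y E)"
    "holder_finite T \<alpha> (incr (dat_F' E))"
    "holder_finite T (2 * \<alpha>) (ctrl_remainder (fst (dat_Y E)) (dat_F E) (dat_F' E))"
    using * by auto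
  show "bmeas T (dat_C E)" "bmeas T (dat_H E)" "bmeas T (dat_Q E)" "bmeas T (dat_R E)"
    using * coeff_ok_bmeas by auto
  have "prim T (bracket (dat_Y E)) (\<lambda>t. vector_derivative (bracket (dat_Y E)) (at t within {0..T}))"
    using * C1_on_interval_prim(2)[OF _ T] by auto
  then obtain K where K: "0 < K" "\<And>s t. \<lbrakk>0 \<le> s; s \<le> t; t \<le> T\<rbrakk> \<Longrightarrow>
    norm (bracket (dat_Y E) t - bracket (dat_Y E) s) \<le> K * (t - s)"
    by (rule prim_lipschitz) (rule that)
  then show b: "holder_finite T 1 (incr (bracket (dat_Y E)))"
    unfolding holder_finite_iff incr_def by (intro exI[of _ K]) auto
  have "holder_finite T (2 * \<alpha>) (\<lambda>s t. - ((1/2) *\<^sub>R incr (bracket (dat_Y E)) s t))"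
    unfolding holder_finite_iff
  proof (intro exI allI impI)
    fix s t assume st: "0 \<le> s \<and> s < t \<and> t \<le> T"
    have "norm (- ((1/2) *\<^sub>R incr (bracket (dat_Y E)) s t)) \<le> K * (t - s) powr 1"
      using K(2)[of s t] norm_ge_zero[of "bracket (dat_Y E) t - bracket (dat_Y E) s"] st
      unfolding incr_def by (simp del: norm_ge_zero)
    also have "\<dots> \<le> K * (T powr (1 - 2 * \<alpha>) * (t - s) powr (2 * \<alpha>))"
      using st K(1) \<alpha> by (intro mult_left_mono powr_le_powr_smaller) auto
    finally show "norm (- ((1/2) *\<^sub>R incr (bracket (dat_Y E)) s t)) \<le> (K * T powr (1 - 2 * \<alpha>)) * (t - s) powr (2 * \<alpha>)"
      by simp
  qed
  from holder_finite_diff[OF _ this, of "snd (dat_Y E)"] *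
  show "holder_finite T (2 * \<alpha>) (snd (circ (dat_Y E)))"
    by (simp add: circ_def)
qed

text \<open>For admissible data all suprema are taken over bounded sets, so every summand of
  \<open>data_dist\<close> is nonnegative and is at most the whole. Stated as increment bounds, this
  frees what follows from suprema.\<close>

lemma data_dist_controls:
  assumes D: "admissible T \<alpha> D" and E: "admissible T \<alpha> E" and T: "0 < T" and \<alpha>: "\<alpha> \<le> 1/2"
  defines "d \<equiv> data_dist T \<alpha> D E"
  shows "0 \<le> d" "norm (dat_v0 D - dat_v0 E) \<le> d"
    "norm (dat_F D 0 - dat_F E 0) \<le> d" "norm (dat_F' D 0 - dat_F' E 0) \<le> d"
    "\<And>s t. \<lbrakk>0 \<le> s; s < t; t \<le> T\<rbrakk> \<Longrightarrow>
      norm (incr (fst (dat_Y D)) s t - incr (fst (dat_Y E)) s t) \<le> d * (t - s) powr \<alpha>"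
    "\<And>s t. \<lbrakk>0 \<le> s; s < t; t \<le> T\<rbrakk> \<Longrightarrow>
      norm (snd (circ (dat_Y D)) s t - snd (circ (dat_Y E)) s t) \<le> d * (t - s) powr (2 * \<alpha>)"
    "\<And>s t. \<lbrakk>0 \<le> s; s < t; t \<le> T\<rbrakk> \<Longrightarrow>
      norm (incr (bracket (dat_Y D)) s t - incr (bracket (dat_Y E)) s t) \<le> d * (t - s) powr 1"
    "\<And>s t. \<lbrakk>0 \<le> s; s < t; t \<le> T\<rbrakk> \<Longrightarrow>
      norm (incr (dat_F' D) s t - incr (dat_F' E) s t) \<le> d * (t - s) powr \<alpha>"
    "\<And>s t. \<lbrakk>0 \<le> s; s < t; t \<le> T\<rbrakk> \<Longrightarrow>
      norm (ctrl_remainder (fst (dat_Y D)) (dat_F D) (dat_F' D) s t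
        - ctrl_remainder (fst (dat_Y E)) (dat_F E) (dat_F' E) s t) \<le> d * (t - s) powr (2 * \<alpha>)"
    "\<And>t. \<lbrakk>0 \<le> t; t \<le> T\<rbrakk> \<Longrightarrow> norm (dat_C D t - dat_C E t) \<le> d"
    "\<And>t. \<lbrakk>0 \<le> t; t \<le> T\<rbrakk> \<Longrightarrow> norm (dat_H D t - dat_H E t) \<le> d"
    "\<And>t. \<lbrakk>0 \<le> t; t \<le> T\<rbrakk> \<Longrightarrow> norm (dat_Q D t - dat_Q E t) \<le> d"
    "\<And>t. \<lbrakk>0 \<le> t; t \<le> T\<rbrakk> \<Longrightarrow> norm (dat_R D t - dat_R E t) \<le> d"
proof -
  note hD = admissible_holder[OF D T \<alpha>] and hE = admissible_holder[OF E T \<alpha>]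
  define f1 where "f1 = (\<lambda>s t. incr (fst (dat_Y D)) s t - incr (fst (dat_Y E)) s t)"
  define f2 where "f2 = (\<lambda>s t. snd (circ (dat_Y D)) s t - snd (circ (dat_Y E)) s t)"
  define f3 where "f3 = (\<lambda>s t. incr (bracket (dat_Y D)) s t - incr (bracket (dat_Y E)) s t)"
  define f4 where "f4 = (\<lambda>s t. incr (dat_F' D) s t - incr (dat_F' E) s t)"
  define f5 where "f5 = (\<lambda>s t. ctrl_remainder (fst (dat_Y D)) (dat_F D) (dat_F' D) s t
        - ctrl_remainder (fst (dat_Y E)) (dat_F E) (dat_F' E) s t)"
  have fin: "holder_finite T \<alpha> f1" "holder_finite T (2 * \<alpha>) f2" "holder_finite T 1 f3"
    "holder_finite T \<alpha> f4" "holder_finite T (2 * \<alpha>) f5"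
    unfolding f1_def f2_def f3_def f4_def f5_def
    by (intro holder_finite_diff hD hE)+
  note nn = fin[THEN holder_seminorm_nonneg[OF _ T]]
  note bd = fin[THEN holder_seminorm_bound]
  let ?C = "\<lambda>t. dat_C D t - dat_C E t" and ?H = "\<lambda>t. dat_H D t - dat_H E t"
    and ?Q = "\<lambda>t. dat_Q D t - dat_Q E t" and ?R = "\<lambda>t. dat_R D t - dat_R E t"
  have bm: "bmeas T ?C" "bmeas T ?H" "bmeas T ?Q" "bmeas T ?R"
    by (intro bmeas_diff hD hE)+
  have sb: "norm (f t) \<le> sup_norm T f" if "bmeas T f" "0 \<le> t" "t \<le> T" for f :: "real \<Rightarrow> 'z::euclidean_space" and t
    using that by (intro sup_norm_bound) (auto simp: bmeas_def)
  have s0: "0 \<le> sup_norm T ?C" "0 \<le> sup_norm T ?H" "0 \<le> sup_norm T ?Q" "0 \<le> sup_norm T ?R"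
    using bm T by (auto intro!: order_trans[OF norm_ge_zero sup_norm_bound[of _ T 0]] simp: bmeas_def)
  have d: "d = norm (dat_v0 D - dat_v0 E)
    + (holder_seminorm T \<alpha> f1 + holder_seminorm T (2 * \<alpha>) f2 + holder_seminorm T 1 f3)
    + (norm (dat_F D 0 - dat_F E 0) + norm (dat_F' D 0 - dat_F' E 0)
      + holder_seminorm T \<alpha> f4 + holder_seminorm T (2 * \<alpha>) f5)
    + sup_norm T ?C + sup_norm T ?H + sup_norm T ?Q + sup_norm T ?R"
  proof -
    have "incr (\<lambda>t. bracket (dat_Y D) t - bracket (dat_Y E) t) = f3"
      by (simp add: f3_def incr_def fun_eq_iff)
    then show ?thesis
      by (simp add: d_def data_dist_def rho1_def rho_def ctrl_dist_def lip_seminorm_def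
          f1_def f2_def f4_def f5_def circ_def[of "dat_Y D"] circ_def[of "dat_Y E"])
  qed
  note n0 = norm_ge_zero[of "dat_v0 D - dat_v0 E"] norm_ge_zero[of "dat_F D 0 - dat_F E 0"]
    norm_ge_zero[of "dat_F' D 0 - dat_F' E 0"]
  show "0 \<le> d" "norm (dat_v0 D - dat_v0 E) \<le> d"
    "norm (dat_F D 0 - dat_F E 0) \<le> d" "norm (dat_F' D 0 - dat_F' E 0) \<le> d"
    unfolding d using nn s0 n0 by linarith+
  have le: "holder_seminorm T \<alpha> f1 \<le> d" "holder_seminorm T (2 * \<alpha>) f2 \<le> d" "holder_seminorm T 1 f3 \<le> d"
    "holder_seminorm T \<alpha> f4 \<le> d" "holder_seminorm T (2 * \<alpha>) f5 \<le> d"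
    "sup_norm T ?C \<le> d" "sup_norm T ?H \<le> d" "sup_norm T ?Q \<le> d" "sup_norm T ?R \<le> d"
    unfolding d using nn s0 n0 by linarith+
  note up = order_trans[OF _ mult_right_mono[OF _ powr_ge_zero]]
  fix s t :: real
  {
    assume st: "0 \<le> s" "s < t" "t \<le> T"
    show "norm (incr (fst (dat_Y D)) s t - incr (fst (dat_Y E)) s t) \<le> d * (t - s) powr \<alpha>"
      using up[OF bd(1)[OF st] le(1)] by (simp add: f1_def)
    show "norm (snd (circ (dat_Y D)) s t - snd (circ (dat_Y E)) s t) \<le> d * (t - s) powr (2 * \<alpha>)"
      using up[OF bd(2)[OF st] le(2)] by (simp add: f2_def)
    show "norm (incr (bracket (dat_Y D)) s t - incr (bracket (dat_Y E)) s t) \<le> d * (t - s) powr 1"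
      using up[OF bd(3)[OF st] le(3)] by (simp add: f3_def)
    show "norm (incr (dat_F' D) s t - incr (dat_F' E) s t) \<le> d * (t - s) powr \<alpha>"
      using up[OF bd(4)[OF st] le(4)] by (simp add: f4_def)
    show "norm (ctrl_remainder (fst (dat_Y D)) (dat_F D) (dat_F' D) s t
        - ctrl_remainder (fst (dat_Y E)) (dat_F E) (dat_F' E) s t) \<le> d * (t - s) powr (2 * \<alpha>)"
      using up[OF bd(5)[OF st] le(5)] by (simp add: f5_def)
  }
  assume t: "0 \<le> t" "t \<le> T"
  show "norm (?C t) \<le> d" "norm (?H t) \<le> d" "norm (?Q t) \<le> d" "norm (?R t) \<le> d"
    using order_trans[OF sb[OF bm(1) t] le(6)] order_trans[OF sb[OF bm(2) t] le(7)]
      order_trans[OF sb[OF bm(3) t] le(8)] order_trans[OF sb[OF bm(4) t] le(9)] by auto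
qed

lemma data_dist_refl:
  assumes "0 < T"
  shows "data_dist T \<alpha> D D = 0"
  using assms
  by (simp add: data_dist_def rho1_def rho_def ctrl_dist_def lip_seminorm_def holder_seminorm_zero
      sup_norm_def incr_def[abs_def])

text \<open>Local Lipschitz continuity asks for constants depending only on the centre
  \<open>D\<close> and the radius \<open>r\<close>. All families below are indexed by the ball, and
  their bounds come from those at \<open>D\<close> and the distance to \<open>D\<close>.\<close>

locale riccati_family =
  fixes T \<alpha> r :: real and D :: "('x::finite, 'y::finite) riccati_data"
  assumes pos_T: "0 < T" and alpha: "1/3 < \<alpha>" "\<alpha> \<le> 1/2" and r_nonneg: "0 \<le> r"
    and D: "admissible T \<alpha> D"
begin

definition data_ball :: "('x, 'y) riccati_data set" where
  "data_ball = {E. admissible T \<alpha> E \<and> data_dist T \<alpha> D E \<le> r}"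

lemma D_in_ball: "D \<in> data_ball"
  using D r_nonneg pos_T by (simp add: data_ball_def data_dist_refl)

lemma ball_admissible: "E \<in> data_ball \<Longrightarrow> admissible T \<alpha> E"
  by (simp add: data_ball_def)

end

sublocale riccati_family \<subseteq> data_family data_ball "data_dist T \<alpha>" T
proof unfold_locales
  show "0 \<le> data_dist T \<alpha> i j" if "i \<in> data_ball" "j \<in> data_ball" for i j
    using data_dist_controls(1)[OF ball_admissible ball_admissible pos_T alpha(2)] that .
qed (rule pos_T)

section \<open>Uniform bounds for the data on the ball\<close>

context riccati_family
begin

lemma lbd_from_center:
  assumes "0 \<le> K"
    and "\<And>s u t. \<lbrakk>0 \<le> s; s \<le> u; u \<le> t; t \<le> T\<rbrakk> \<Longrightarrow> norm (f D s u t) \<le> K * pw (t - s) \<gamma>"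
    and lip: "\<And>i j s u t. \<lbrakk>i \<in> data_ball; j \<in> data_ball; 0 \<le> s; s \<le> u; u \<le> t; t \<le> T\<rbrakk> \<Longrightarrow>
      norm (f i s u t - f j s u t) \<le> data_dist T \<alpha> i j * pw (t - s) \<gamma>"
  shows "lbd \<gamma> f"
\<comment> \<open>\<open>K + r\<close> bounds the members, which are within distance
  \<open>r\<close> of the centre; the summand 1 makes the constant at least 1, as the Lipschitz
  bound requires.\<close>
proof (rule lbdI[of "K + r + 1"])
  fix i s u t assume *: "i \<in> data_ball" "0 \<le> s" "s \<le> u" "u \<le> t" "t \<le> T"
  have "norm (f i s u t) \<le> norm (f D s u t) + norm (f D s u t - f i s u t)"
    using norm_triangle_ineq4[of "f D s u t" "f D s u t - f i s u t"] by simp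
  also have "\<dots> \<le> K * pw (t - s) \<gamma> + data_dist T \<alpha> D i * pw (t - s) \<gamma>"
    using * D_in_ball assms by (intro add_mono) auto
  also have "\<dots> \<le> K * pw (t - s) \<gamma> + r * pw (t - s) \<gamma>"
    using * by (intro add_mono mult_right_mono) (auto simp: data_ball_def)
  also have "\<dots> \<le> (K + r + 1) * pw (t - s) \<gamma>" by (simp add: algebra_simps)
  finally show "norm (f i s u t) \<le> (K + r + 1) * pw (t - s) \<gamma>" .
next
  fix i j s u t assume *: "i \<in> data_ball" "j \<in> data_ball" "0 \<le> s" "s \<le> u" "u \<le> t" "t \<le> T"
  have "norm (f i s u t - f j s u t) \<le> data_dist T \<alpha> i j * pw (t - s) \<gamma>" using * by (rule lip)
  also have "\<dots> \<le> (K + r + 1) * data_dist T \<alpha> i j * pw (t - s) \<gamma>"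
    using d_nonneg[OF *(1,2)] assms(1) r_nonneg by (intro mult_right_mono) (auto simp: algebra_simps)
  finally show "norm (f i s u t - f j s u t) \<le> (K + r + 1) * data_dist T \<alpha> i j * pw (t - s) \<gamma>" .
qed (use assms(1) r_nonneg in simp)

text \<open>A Hoelder seminorm says nothing on the diagonal, where \<open>pw 0 \<gamma> = 0\<close>
  for \<gamma> > 0 demands the value 0; \<open>diag\<close> supplies it.\<close>

lemma lbd_holder:
  assumes \<gamma>: "0 < \<gamma>" and fin: "holder_finite T \<gamma> (f D)"
    and diag: "\<And>i s. \<lbrakk>i \<in> data_ball; 0 \<le> s; s \<le> T\<rbrakk> \<Longrightarrow> f i s s = 0"
    and lip: "\<And>i j s t. \<lbrakk>i \<in> data_ball; j \<in> data_ball; 0 \<le> s; s < t; t \<le> T\<rbrakk> \<Longrightarrow>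
      norm (f i s t - f j s t) \<le> data_dist T \<alpha> i j * (t - s) powr \<gamma>"
  shows "lbd \<gamma> (\<lambda>i s u t. f i s t)"
proof -
  have pw: "pw x \<gamma> = x powr \<gamma>" for x using \<gamma> by (simp add: pw_def)
  show ?thesis
  proof (rule lbd_from_center[of "holder_seminorm T \<gamma> (f D)"])
    show "0 \<le> holder_seminorm T \<gamma> (f D)" by (rule holder_seminorm_nonneg[OF fin pos_T])
    fix s u t :: real assume *: "0 \<le> s" "s \<le> u" "u \<le> t" "t \<le> T"
    show "norm (f D s t) \<le> holder_seminorm T \<gamma> (f D) * pw (t - s) \<gamma>"
      using holder_seminorm_bound[OF fin, of s t] diag[OF D_in_ball, of s] * unfolding pw
      by (cases "s = t") auto
  next
    fix i j s u t assume *: "i \<in> data_ball" "j \<in> data_ball" "0 \<le> s" "s \<le> u" "u \<le> t" "t \<le> T"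
    show "norm (f i s t - f j s t) \<le> data_dist T \<alpha> i j * pw (t - s) \<gamma>"
      using lip[of i j s t] diag[of i s] diag[of j s] * unfolding pw
      by (cases "s = t") auto
  qed
qed

lemma lbd_point:
  assumes "0 \<le> K" "\<And>t. \<lbrakk>0 \<le> t; t \<le> T\<rbrakk> \<Longrightarrow> norm (f D t) \<le> K"
    and "\<And>i j t. \<lbrakk>i \<in> data_ball; j \<in> data_ball; 0 \<le> t; t \<le> T\<rbrakk> \<Longrightarrow> norm (f i t - f j t) \<le> data_dist T \<alpha> i j"
  shows "lbd 0 (\<lambda>i s u t. f i t)"
  by (rule lbd_from_center[OF assms(1)]) (use assms in auto)

lemma lbd_coefficient:
  assumes "bmeas T (f D)"
    and "\<And>i j t. \<lbrakk>i \<in> data_ball; j \<in> data_ball; 0 \<le> t; t \<le> T\<rbrakk> \<Longrightarrow> norm (f i t - f j t) \<le> data_dist T \<alpha> i j"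
  shows "lbd 0 (\<lambda>i s u t. f i t)"
proof (rule bmeas_bound[OF assms(1)])
  fix K assume "0 < K" "\<And>t. \<lbrakk>0 \<le> t; t \<le> T\<rbrakk> \<Longrightarrow> norm (f D t) \<le> K"
  then show ?thesis by (intro lbd_point[of K] assms(2)) auto
qed

lemma alpha_pos: "0 < \<alpha>" "0 < 2 * \<alpha>" "0 \<le> \<alpha>" "0 \<le> 2 * \<alpha>" "0 \<le> 3 * \<alpha>" "1 < 3 * \<alpha>"
  using alpha by auto

lemmas ball_controls = data_dist_controls[OF ball_admissible ball_admissible pos_T alpha(2)]
lemmas center_holder = admissible_holder[OF D pos_T alpha(2)]

lemma lbd_C: "lbd 0 (\<lambda>i s u t. dat_C i t)" and lbd_H: "lbd 0 (\<lambda>i s u t. dat_H i t)"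
  and lbd_Q: "lbd 0 (\<lambda>i s u t. dat_Q i t)" and lbd_R: "lbd 0 (\<lambda>i s u t. dat_R i t)"
  by (rule lbd_coefficient, rule center_holder, rule ball_controls; assumption)+

lemma lbd_v0: "lbd 0 (\<lambda>i s u t. dat_v0 i)"
  by (rule lbd_point[of "norm (dat_v0 D)"]) (use ball_controls(2) in auto)

lemma lbd_incr_Y: "lbd \<alpha> (\<lambda>i s u t. incr (fst (dat_Y i)) s t)"
  by (rule lbd_holder[OF alpha_pos(1) center_holder(1) _ ball_controls(5)]) (auto simp: incr_def)

lemma lbd_incr_bracket: "lbd 1 (\<lambda>i s u t. incr (bracket (dat_Y i)) s t)"
  by (rule lbd_holder[OF zero_less_one center_holder(3) _ ball_controls(7)]) (auto simp: incr_def)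

text \<open>The metric compares second levels through \<open>circ\<close>. The second level itself
  is recovered by subtracting half the bracket, which is compared in the stronger Lipschitz
  seminorm.\<close>

lemma lbd_Y2: "lbd (2 * \<alpha>) (\<lambda>i s u t. snd (dat_Y i) s t)"
proof -
  have "lbd (2 * \<alpha>) (\<lambda>i s u t. snd (circ (dat_Y i)) s t)"
  proof (rule lbd_holder[OF alpha_pos(2) center_holder(2) _ ball_controls(6)])
    fix i s assume "i \<in> data_ball" "0 \<le> s" "s \<le> T"
    then have "snd (dat_Y i) s s = 0"
      using admissible_holder(6)[OF ball_admissible pos_T alpha(2)] by (intro chen_refl)
    then show "snd (circ (dat_Y i)) s s = 0" by (simp add: circ_def incr_def)
  qed
  moreover have "lbd (2 * \<alpha>) (\<lambda>i s u t. (1/2) *\<^sub>R incr (bracket (dat_Y i)) s t)"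
    using alpha by (intro lbd_bounded_linear[OF bounded_linear_scaleR_right] lbd_mono[OF lbd_incr_bracket]) auto
  ultimately have "lbd (2 * \<alpha>) (\<lambda>i s u t. snd (circ (dat_Y i)) s t - (1/2) *\<^sub>R incr (bracket (dat_Y i)) s t)"
    by (rule lbd_diff)
  then show ?thesis by (simp add: circ_def)
qed

lemma lbd_incr_F': "lbd \<alpha> (\<lambda>i s u t. dat_F' i t - dat_F' i s)"
  using lbd_holder[OF alpha_pos(1) center_holder(4) _ ball_controls(8)] by (simp add: incr_def)

lemma lbd_F': "lbd 0 (\<lambda>i s u t. dat_F' i t)"
proof (rule lbd_from_initial[OF _ lbd_incr_F' alpha_pos(3)])
  show "lbd 0 (\<lambda>i s u t. dat_F' i 0)"
    by (rule lbd_point[of "norm (dat_F' D 0)"]) (use ball_controls(4) in auto)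
qed

lemma lbd_ctrl_remainder:
  "lbd (2 * \<alpha>) (\<lambda>i s u t. ctrl_remainder (fst (dat_Y i)) (dat_F i) (dat_F' i) s t)"
  by (rule lbd_holder[OF alpha_pos(2) center_holder(5) _ ball_controls(9)])
    (auto simp: ctrl_remainder_def incr_def vec_eq_iff)

end

section \<open>The linear rough flow\<close>

definition driver1 :: "('x::finite, 'y::finite) riccati_data \<Rightarrow> real \<Rightarrow> real^'y \<Rightarrow> real^'x^'x" where
  "driver1 E s y = (\<Sum>\<kappa>\<in>UNIV. (y $ \<kappa>) *\<^sub>R (dat_F E s $ \<kappa>))"

text \<open>For the linear vector fields \<open>F\<^sub>\<kappa> \<Phi>\<close>, the derivative of
  field \<mu> along field \<kappa> is \<open>F\<^sub>\<mu> F\<^sub>\<kappa> \<Phi>\<close>, and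
  \<open>F'\<close> accounts for the dependence of the coefficients on the driving path. The later
  increment, with index \<mu>, acts on the left.\<close>

definition second_coeff :: "('x::finite, 'y::finite) riccati_data \<Rightarrow> 'y \<Rightarrow> 'y \<Rightarrow> real \<Rightarrow> real^'x^'x" where
  "second_coeff E \<kappa> \<mu> s = dat_F E s $ \<mu> ** dat_F E s $ \<kappa> + dat_F' E s $ \<mu> $ \<kappa>"

definition driver2 :: "('x::finite, 'y::finite) riccati_data \<Rightarrow> real \<Rightarrow> real^'y^'y \<Rightarrow> real^'x^'x" where
  "driver2 E s Z = (\<Sum>\<kappa>\<in>UNIV. \<Sum>\<mu>\<in>UNIV. (Z $ \<kappa> $ \<mu>) *\<^sub>R second_coeff E \<kappa> \<mu> s)"

text \<open>The terms of order at least \<open>2 * \<alpha>\<close>; those of order \<alpha> form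
  \<open>step_rough\<close>. With this split a product of steps is negligible as soon as one of its
  factors is of the first kind.\<close>

definition step_smooth :: "('x::finite, 'y::finite) riccati_data \<Rightarrow> real \<Rightarrow> real \<Rightarrow> real^'x^'x" where
  "step_smooth E s t = integral {s..t} (dat_C E) + driver2 E s (snd (dat_Y E) s t)"

definition step_rough :: "('x::finite, 'y::finite) riccati_data \<Rightarrow> real \<Rightarrow> real \<Rightarrow> real^'x^'x" where
  "step_rough E s t = driver1 E s (incr (fst (dat_Y E)) s t)"

text \<open>\<open>1 + step\<close> is the one-step map of Davie's scheme for the linear equation
  \<open>d\<Phi> = C \<Phi> dt + F\<^sub>\<kappa> \<Phi> d\<^bold>Y\<^sup>\<kappa>\<close>. The bracket term of the Riccati equation is not part of it: it is
  produced by the product \<open>\<Phi> w \<Phi>\<^sup>T\<close>.\<close>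

definition step :: "('x::finite, 'y::finite) riccati_data \<Rightarrow> real \<Rightarrow> real \<Rightarrow> real^'x^'x" where
  "step E s t = step_smooth E s t + step_rough E s t"

lemma driver1_add: "driver1 E s (y + z) = driver1 E s y + driver1 E s z"
  by (simp add: driver1_def scaleR_left_distrib sum.distrib)

lemma driver2_add: "driver2 E s (y + z) = driver2 E s y + driver2 E s z"
  by (simp add: driver2_def scaleR_left_distrib sum.distrib)

text \<open>Let \<open>x\<close>, \<open>y\<close> be the increments over \<open>[s, u]\<close> and
  \<open>[u, t]\<close>. By Chen's relation the second level over \<open>[s, t]\<close> contains
  \<open>tensor x y\<close>. The part of it with a product of two \<open>F\<close> cancels the
  product of the two rough steps up to a change of base point, and the part with \<open>F'\<close>
  cancels the change of \<open>F\<close> from \<open>s\<close> to \<open>u\<close> up to the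
  controlled remainder. Only terms of order at least \<open>3 * \<alpha>\<close> are left.\<close>

lemma step_multiplicative_defect:
  assumes chen: "chen T (dat_Y E)" and C: "bmeas T (dat_C E)"
    and st: "0 \<le> s" "s \<le> u" "u \<le> t" "t \<le> T"
  defines "y \<equiv> incr (fst (dat_Y E)) u t"
  shows "step E s t - step E s u - step E u t - step E u t ** step E s u =
    - (step_smooth E u t ** step E s u + step_rough E u t ** step_smooth E s u
      + (\<Sum>\<kappa>\<in>UNIV. (y $ \<kappa>) *\<^sub>R (dat_F E u $ \<kappa> - dat_F E s $ \<kappa>)) ** step_rough E s u
      + (\<Sum>\<kappa>\<in>UNIV. (y $ \<kappa>) *\<^sub>R (ctrl_remainder (fst (dat_Y E)) (dat_F E) (dat_F' E) s u $ \<kappa>))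
      + (\<Sum>\<kappa>\<in>UNIV. \<Sum>\<mu>\<in>UNIV. (snd (dat_Y E) u t $ \<kappa> $ \<mu>) *\<^sub>R
          (second_coeff E \<kappa> \<mu> u - second_coeff E \<kappa> \<mu> s)))"
    (is "_ = - (_ + _ + ?X1 ** _ + ?X2 + ?X3)")
proof -
  define x where "x = incr (fst (dat_Y E)) s u"
  have inc: "incr (fst (dat_Y E)) s t = x + y"
    by (simp add: x_def y_def incr_def)
  have snd: "snd (dat_Y E) s t = snd (dat_Y E) s u + snd (dat_Y E) u t + tensor x y"
    using chen st unfolding chen_def x_def y_def by blast
  have c: "integral {s..t} (dat_C E) = integral {s..u} (dat_C E) + integral {u..t} (dat_C E)"
    using integral_additive[OF C st] .
  have A: "driver1 E s y = driver1 E u y - ?X1"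
    by (simp add: driver1_def scaleR_diff_right sum_subtractf)
  have B: "driver2 E s (snd (dat_Y E) u t) = driver2 E u (snd (dat_Y E) u t) - ?X3"
    by (simp add: driver2_def scaleR_diff_right sum_subtractf)
  define Z where "Z = (\<Sum>\<kappa>\<in>UNIV. \<Sum>\<mu>\<in>UNIV. (x $ \<kappa> * y $ \<mu>) *\<^sub>R (dat_F' E s $ \<mu> $ \<kappa>))"
  have "driver2 E s (tensor x y) = (\<Sum>\<kappa>\<in>UNIV. \<Sum>\<mu>\<in>UNIV. (x $ \<kappa> * y $ \<mu>) *\<^sub>R (dat_F E s $ \<mu> ** dat_F E s $ \<kappa>)) + Z"
    by (simp add: driver2_def second_coeff_def tensor_def Z_def scaleR_add_right sum.distrib)
  also have "(\<Sum>\<kappa>\<in>UNIV. \<Sum>\<mu>\<in>UNIV. (x $ \<kappa> * y $ \<mu>) *\<^sub>R (dat_F E s $ \<mu> ** dat_F E s $ \<kappa>)) =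
      driver1 E s y ** driver1 E s x"
    unfolding driver1_def mm.sum_left mm.sum_right mm.scaleR_left mm.scaleR_right
    by (simp add: scaleR_sum_right)
  finally have T: "driver2 E s (tensor x y) = driver1 E s y ** driver1 E s x + Z" .
  \<comment> \<open>The controlled expansion of \<open>F\<close> over \<open>[s, u]\<close>, paired
    with \<open>y\<close>; interchanging the sums identifies its first-order term with
    \<open>Z\<close>.\<close>
  have "?X1 = ?X2 + (\<Sum>\<mu>\<in>UNIV. y $ \<mu> *\<^sub>R (\<Sum>\<kappa>\<in>UNIV. x $ \<kappa> *\<^sub>R (dat_F' E s $ \<mu> $ \<kappa>)))"
    unfolding sum.distrib[symmetric] scaleR_add_right[symmetric]
    by (simp add: ctrl_remainder_def x_def)
  also have "(\<Sum>\<mu>\<in>UNIV. y $ \<mu> *\<^sub>R (\<Sum>\<kappa>\<in>UNIV. x $ \<kappa> *\<^sub>R (dat_F' E s $ \<mu> $ \<kappa>))) = Z"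
    unfolding Z_def scaleR_sum_right scaleR_scaleR by (subst sum.swap) (simp add: mult.commute)
  finally have X1: "Z = ?X1 - ?X2" by simp
  have "step E s t = step E s u + step E u t - ?X3 - ?X2 + (step_rough E u t - ?X1) ** step_rough E s u"
    unfolding step_def step_smooth_def step_rough_def inc snd c driver1_add driver2_add A B T X1
    by (simp add: x_def[symmetric] y_def[symmetric])
  moreover have "step E u t ** step E s u = step_smooth E u t ** step E s u
      + step_rough E u t ** step_smooth E s u + step_rough E u t ** step_rough E s u"
    by (simp add: step_def mm.add_left mm.add_right)
  ultimately show ?thesis
    by (simp add: mm.diff_left algebra_simps)
qed

lemma (in data_family) lbd_small_o:
  assumes "lbd \<gamma> (\<lambda>i s u t. f i s t)" "1 < \<gamma>" "i \<in> A"
  shows "small_o T (f i)"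
proof -
  obtain K where K: "\<And>s t. \<lbrakk>0 \<le> s; s \<le> t; t \<le> T\<rbrakk> \<Longrightarrow> norm (f i s t) \<le> K * pw (t - s) \<gamma>"
    using lbdE[OF assms(1)] assms(3) by (metis order.refl)
  show ?thesis
    using assms(2) by (intro small_o_powr[OF assms(2), of _ _ K]) (use K in \<open>auto simp: pw_def\<close>)
qed

lemma (in data_family) lbd_point_bound:
  assumes "lbd 0 (\<lambda>i s u t. f i t)"
  obtains K where "0 < K" "\<And>i t. \<lbrakk>i \<in> A; 0 \<le> t; t \<le> T\<rbrakk> \<Longrightarrow> norm (f i t) \<le> K"
    "\<And>i j t. \<lbrakk>i \<in> A; j \<in> A; 0 \<le> t; t \<le> T\<rbrakk> \<Longrightarrow> norm (f i t - f j t) \<le> K * d i j"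
proof (rule lbd_pointE[OF assms])
  fix K assume K: "0 \<le> K" "\<And>i t. \<lbrakk>i \<in> A; 0 \<le> t; t \<le> T\<rbrakk> \<Longrightarrow> norm (f i t) \<le> K"
    "\<And>i j t. \<lbrakk>i \<in> A; j \<in> A; 0 \<le> t; t \<le> T\<rbrakk> \<Longrightarrow> norm (f i t - f j t) \<le> K * d i j"
  show ?thesis
  proof (rule that[of "K + 1"])
    show "norm (f i t) \<le> K + 1" if "i \<in> A" "0 \<le> t" "t \<le> T" for i t
      using K(2)[OF that] by simp
    show "norm (f i t - f j t) \<le> (K + 1) * d i j" if "i \<in> A" "j \<in> A" "0 \<le> t" "t \<le> T" for i j t
      using K(3)[OF that] d_nonneg[OF that(1,2)] by (simp add: distrib_right)
  qed (use K in simp)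
qed

lemma (in data_family) lbd_continuous:
  assumes "lbd \<gamma> (\<lambda>i s u t. f i t - f i s)" "0 < \<gamma>" "i \<in> A"
  shows "continuous_on {0..T} (f i)"
proof -
  obtain K where K: "0 \<le> K" "\<And>i s u t. \<lbrakk>i \<in> A; 0 \<le> s; s \<le> u; u \<le> t; t \<le> T\<rbrakk> \<Longrightarrow>
      norm (f i t - f i s) \<le> K * pw (t - s) \<gamma>"
    by (rule lbdE[OF assms(1)]) (rule that)
  have bound: "norm (f i y - f i x) \<le> K * \<bar>y - x\<bar> powr \<gamma>" if "x \<in> {0..T}" "y \<in> {0..T}" for x y
  proof (cases "x \<le> y")
    case True
    then show ?thesis using K(2)[of i x x y] assms that by (simp add: pw_def)
  next
    case False
    then show ?thesis using K(2)[of i y y x] assms that by (simp add: pw_def norm_minus_commute)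
  qed
  show ?thesis
    unfolding continuous_on
  proof (rule ballI, rule Lim_null[THEN iffD2])
    fix x assume x: "x \<in> {0..T}"
    have "((\<lambda>y. \<bar>y - x\<bar>) \<longlongrightarrow> \<bar>x - x\<bar>) (at x within {0..T})"
      by (intro tendsto_rabs tendsto_diff tendsto_ident_at tendsto_const)
    then have "((\<lambda>y. \<bar>y - x\<bar>) \<longlongrightarrow> 0) (at x within {0..T})"
      by (simp only: diff_self abs_zero)
    then have "((\<lambda>y. \<bar>y - x\<bar> powr \<gamma>) \<longlongrightarrow> 0) (at x within {0..T})"
      using assms(2) by (intro tendsto_zero_powrI[OF _ tendsto_const]) auto
    then have "((\<lambda>y. K * \<bar>y - x\<bar> powr \<gamma>) \<longlongrightarrow> 0) (at x within {0..T})"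
      by (rule tendsto_mult_right_zero)
    then show "((\<lambda>y. f i y - f i x) \<longlongrightarrow> 0) (at x within {0..T})"
    proof (rule Lim_null_comparison[rotated])
      show "\<forall>\<^sub>F y in at x within {0..T}. norm (f i y - f i x) \<le> K * \<bar>y - x\<bar> powr \<gamma>"
        unfolding eventually_at_filter using bound[OF x] by (intro always_eventually) blast
    qed
  qed
qed

section \<open>Orders of the one-step map and of its defect\<close>

context riccati_family
begin

lemma lbd_scaleR:
  assumes "lbd a f" "lbd b g" "0 \<le> a" "0 \<le> b" "0 \<le> c" "c \<le> a + b"
  shows "lbd c (\<lambda>i s u t. f i s u t *\<^sub>R g i s u t)"
  using assms by (rule lbd_bilinear_ge[OF bounded_bilinear_scaleR])

lemma lbd_mm:
  assumes "lbd a f" "lbd b g" "0 \<le> a" "0 \<le> b" "0 \<le> c" "c \<le> a + b"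
  shows "lbd c (\<lambda>i s u t. f i s u t ** (g i s u t :: real^'p^'q))"
  using assms by (rule lbd_bilinear_ge[OF bounded_bilinear_matrix_mult])

lemma lbd_nth: "lbd \<gamma> f \<Longrightarrow> lbd \<gamma> (\<lambda>i s u t. f i s u t $ \<kappa>)"
  by (rule lbd_bounded_linear[OF bounded_linear_vec_nth])

text \<open>The distance contains the remainder and \<open>F'\<close> but no Hoelder seminorm of
  \<open>F\<close>; increments of \<open>F\<close> are rebuilt from the controlled expansion and
  inherit its Lipschitz bound.\<close>

lemma lbd_incr_F: "lbd \<alpha> (\<lambda>i s u t. dat_F i t $ \<kappa> - dat_F i s $ \<kappa>)"
proof -
  have "lbd \<alpha> (\<lambda>i s u t. ctrl_remainder (fst (dat_Y i)) (dat_F i) (dat_F' i) s t $ \<kappa>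
    + (\<Sum>\<mu>\<in>UNIV. (incr (fst (dat_Y i)) s t $ \<mu>) *\<^sub>R (dat_F' i s $ \<kappa> $ \<mu>)))"
    using alpha_pos
    by (intro lbd_add lbd_sum lbd_nth lbd_mono[OF lbd_ctrl_remainder]
        lbd_scaleR[OF lbd_nth[OF lbd_incr_Y] lbd_nth[OF lbd_nth[OF lbd_point_left[OF lbd_F']]]]) auto
  then show ?thesis by (simp add: ctrl_remainder_def)
qed

lemma lbd_F: "lbd 0 (\<lambda>i s u t. dat_F i t $ \<kappa>)"
proof (rule lbd_from_initial[OF _ lbd_incr_F alpha_pos(3)])
  have "lbd 0 (\<lambda>i s u t. dat_F i 0)"
    by (rule lbd_point[of "norm (dat_F D 0)"]) (use ball_controls(3) in auto)
  then show "lbd 0 (\<lambda>i s u t. dat_F i 0 $ \<kappa>)" by (rule lbd_nth)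
qed

lemma lbd_second_coeff: "lbd 0 (\<lambda>i s u t. second_coeff i \<kappa> \<mu> t)"
  unfolding second_coeff_def
  by (intro lbd_add lbd_mm[OF lbd_F lbd_F] lbd_nth lbd_F') auto

lemma lbd_incr_second_coeff: "lbd \<alpha> (\<lambda>i s u t. second_coeff i \<kappa> \<mu> t - second_coeff i \<kappa> \<mu> s)"
proof -
  have "lbd \<alpha> (\<lambda>i s u t. (dat_F i t $ \<mu> - dat_F i s $ \<mu>) ** (dat_F i t $ \<kappa>)
      + (dat_F i s $ \<mu>) ** (dat_F i t $ \<kappa> - dat_F i s $ \<kappa>)
      + (dat_F' i t - dat_F' i s) $ \<mu> $ \<kappa>)"
    using alpha_pos
    by (intro lbd_add lbd_mm[OF lbd_incr_F lbd_F] lbd_mm[OF lbd_point_left[OF lbd_F] lbd_incr_F]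
        lbd_nth lbd_incr_F') auto
  then show ?thesis
    by (rule lbd_cong) (simp add: second_coeff_def mm.diff_left mm.diff_right)
qed

lemma lbd_integral:
  fixes f :: "('x, 'y) riccati_data \<Rightarrow> real \<Rightarrow> 'a::euclidean_space"
  assumes f: "lbd 0 (\<lambda>i s u t. f i t)" and m: "\<And>i. i \<in> data_ball \<Longrightarrow> bmeas T (f i)"
  shows "lbd 1 (\<lambda>i s u t. integral {s..t} (f i))"
proof (rule lbd_pointE[OF f])
  fix K assume K: "0 \<le> K" "\<And>i t. \<lbrakk>i \<in> data_ball; 0 \<le> t; t \<le> T\<rbrakk> \<Longrightarrow> norm (f i t) \<le> K"
    "\<And>i j t. \<lbrakk>i \<in> data_ball; j \<in> data_ball; 0 \<le> t; t \<le> T\<rbrakk> \<Longrightarrow>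
      norm (f i t - f j t) \<le> K * data_dist T \<alpha> i j"
  show ?thesis
  proof (rule lbdI[OF K(1)])
    fix i s u t assume *: "i \<in> data_ball" "0 \<le> s" "s \<le> u" "u \<le> t" "t \<le> T"
    have "norm (integral {s..t} (f i)) \<le> K * (t - s)"
      using * K by (intro integral_norm_le bmeas_integrable[OF m]) auto
    then show "norm (integral {s..t} (f i)) \<le> K * pw (t - s) 1"
      using * by (simp add: pw_def)
  next
    fix i j s u t assume *: "i \<in> data_ball" "j \<in> data_ball" "0 \<le> s" "s \<le> u" "u \<le> t" "t \<le> T"
    have fi: "f i integrable_on {s..t}" "f j integrable_on {s..t}"
      using * bmeas_integrable[OF m[OF *(1)]] bmeas_integrable[OF m[OF *(2)]] by simp_all
    have "norm (integral {s..t} (\<lambda>r. f i r - f j r)) \<le> (K * data_dist T \<alpha> i j) * (t - s)"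
      using * K fi by (intro integral_norm_le integrable_diff) auto
    then show "norm (integral {s..t} (f i) - integral {s..t} (f j)) \<le> K * data_dist T \<alpha> i j * pw (t - s) 1"
      using * fi by (simp add: pw_def Henstock_Kurzweil_Integration.integral_diff)
  qed
qed

lemma lbd_step_rough: "lbd \<alpha> (\<lambda>i s u t. step_rough i s t)"
  unfolding step_rough_def driver1_def
  using alpha_pos by (intro lbd_sum lbd_scaleR[OF lbd_nth[OF lbd_incr_Y] lbd_point_left[OF lbd_F]]) auto

lemma lbd_step_smooth: "lbd (2 * \<alpha>) (\<lambda>i s u t. step_smooth i s t)"
proof -
  have "lbd 1 (\<lambda>i s u t. integral {s..t} (dat_C i))"
    using admissible_holder(7)[OF ball_admissible pos_T alpha(2)] by (intro lbd_integral lbd_C)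
  then have "lbd (2 * \<alpha>) (\<lambda>i s u t. integral {s..t} (dat_C i))"
    by (rule lbd_mono) (use alpha in auto)
  then show ?thesis
    unfolding step_smooth_def driver2_def
    using alpha_pos
    by (intro lbd_add lbd_sum lbd_scaleR[OF lbd_nth[OF lbd_nth[OF lbd_Y2]] lbd_point_left[OF lbd_second_coeff]]) auto
qed

lemma lbd_step: "lbd \<alpha> (\<lambda>i s u t. step i s t)"
  unfolding step_def
  using alpha_pos by (intro lbd_add lbd_step_rough lbd_mono[OF lbd_step_smooth]) auto

text \<open>Counting orders in the formula for the defect, term by term:
  \<open>2\<alpha> + \<alpha>\<close>, \<open>\<alpha> + 2\<alpha>\<close>,
  \<open>\<alpha> + \<alpha> + \<alpha>\<close>, \<open>\<alpha> + 2\<alpha>\<close>,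
  \<open>2\<alpha> + \<alpha>\<close>. The formula is built from sums and products of families
  already known to be Lipschitz in the data, so the Lipschitz bound comes along.\<close>

lemma lbd_step_defect:
  "lbd (3 * \<alpha>) (\<lambda>i s u t. step i s t - step i s u - step i u t - step i u t ** step i s u)"
proof -
  note smooth_l = lbd_left[OF lbd_step_smooth alpha_pos(4)] and smooth_r = lbd_right[OF lbd_step_smooth alpha_pos(4)]
  note rough_l = lbd_left[OF lbd_step_rough alpha_pos(3)] and rough_r = lbd_right[OF lbd_step_rough alpha_pos(3)]
  note incY_r = lbd_nth[OF lbd_right[OF lbd_incr_Y alpha_pos(3)]]
  have "lbd (3 * \<alpha>) (\<lambda>i s u t. - (step_smooth i u t ** step i s u + step_rough i u t ** step_smooth i s u
      + (\<Sum>\<kappa>\<in>UNIV. (incr (fst (dat_Y i)) u t $ \<kappa>) *\<^sub>R (dat_F i u $ \<kappa> - dat_F i s $ \<kappa>)) ** step_rough i s u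
      + (\<Sum>\<kappa>\<in>UNIV. (incr (fst (dat_Y i)) u t $ \<kappa>) *\<^sub>R (ctrl_remainder (fst (dat_Y i)) (dat_F i) (dat_F' i) s u $ \<kappa>))
      + (\<Sum>\<kappa>\<in>UNIV. \<Sum>\<mu>\<in>UNIV. (snd (dat_Y i) u t $ \<kappa> $ \<mu>) *\<^sub>R
          (second_coeff i \<kappa> \<mu> u - second_coeff i \<kappa> \<mu> s))))"
  proof (intro lbd_uminus lbd_add)
    show "lbd (3 * \<alpha>) (\<lambda>i s u t. step_smooth i u t ** step i s u)"
      using alpha_pos by (intro lbd_mm[OF smooth_r lbd_left[OF lbd_step alpha_pos(3)]]) auto
    show "lbd (3 * \<alpha>) (\<lambda>i s u t. step_rough i u t ** step_smooth i s u)"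
      using alpha_pos by (intro lbd_mm[OF rough_r smooth_l]) auto
    have "lbd (2 * \<alpha>) (\<lambda>i s u t. \<Sum>\<kappa>\<in>UNIV. (incr (fst (dat_Y i)) u t $ \<kappa>) *\<^sub>R (dat_F i u $ \<kappa> - dat_F i s $ \<kappa>))"
      using alpha_pos by (intro lbd_sum lbd_scaleR[OF incY_r lbd_left[OF lbd_incr_F alpha_pos(3)]]) auto
    then show "lbd (3 * \<alpha>) (\<lambda>i s u t. (\<Sum>\<kappa>\<in>UNIV. (incr (fst (dat_Y i)) u t $ \<kappa>) *\<^sub>R
        (dat_F i u $ \<kappa> - dat_F i s $ \<kappa>)) ** step_rough i s u)"
      using alpha_pos by (intro lbd_mm[OF _ rough_l]) auto
    show "lbd (3 * \<alpha>) (\<lambda>i s u t. \<Sum>\<kappa>\<in>UNIV. (incr (fst (dat_Y i)) u t $ \<kappa>) *\<^sub>R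
        (ctrl_remainder (fst (dat_Y i)) (dat_F i) (dat_F' i) s u $ \<kappa>))"
      using alpha_pos
      by (intro lbd_sum lbd_scaleR[OF incY_r lbd_nth[OF lbd_left[OF lbd_ctrl_remainder alpha_pos(4)]]]) auto
    show "lbd (3 * \<alpha>) (\<lambda>i s u t. \<Sum>\<kappa>\<in>UNIV. \<Sum>\<mu>\<in>UNIV. (snd (dat_Y i) u t $ \<kappa> $ \<mu>) *\<^sub>R
        (second_coeff i \<kappa> \<mu> u - second_coeff i \<kappa> \<mu> s))"
      using alpha_pos
      by (intro lbd_sum lbd_scaleR[OF lbd_nth[OF lbd_nth[OF lbd_right[OF lbd_Y2 alpha_pos(4)]]]
            lbd_left[OF lbd_incr_second_coeff alpha_pos(3)]]) auto
  qed
  then show ?thesis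
  proof (rule lbd_cong)
    fix i s u t assume *: "i \<in> data_ball" "0 \<le> s" "s \<le> u" "u \<le> t" "t \<le> T"
    note h = admissible_holder[OF ball_admissible[OF *(1)] pos_T alpha(2)]
    show "step i s t - step i s u - step i u t - step i u t ** step i s u =
      - (step_smooth i u t ** step i s u + step_rough i u t ** step_smooth i s u
      + (\<Sum>\<kappa>\<in>UNIV. (incr (fst (dat_Y i)) u t $ \<kappa>) *\<^sub>R (dat_F i u $ \<kappa> - dat_F i s $ \<kappa>)) ** step_rough i s u
      + (\<Sum>\<kappa>\<in>UNIV. (incr (fst (dat_Y i)) u t $ \<kappa>) *\<^sub>R (ctrl_remainder (fst (dat_Y i)) (dat_F i) (dat_F' i) s u $ \<kappa>))
      + (\<Sum>\<kappa>\<in>UNIV. \<Sum>\<mu>\<in>UNIV. (snd (dat_Y i) u t $ \<kappa> $ \<mu>) *\<^sub>R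
          (second_coeff i \<kappa> \<mu> u - second_coeff i \<kappa> \<mu> s)))"
      by (rule step_multiplicative_defect[OF h(6,7) *(2-5)])
  qed
qed

lemma flow_exists:
  "\<exists>\<Phi> :: ('x, 'y) riccati_data \<Rightarrow> real \<Rightarrow> real^'x^'x. (\<forall>i\<in>data_ball. \<Phi> i 0 = mat 1) \<and>
     lbd 0 (\<lambda>i s u t. \<Phi> i t) \<and> lbd (3 * \<alpha>) (\<lambda>i s u t. \<Phi> i t - (mat 1 + step i s t) ** \<Phi> i s)"
proof (rule linear_rough_equation[OF bounded_bilinear_matrix_mult, where mul = "(**)" and one = "mat 1" and a = \<alpha>])
  show "lbd \<alpha> (\<lambda>i s u t. mat 1 + step i s t - mat 1)"
    using lbd_step by simp
  show "lbd (3 * \<alpha>) (\<lambda>i s u t. (mat 1 + step i s t) - (mat 1 + step i u t) ** (mat 1 + step i s u))"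
    by (rule lbd_cong[OF lbd_step_defect]) (simp add: mm.add_left mm.add_right)
  show "lbd 0 (\<lambda>i s u t. mat 1)" by (rule lbd_const)
qed (use alpha in \<open>auto simp: matrix_mul_assoc\<close>)

text \<open>Up to order \<open>3\<alpha>\<close>, \<open>1 - m + m\<^sup>2\<close> inverts \<open>1 + m\<close>, so it drives the inverse flow, acting from the
  right. Solving for the inverse flow separately yields its uniform bounds for free.\<close>

lemma inverse_flow_exists:
  "\<exists>\<Psi> :: ('x, 'y) riccati_data \<Rightarrow> real \<Rightarrow> real^'x^'x. (\<forall>i\<in>data_ball. \<Psi> i 0 = mat 1) \<and>
     lbd 0 (\<lambda>i s u t. \<Psi> i t) \<and>
     lbd (3 * \<alpha>) (\<lambda>i s u t. \<Psi> i t - \<Psi> i s ** (mat 1 - step i s t + step i s t ** step i s t))"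
proof (rule linear_rough_equation[OF bounded_bilinear.flip[OF bounded_bilinear_matrix_mult],
      where mul = "\<lambda>a b. b ** a" and one = "mat 1" and a = \<alpha>])
  have "lbd \<alpha> (\<lambda>i s u t. - step i s t + step i s t ** step i s t)"
    using alpha_pos by (intro lbd_add lbd_uminus lbd_step lbd_mm[OF lbd_step lbd_step]) auto
  then show "lbd \<alpha> (\<lambda>i s u t. mat 1 - step i s t + step i s t ** step i s t - mat 1)"
    by (simp add: add.commute)
  \<comment> \<open>The additive defect \<open>step i s t - step i s u - step i u t\<close>, written
    so that its order \<open>2 * \<alpha>\<close> can be read off.\<close>
  define e where "e i s u t = step i u t ** step i s u
    + (step i s t - step i s u - step i u t - step i u t ** step i s u)" for i :: "('x, 'y) riccati_data" and s u t
  note sl = lbd_left[OF lbd_step alpha_pos(3)] and sr = lbd_right[OF lbd_step alpha_pos(3)]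
  have e: "lbd (2 * \<alpha>) e"
    unfolding e_def[abs_def]
    using alpha_pos by (intro lbd_add lbd_mm[OF sr sl] lbd_mono[OF lbd_step_defect]) auto
  have sq: "lbd (2 * \<alpha>) (\<lambda>i s u t. step i u t ** step i u t)"
    using alpha_pos by (intro lbd_mm[OF sr sr]) auto
  have sql: "lbd (2 * \<alpha>) (\<lambda>i s u t. step i s u ** step i s u)"
    using alpha_pos by (intro lbd_mm[OF sl sl]) auto
  \<comment> \<open>After expansion the terms of order \<open>2 * \<alpha>\<close> combine to minus
    the defect of \<open>step\<close>, which is already known to be of order
    \<open>3 * \<alpha>\<close>; all others contain at least three factors \<alpha> in their
    order.\<close>
  have "lbd (3 * \<alpha>) (\<lambda>i s u t. - (step i s t - step i s u - step i u t - step i u t ** step i s u)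
    + (step i s u + step i u t) ** e i s u t + e i s u t ** step i s t
    + step i s u ** (step i u t ** step i u t) + (step i s u ** step i s u) ** step i u t
    - (step i s u ** step i s u) ** (step i u t ** step i u t))"
    using alpha_pos
    by (intro lbd_add lbd_diff lbd_uminus lbd_step_defect lbd_mm[OF lbd_add[OF sl sr] e] lbd_mm[OF e lbd_step]
        lbd_mm[OF sl sq] lbd_mm[OF sql sr] lbd_mm[OF sql sq]) auto
  then show "lbd (3 * \<alpha>) (\<lambda>i s u t. (mat 1 - step i s t + step i s t ** step i s t) -
    (mat 1 - step i s u + step i s u ** step i s u) ** (mat 1 - step i u t + step i u t ** step i u t))"
  proof (rule lbd_cong)
    fix i :: "('x, 'y) riccati_data" and s u t
    define a b where "a = step i s u" and "b = step i u t"
    have m: "step i s t = a + b + e i s u t"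
      by (simp add: e_def a_def b_def)
    have d: "step i s t - a - b - b ** a = e i s u t - b ** a"
      by (simp add: e_def a_def b_def)
    show "(mat 1 - step i s t + step i s t ** step i s t) -
      (mat 1 - step i s u + step i s u ** step i s u) ** (mat 1 - step i u t + step i u t ** step i u t)
     = - (step i s t - step i s u - step i u t - step i u t ** step i s u)
    + (step i s u + step i u t) ** e i s u t + e i s u t ** step i s t
    + step i s u ** (step i u t ** step i u t) + (step i s u ** step i s u) ** step i u t
    - (step i s u ** step i s u) ** (step i u t ** step i u t)"
      unfolding a_def[symmetric] b_def[symmetric] d unfolding m
      by (simp add: mm.add_left mm.add_right mm.diff_left mm.diff_right matrix_mul_assoc algebra_simps)
  qed
  show "lbd 0 (\<lambda>i s u t. mat 1)" by (rule lbd_const)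
qed (use alpha in \<open>auto simp: matrix_mul_assoc\<close>)

end

locale riccati_flow = riccati_family +
  fixes \<Phi> \<Psi> :: "('a::finite, 'b::finite) riccati_data \<Rightarrow> real \<Rightarrow> real^'a^'a"
  assumes flow_0: "\<And>i. i \<in> data_ball \<Longrightarrow> \<Phi> i 0 = mat 1" "\<And>i. i \<in> data_ball \<Longrightarrow> \<Psi> i 0 = mat 1"
    and lbd_flow: "lbd 0 (\<lambda>i s u t. \<Phi> i t)" "lbd 0 (\<lambda>i s u t. \<Psi> i t)"
    and flow_step: "lbd (3 * \<alpha>) (\<lambda>i s u t. \<Phi> i t - (mat 1 + step i s t) ** \<Phi> i s)"
      "lbd (3 * \<alpha>) (\<lambda>i s u t. \<Psi> i t - \<Psi> i s ** (mat 1 - step i s t + step i s t ** step i s t))"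
begin

text \<open>The flow estimates are of order \<open>3 * \<alpha>\<close> and \<open>step\<close> is
  of order \<alpha>, so both flows are \<alpha>-Hoelder. The compactness argument gave paths without
  any regularity.\<close>

lemma flow_continuous:
  assumes "i \<in> data_ball"
  shows "continuous_on {0..T} (\<Phi> i)" "continuous_on {0..T} (\<Psi> i)"
proof -
  have "lbd \<alpha> (\<lambda>i s u t. (\<Phi> i t - (mat 1 + step i s t) ** \<Phi> i s) + step i s t ** \<Phi> i s)"
    using alpha_pos
    by (intro lbd_add lbd_mono[OF flow_step(1)] lbd_mm[OF lbd_step lbd_point_left[OF lbd_flow(1)]]) auto
  then have "lbd \<alpha> (\<lambda>i s u t. \<Phi> i t - \<Phi> i s)"
    by (rule lbd_cong) (simp add: mm.add_left)
  then show "continuous_on {0..T} (\<Phi> i)"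
    by (rule lbd_continuous[OF _ alpha_pos(1) assms])
  have "lbd \<alpha> (\<lambda>i s u t. (\<Psi> i t - \<Psi> i s ** (mat 1 - step i s t + step i s t ** step i s t))
      + \<Psi> i s ** (- step i s t + step i s t ** step i s t))"
    using alpha_pos
    by (intro lbd_add lbd_mono[OF flow_step(2)]
        lbd_mm[OF lbd_point_left[OF lbd_flow(2)] lbd_add[OF lbd_uminus[OF lbd_step] lbd_mm[OF lbd_step lbd_step]]]) auto
  then have "lbd \<alpha> (\<lambda>i s u t. \<Psi> i t - \<Psi> i s)"
    by (rule lbd_cong) (simp add: mm.add_right mm.diff_right mm.minus_right)
  then show "continuous_on {0..T} (\<Psi> i)"
    by (rule lbd_continuous[OF _ alpha_pos(1) assms])
qed

text \<open>Since \<open>(1 - m + m\<^sup>2) (1 + m) = 1 + m\<^sup>3\<close>, the product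
  \<open>\<Psi> \<Phi>\<close> has increments of order \<open>3 * \<alpha> > 1\<close> and stays
  constant. In this way the bounds of \<open>\<Psi>\<close> become bounds for the inverse
  flow.\<close>

lemma flow_inverse:
  assumes i: "i \<in> data_ball" and t: "0 \<le> t" "t \<le> T"
  shows "\<Psi> i t ** \<Phi> i t = mat 1" "\<Phi> i t ** \<Psi> i t = mat 1"
proof -
  let ?N = "\<lambda>i s t. mat 1 - step i s t + step i s t ** step i s t"
  have N: "lbd 0 (\<lambda>i s u t. ?N i s t)"
    using alpha_pos
    by (intro lbd_add lbd_diff lbd_const lbd_mono[OF lbd_step] lbd_mm[OF lbd_step lbd_step]) auto
  note \<Psi>s = lbd_point_left[OF lbd_flow(2)] and \<Phi>s = lbd_point_left[OF lbd_flow(1)]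
  have m2: "lbd (2 * \<alpha>) (\<lambda>i s u t. step i s t ** step i s t)"
    using alpha_pos by (intro lbd_mm[OF lbd_step lbd_step]) auto
  have m3: "lbd (3 * \<alpha>) (\<lambda>i s u t. step i s t ** step i s t ** step i s t)"
    using alpha_pos by (intro lbd_mm[OF m2 lbd_step]) auto
  have 1: "lbd (3 * \<alpha>) (\<lambda>i s u t. \<Psi> i s ** (step i s t ** step i s t ** step i s t))"
    using alpha_pos by (intro lbd_mm[OF \<Psi>s m3]) auto
  have 2: "lbd 0 (\<lambda>i s u t. \<Psi> i s ** ?N i s t)"
    by (intro lbd_mm[OF \<Psi>s N]) auto
  \<comment> \<open>A telescoping sum in which the one-step approximations of \<open>\<Phi>\<close>
    and of \<open>\<Psi>\<close> are replaced one after the other; it equals the increment of the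
    product.\<close>
  have "lbd (3 * \<alpha>) (\<lambda>i s u t. \<Psi> i s ** (step i s t ** step i s t ** step i s t) ** \<Phi> i s
    + \<Psi> i s ** ?N i s t ** (\<Phi> i t - (mat 1 + step i s t) ** \<Phi> i s)
    + (\<Psi> i t - \<Psi> i s ** ?N i s t) ** \<Phi> i t)"
    using alpha_pos
    by (intro lbd_add lbd_mm[OF 1 \<Phi>s] lbd_mm[OF 2 flow_step(1)] lbd_mm[OF flow_step(2) lbd_flow(1)]) auto
  then have "lbd (3 * \<alpha>) (\<lambda>i s u t. \<Psi> i t ** \<Phi> i t - \<Psi> i s ** \<Phi> i s)"
    by (rule lbd_cong) (simp add: mm.add_left mm.add_right mm.diff_left mm.diff_right matrix_mul_assoc)
  then have "small_o T (\<lambda>s t. \<Psi> i t ** \<Phi> i t - \<Psi> i s ** \<Phi> i s)"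
    by (rule lbd_small_o[OF _ alpha_pos(6) i])
  from small_o_imp_constant[OF this t] show "\<Psi> i t ** \<Phi> i t = mat 1"
    by (simp add: flow_0 i)
  then show "\<Phi> i t ** \<Psi> i t = mat 1"
    by (simp add: matrix_left_right_inverse)
qed

end

section \<open>Conjugation by the flow\<close>

lemma sym_mult_add: "sym_mult (A + B) v = sym_mult A v + sym_mult B v"
  by (simp add: sym_mult_def mm.add_left mm.add_right transpose_add)

lemma sym_mult_scaleR: "sym_mult (c *\<^sub>R A) v = c *\<^sub>R sym_mult A v"
proof -
  have "transpose (c *\<^sub>R A) = c *\<^sub>R transpose A" by (simp add: transpose_def vec_eq_iff)
  then show ?thesis
    by (simp add: sym_mult_def mm.scaleR_left mm.scaleR_right scaleR_add_right)
qed

lemma bounded_linear_sym_mult: "bounded_linear (\<lambda>A. sym_mult A (v :: real^'n^'n))"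
  by (simp add: linear_conv_bounded_linear[symmetric] linearI sym_mult_add sym_mult_scaleR)

lemma bounded_bilinear_sym_mult:
  "bounded_bilinear (sym_mult :: real^'n^'n \<Rightarrow> real^'n^'n \<Rightarrow> real^'n^'n)"
proof -
  have "bilinear (sym_mult :: real^'n^'n \<Rightarrow> real^'n^'n \<Rightarrow> real^'n^'n)"
    unfolding bilinear_def
  proof (intro conjI allI)
    fix x y :: "real^'n^'n"
    show "linear (\<lambda>A. sym_mult A y)" by (rule bounded_linear.linear[OF bounded_linear_sym_mult])
    show "linear (sym_mult x)"
      by (intro linearI) (simp_all add: sym_mult_def mm.add_left mm.add_right mm.scaleR_left
        mm.scaleR_right scaleR_add_right)
  qed
  then show ?thesis by (simp add: bilinear_conv_bounded_bilinear)
qed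

lemma sym_mult_sum: "sym_mult (\<Sum>k\<in>S. A k) v = (\<Sum>k\<in>S. sym_mult (A k) v)"
  by (rule linear_sum[OF bounded_linear.linear[OF bounded_linear_sym_mult]])

lemma transpose_scaleR: "transpose (c *\<^sub>R A) = c *\<^sub>R transpose (A :: real^'n^'m)"
  by (simp add: transpose_def vec_eq_iff)

lemma transpose_sum: "transpose (\<Sum>k\<in>S. A k) = (\<Sum>k\<in>S. transpose (A k :: real^'n^'m))"
  by (rule linear_sum[OF bounded_linear.linear[OF bounded_linear_transpose]])

definition bracket_form :: "('x::finite, 'y::finite) riccati_data \<Rightarrow> real \<Rightarrow> real^'y^'y \<Rightarrow> real^'x^'x \<Rightarrow> real^'x^'x" where
  "bracket_form E s Z v = (\<Sum>\<kappa>\<in>UNIV. \<Sum>\<mu>\<in>UNIV. (Z $ \<kappa> $ \<mu>) *\<^sub>R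
     (dat_F E s $ \<kappa> ** v ** transpose (dat_F E s $ \<mu>)))"

text \<open>The part of the drift that survives the conjugation: the terms with \<open>C\<close> and
  with the bracket are produced by the flow.\<close>

definition smooth_drift :: "('x::finite, 'y::finite) riccati_data \<Rightarrow> real \<Rightarrow> real^'x^'x \<Rightarrow> real^'x^'x" where
  "smooth_drift E t v = dat_Q E t - v ** transpose (dat_H E t) ** dat_R E t ** dat_H E t ** v"

lemma riccati_drift_split:
  "riccati_drift T E t v = smooth_drift E t v + sym_mult (dat_C E t) v
    + bracket_form E t (vector_derivative (bracket (dat_Y E)) (at t within {0..T})) v"
  by (simp add: riccati_drift_def smooth_drift_def sym_mult_def bracket_form_def)

text \<open>The Davie expansion weights \<open>F\<^sub>\<kappa> v F\<^sub>\<mu>\<^sup>T\<close> with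
  the symmetrised second level, whereas the congruence of \<open>v\<close> by
  \<open>step_rough\<close> weights it with the tensor square of the increment. By
  \<open>bracket_incr\<close> the weights differ exactly by a bracket increment, which is the origin
  of the bracket term in the drift.\<close>

lemma second_order_terms:
  fixes E :: "('x::finite, 'y::finite) riccati_data"
  assumes chen: "chen T (dat_Y E)" and st: "0 \<le> s" "s \<le> t" "t \<le> T"
  shows "(\<Sum>\<kappa>\<in>UNIV. \<Sum>\<mu>\<in>UNIV. (snd (dat_Y E) s t $ \<kappa> $ \<mu>) *\<^sub>R
        (frechet_derivative (riccati_g E \<mu> s) (at v) (riccati_g E \<kappa> s v) + riccati_g' E \<mu> \<kappa> s v))
    = sym_mult (driver2 E s (snd (dat_Y E) s t)) v
      + step_rough E s t ** v ** transpose (step_rough E s t)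
      - bracket_form E s (incr (bracket (dat_Y E)) s t) v"
proof -
  let ?Y = "snd (dat_Y E) s t" and ?F = "\<lambda>\<kappa>. dat_F E s $ \<kappa>"
  let ?S = "\<lambda>f. \<Sum>\<kappa>\<in>(UNIV::'y set). \<Sum>\<mu>\<in>(UNIV::'y set). f \<kappa> \<mu>"
  define y where "y = incr (fst (dat_Y E)) s t"
  define P where "P \<kappa> \<mu> = ?F \<kappa> ** v ** transpose (?F \<mu>)" for \<kappa> \<mu>
  have "tensor y y = ?Y + transpose ?Y + incr (bracket (dat_Y E)) s t"
    unfolding y_def by (rule bracket_incr[OF chen st])
  then have yy: "y $ \<kappa> * y $ \<mu> = ?Y $ \<kappa> $ \<mu> + ?Y $ \<mu> $ \<kappa> + incr (bracket (dat_Y E)) s t $ \<kappa> $ \<mu>" for \<kappa> \<mu>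
    by (simp add: vec_eq_iff tensor_def transpose_def)
  have g: "frechet_derivative (riccati_g E \<mu> s) (at v) (riccati_g E \<kappa> s v) + riccati_g' E \<mu> \<kappa> s v
    = sym_mult (second_coeff E \<kappa> \<mu> s) v + (P \<kappa> \<mu> + P \<mu> \<kappa>)" for \<kappa> \<mu>
    unfolding frechet_derivative_riccati_g
    by (simp add: riccati_g_def riccati_g'_def sym_mult_def second_coeff_def P_def transpose_add
      matrix_transpose_mul mm.add_left mm.add_right matrix_mul_assoc)
  have "step_rough E s t ** v ** transpose (step_rough E s t) = ?S (\<lambda>\<kappa> \<mu>. (y $ \<kappa> * y $ \<mu>) *\<^sub>R P \<kappa> \<mu>)"
    unfolding step_rough_def driver1_def y_def[symmetric] P_def transpose_sum transpose_scaleR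
      mm.sum_left mm.sum_right mm.scaleR_left mm.scaleR_right
    by (simp add: scaleR_sum_right) (subst sum.swap, simp add: mult.commute)
  also have "\<dots> = ?S (\<lambda>\<kappa> \<mu>. ?Y $ \<kappa> $ \<mu> *\<^sub>R P \<kappa> \<mu>) + ?S (\<lambda>\<kappa> \<mu>. ?Y $ \<mu> $ \<kappa> *\<^sub>R P \<kappa> \<mu>)
      + bracket_form E s (incr (bracket (dat_Y E)) s t) v"
    by (simp add: yy scaleR_left_distrib sum.distrib bracket_form_def P_def)
  also have "?S (\<lambda>\<kappa> \<mu>. ?Y $ \<mu> $ \<kappa> *\<^sub>R P \<kappa> \<mu>) = ?S (\<lambda>\<kappa> \<mu>. ?Y $ \<kappa> $ \<mu> *\<^sub>R P \<mu> \<kappa>)"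
    by (rule sum.swap)
  finally have A: "step_rough E s t ** v ** transpose (step_rough E s t) =
    ?S (\<lambda>\<kappa> \<mu>. ?Y $ \<kappa> $ \<mu> *\<^sub>R P \<kappa> \<mu>) + ?S (\<lambda>\<kappa> \<mu>. ?Y $ \<kappa> $ \<mu> *\<^sub>R P \<mu> \<kappa>)
      + bracket_form E s (incr (bracket (dat_Y E)) s t) v" .
  have B: "sym_mult (driver2 E s ?Y) v = ?S (\<lambda>\<kappa> \<mu>. ?Y $ \<kappa> $ \<mu> *\<^sub>R sym_mult (second_coeff E \<kappa> \<mu> s) v)"
    by (simp add: driver2_def sym_mult_sum sym_mult_scaleR)
  show ?thesis
    unfolding g A B by (simp add: scaleR_add_right sum.distrib)
qed

section \<open>Remainders under conjugation by the flow\<close>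

context riccati_flow
begin

text \<open>The remainder that arises when the linear part of the equation is applied as the
  congruence with the one-step map of the flow, in place of its second-order expansion.\<close>

definition flow_defect :: "('a, 'b) riccati_data \<Rightarrow> (real \<Rightarrow> real^'a^'a) \<Rightarrow> real \<Rightarrow> real \<Rightarrow> real^'a^'a" where
  "flow_defect E v s t = v t - (mat 1 + step E s t) ** v s ** transpose (mat 1 + step E s t)
     - integral {s..t} (\<lambda>r. smooth_drift E r (v r))"

lemma small_o_mm_left:
  assumes "small_o T f" "bounded3 T (\<lambda>s t r. g s t)"
  shows "small_o T (\<lambda>s t. f s t ** (g s t :: real^'n^'m))"
  by (rule small_o_bilinear_left[OF bounded_bilinear_matrix_mult assms])

lemma small_o_mm_right:
  assumes "bounded3 T (\<lambda>s t r. g s t)" "small_o T f"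
  shows "small_o T (\<lambda>s t. g s t ** (f s t :: real^'n^'m))"
  by (rule small_o_bilinear_right[OF bounded_bilinear_matrix_mult assms])

lemma lbd_bounded3:
  assumes "lbd 0 (\<lambda>i s u t. f i s t)" "i \<in> data_ball"
  shows "bounded3 T (\<lambda>s t r. f i s t)"
proof (rule lbdE[OF assms(1)])
  fix K assume "\<And>i s u t. \<lbrakk>i \<in> data_ball; 0 \<le> s; s \<le> u; u \<le> t; t \<le> T\<rbrakk> \<Longrightarrow> norm (f i s t) \<le> K * pw (t - s) 0"
  then show ?thesis using assms(2) unfolding bounded3_def by (intro exI[of _ K]) fastforce
qed

lemma bounded3_transpose: "bounded3 T f \<Longrightarrow> bounded3 T (\<lambda>s t r. transpose (f s t r :: real^'n^'m))"
proof -
  obtain K where "\<And>x :: real^'n^'m. norm (transpose x) \<le> norm x * K" "0 < K"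
    using bounded_linear.pos_bounded[OF bounded_linear_transpose] by blast
  moreover assume "bounded3 T f"
  then obtain B where "\<And>s r t. 0 \<le> s \<and> s \<le> r \<and> r \<le> t \<and> t \<le> T \<Longrightarrow> norm (f s t r) \<le> B"
    unfolding bounded3_def by blast
  ultimately show ?thesis
    unfolding bounded3_def by (meson mult_right_mono order_trans less_imp_le)
qed

lemma bmeas_smooth_drift:
  assumes "E \<in> data_ball" "bmeas T v"
  shows "bmeas T (\<lambda>r. smooth_drift E r (v r))"
  unfolding smooth_drift_def
  by (intro bmeas_diff bmeas_bilinear[OF bounded_bilinear_matrix_mult] bmeas_linear[OF bounded_linear_transpose]
      assms admissible_holder[OF ball_admissible[OF assms(1)] pos_T alpha(2)])

text \<open>The two remainders differ in two ways. In the integrals of the \<open>C\<close> and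
  bracket terms, \<open>v\<close> and \<open>F\<close> are frozen at \<open>s\<close>, which costs
  o(t - s) by continuity; and the congruence contains products of steps, of order
  \<open>3 * \<alpha>\<close>, which are absent from the expansion.\<close>

lemma flow_defect_eq_remainder:
  assumes E: "E \<in> data_ball" and v: "continuous_on {0..T} v"
  shows "small_o T (\<lambda>s t. flow_defect E v s t - riccati_remainder T E v s t)"
    and "bmeas T (\<lambda>r. riccati_drift T E r (v r))"
proof -
  note h = admissible_holder[OF ball_admissible[OF E] pos_T alpha(2)]
  note mb = bounded_bilinear_matrix_mult
  have C1: "C1_on_interval T (bracket (dat_Y E))"
    using ball_admissible[OF E] by (simp add: admissible_def rough_path_C01_def)
  let ?b = "\<lambda>t. vector_derivative (bracket (dat_Y E)) (at t within {0..T})"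
  note bc = C1_on_interval_prim(1)[OF C1 pos_T] and bp = C1_on_interval_prim(2)[OF C1 pos_T]
  note bm = prim_bmeas[OF bp]
  note vm = bmeas_continuous[OF v]
  have Fc: "continuous_on {0..T} (\<lambda>t. dat_F E t $ \<kappa>)" for \<kappa>
    by (rule lbd_continuous[OF lbd_incr_F alpha_pos(1) E])
  define G where "G \<kappa> \<mu> t = dat_F E t $ \<kappa> ** v t ** transpose (dat_F E t $ \<mu>)" for \<kappa> \<mu> t
  have Gc: "continuous_on {0..T} (G \<kappa> \<mu>)" for \<kappa> \<mu>
    unfolding G_def
    by (intro bounded_bilinear.continuous_on[OF mb] Fc v bounded_linear.continuous_on[OF bounded_linear_transpose])
  note Gm = bmeas_continuous[OF Gc]
  have bfm: "bmeas T (\<lambda>r. bracket_form E r (?b r) (v r))"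
    unfolding bracket_form_def G_def[symmetric]
    by (intro bmeas_sum bmeas_bilinear[OF bounded_bilinear_scaleR] Gm
        bmeas_linear[OF bounded_linear_vec_nth] bm)
  have Cm: "bmeas T (\<lambda>r. sym_mult (dat_C E r) (v r))"
    by (intro bmeas_bilinear[OF bounded_bilinear_sym_mult] h vm)
  note sm = bmeas_smooth_drift[OF E vm]
  show "bmeas T (\<lambda>r. riccati_drift T E r (v r))"
    unfolding riccati_drift_split by (intro bmeas_add sm Cm bfm)
  let ?h = "\<lambda>s t r. sym_mult (dat_C E r) (v r - v s) + (\<Sum>\<kappa>\<in>UNIV. \<Sum>\<mu>\<in>UNIV. (?b r $ \<kappa> $ \<mu>) *\<^sub>R (G \<kappa> \<mu> r - G \<kappa> \<mu> s))"
  have "vanish T ?h"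
    by (intro vanish_add vanish_sum vanish_bilinear_right[OF bounded_bilinear_sym_mult]
        vanish_bilinear_right[OF bounded_bilinear_scaleR] bounded3_bmeas h
        bmeas_linear[OF bounded_linear_vec_nth] bm continuous_imp_vanish v Gc)
  then have int: "small_o T (\<lambda>s t. integral {s..t} (?h s t))"
    by (rule small_o_integral_vanish)
      (intro bmeas_integrable[of T] bmeas_add bmeas_sum bmeas_bilinear[OF bounded_bilinear_sym_mult]
        bmeas_bilinear[OF bounded_bilinear_scaleR] bmeas_linear[OF bounded_linear_vec_nth] bmeas_diff
        bmeas_const h bm Gm vm, auto)
  obtain K where K: "0 < K" "\<And>t. \<lbrakk>0 \<le> t; t \<le> T\<rbrakk> \<Longrightarrow> norm (v t) \<le> K"
    using bmeas_bound[OF vm] by blast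
  let ?m = "\<lambda>s t. step E s t" and ?a = "\<lambda>s t. step_rough E s t" and ?c = "\<lambda>s t. step_smooth E s t"
  \<comment> \<open>All of \<open>step ** v ** transpose step\<close> except its rough-rough part,
    which is only of order \<open>2 * \<alpha>\<close> and is accounted for by
    \<open>second_order_terms\<close>.\<close>
  let ?quad = "\<lambda>s t. ?c s t ** v s ** transpose (?m s t) + ?a s t ** v s ** transpose (?c s t)"
  have quad: "small_o T ?quad"
  proof -
    obtain K1 where K1: "0 \<le> K1" "\<And>i s u t. \<lbrakk>i \<in> data_ball; 0 \<le> s; s \<le> u; u \<le> t; t \<le> T\<rbrakk> \<Longrightarrow>
        norm (step_smooth i s t) \<le> K1 * pw (t - s) (2 * \<alpha>)"
      by (rule lbdE[OF lbd_step_smooth]) (rule that)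
    obtain K2 where K2: "0 \<le> K2" "\<And>i s u t. \<lbrakk>i \<in> data_ball; 0 \<le> s; s \<le> u; u \<le> t; t \<le> T\<rbrakk> \<Longrightarrow>
        norm (transpose (step i s t)) \<le> K2 * pw (t - s) \<alpha>"
      by (rule lbdE[OF lbd_bounded_linear[OF bounded_linear_transpose lbd_step]]) (rule that)
    obtain K3 where K3: "0 \<le> K3" "\<And>i s u t. \<lbrakk>i \<in> data_ball; 0 \<le> s; s \<le> u; u \<le> t; t \<le> T\<rbrakk> \<Longrightarrow>
        norm (step_rough i s t) \<le> K3 * pw (t - s) \<alpha>"
      by (rule lbdE[OF lbd_step_rough]) (rule that)
    obtain K4 where K4: "0 \<le> K4" "\<And>i s u t. \<lbrakk>i \<in> data_ball; 0 \<le> s; s \<le> u; u \<le> t; t \<le> T\<rbrakk> \<Longrightarrow>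
        norm (transpose (step_smooth i s t)) \<le> K4 * pw (t - s) (2 * \<alpha>)"
      by (rule lbdE[OF lbd_bounded_linear[OF bounded_linear_transpose lbd_step_smooth]]) (rule that)
    obtain B :: real where B: "B > 0" "\<And>(x::real^'a^'a) (y::real^'a^'a). norm (x ** y) \<le> norm x * norm y * B"
      using mm.pos_bounded by blast
    have 3: "norm (x ** y ** z) \<le> X * K * B * Z * B" if "norm x \<le> X" "norm y \<le> K" "norm z \<le> Z"
      for x y z :: "real^'a^'a" and X Z
      using that B(1) order_trans[OF norm_ge_zero that(1)] order_trans[OF norm_ge_zero that(2)]
      by (intro order_trans[OF B(2)] mult_right_mono mult_mono) auto
    show ?thesis
    proof (rule small_o_powr[OF alpha_pos(6)])
      fix s t assume st: "0 \<le> s" "s \<le> t" "t \<le> T"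
      have p: "pw (t - s) (2 * \<alpha>) * pw (t - s) \<alpha> = (t - s) powr (3 * \<alpha>)"
        using st alpha_pos pw_add[of "t - s" "2 * \<alpha>" \<alpha>] by (simp add: pw_def)
      have "norm (?quad s t) \<le> (K1 * pw (t - s) (2 * \<alpha>)) * K * B * (K2 * pw (t - s) \<alpha>) * B
          + (K3 * pw (t - s) \<alpha>) * K * B * (K4 * pw (t - s) (2 * \<alpha>)) * B"
        using st E K
        by (intro norm_triangle_mono 3 K1(2)[of E s s t] K2(2)[of E s s t] K3(2)[of E s s t] K4(2)[of E s s t]) auto
      also have "\<dots> = (K1 * K * B * K2 * B + K3 * K * B * K4 * B) * (pw (t - s) (2 * \<alpha>) * pw (t - s) \<alpha>)"
        by (simp add: algebra_simps)
      finally show "norm (?quad s t) \<le> (K1 * K * B * K2 * B + K3 * K * B * K4 * B) * (t - s) powr (3 * \<alpha>)"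
        unfolding p .
    qed
  qed
  show "small_o T (\<lambda>s t. flow_defect E v s t - riccati_remainder T E v s t)"
  proof (rule small_o_cong[OF small_o_diff[OF int quad]])
    fix s t assume st: "0 \<le> s" "s \<le> t" "t \<le> T"
    have i: "\<And>f. bmeas T f \<Longrightarrow> (f :: real \<Rightarrow> real^'a^'a) integrable_on {s..t}"
      using st bmeas_integrable by blast
    have drift: "integral {s..t} (\<lambda>r. riccati_drift T E r (v r)) = integral {s..t} (\<lambda>r. smooth_drift E r (v r))
      + integral {s..t} (\<lambda>r. sym_mult (dat_C E r) (v r)) + integral {s..t} (\<lambda>r. bracket_form E r (?b r) (v r))"
      unfolding riccati_drift_split
      using Henstock_Kurzweil_Integration.integral_add[OF i[OF bmeas_add[OF sm Cm]] i[OF bfm]]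
        Henstock_Kurzweil_Integration.integral_add[OF i[OF sm] i[OF Cm]] by simp
    have Ci: "dat_C E integrable_on {s..t}" using i h by blast
    have sC: "sym_mult (integral {s..t} (dat_C E)) (v s) = integral {s..t} (\<lambda>r. sym_mult (dat_C E r) (v s))"
      by (rule integral_bounded_linear_comp[OF bounded_linear_sym_mult Ci, symmetric])
    have Csm: "bmeas T (\<lambda>r. sym_mult (dat_C E r) (v s))"
      by (intro bmeas_bilinear[OF bounded_bilinear_sym_mult] h bmeas_const)
    have bfsm: "bmeas T (\<lambda>r. bracket_form E s (?b r) (v s))"
      unfolding bracket_form_def
      by (intro bmeas_sum bmeas_bilinear[OF bounded_bilinear_scaleR] bmeas_const
          bmeas_linear[OF bounded_linear_vec_nth] bm)
    have bl: "bounded_linear (\<lambda>Z. bracket_form E s Z (v s))"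
      unfolding bracket_form_def
      by (intro bounded_linear_sum bounded_linear_scaleR_const
          bounded_linear_compose[OF bounded_linear_vec_nth] bounded_linear_vec_nth)
    have bi: "?b integrable_on {s..t}" using st bmeas_integrable[OF bm] by auto
    have sb: "bracket_form E s (incr (bracket (dat_Y E)) s t) (v s) = integral {s..t} (\<lambda>r. bracket_form E s (?b r) (v s))"
      using integral_bounded_linear_comp[OF bl bi] primD[OF bp st] by (simp add: incr_def)
    have inth: "integral {s..t} (?h s t) =
      (integral {s..t} (\<lambda>r. sym_mult (dat_C E r) (v r)) - integral {s..t} (\<lambda>r. sym_mult (dat_C E r) (v s)))
      + (integral {s..t} (\<lambda>r. bracket_form E r (?b r) (v r)) - integral {s..t} (\<lambda>r. bracket_form E s (?b r) (v s)))"
    proof -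
      have "?h s t = (\<lambda>r. (sym_mult (dat_C E r) (v r) - sym_mult (dat_C E r) (v s))
        + (bracket_form E r (?b r) (v r) - bracket_form E s (?b r) (v s)))"
        by (simp add: fun_eq_iff bounded_bilinear.diff_right[OF bounded_bilinear_sym_mult] G_def
            bracket_form_def scaleR_diff_right sum_subtractf)
      then show ?thesis
        using Henstock_Kurzweil_Integration.integral_add[OF i[OF bmeas_diff[OF Cm Csm]] i[OF bmeas_diff[OF bfm bfsm]]]
          Henstock_Kurzweil_Integration.integral_diff[OF i[OF Cm] i[OF Csm]]
          Henstock_Kurzweil_Integration.integral_diff[OF i[OF bfm] i[OF bfsm]] by simp
    qed
    have L1: "(\<Sum>\<kappa>\<in>UNIV. (incr (fst (dat_Y E)) s t $ \<kappa>) *\<^sub>R riccati_g E \<kappa> s (v s)) = sym_mult (?a s t) (v s)"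
      by (simp add: step_rough_def driver1_def sym_mult_sum sym_mult_scaleR riccati_g_def)
    have m: "?m s t = integral {s..t} (dat_C E) + driver2 E s (snd (dat_Y E) s t) + ?a s t"
      by (simp add: step_def step_smooth_def)
    have "(mat 1 + ?m s t) ** v s ** transpose (mat 1 + ?m s t)
      = v s + sym_mult (?m s t) (v s) + (?quad s t + ?a s t ** v s ** transpose (?a s t))"
      by (simp add: sym_mult_def step_def transpose_add mm.add_left mm.add_right)
    also have "sym_mult (?m s t) (v s) = sym_mult (integral {s..t} (dat_C E)) (v s)
      + sym_mult (driver2 E s (snd (dat_Y E) s t)) (v s) + sym_mult (?a s t) (v s)"
      by (simp add: m sym_mult_add)
    finally have M: "(mat 1 + ?m s t) ** v s ** transpose (mat 1 + ?m s t) =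
      v s + (sym_mult (integral {s..t} (dat_C E)) (v s) + sym_mult (driver2 E s (snd (dat_Y E) s t)) (v s)
        + sym_mult (?a s t) (v s)) + (?quad s t + ?a s t ** v s ** transpose (?a s t))" .
    show "flow_defect E v s t - riccati_remainder T E v s t = integral {s..t} (?h s t) - ?quad s t"
      unfolding flow_defect_def riccati_remainder_def M L1 drift inth second_order_terms[OF h(6) st] sC sb
      by (simp add: incr_def)
  qed
qed

text \<open>If the one-step map were exactly \<open>\<Phi> E t ** \<Psi> E s\<close>, its congruence
  of \<open>v s\<close>, conjugated with \<open>\<Psi> E t\<close>, would be \<open>w s\<close>, and
  no rough term would remain. The true map differs from it by \<open>J s t ** \<Psi> E s\<close>, of
  order \<open>3 * \<alpha>\<close>, and replacing \<open>\<Psi> E t\<close> by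
  \<open>\<Psi> E r\<close> under the drift integral costs o(t - s).\<close>

lemma conjugated_increment:
  assumes E: "E \<in> data_ball" and v: "continuous_on {0..T} v"
  defines "w \<equiv> \<lambda>t. \<Psi> E t ** v t ** transpose (\<Psi> E t)"
  shows "small_o T (\<lambda>s t. (w t - w s - integral {s..t} (\<lambda>r. \<Psi> E r ** smooth_drift E r (v r) ** transpose (\<Psi> E r)))
    - \<Psi> E t ** flow_defect E v s t ** transpose (\<Psi> E t))"
proof -
  note mb = bounded_bilinear_matrix_mult
  note vm = bmeas_continuous[OF v]
  note \<Psi>c = flow_continuous(2)[OF E] and \<Phi>c = flow_continuous(1)[OF E]
  note \<Psi>m = bmeas_continuous[OF \<Psi>c] and \<Phi>m = bmeas_continuous[OF \<Phi>c]
  define g where "g r = smooth_drift E r (v r)" for r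
  have gm: "bmeas T g" unfolding g_def by (rule bmeas_smooth_drift[OF E vm])
  define J where "J s t = \<Phi> E t - (mat 1 + step E s t) ** \<Phi> E s" for s t
  have J: "small_o T J"
    unfolding J_def by (rule lbd_small_o[OF flow_step(1) alpha_pos(6) E])
  let ?M = "\<lambda>s t. mat 1 + step E s t"
  let ?P = "\<lambda>s t. \<Phi> E t ** \<Psi> E s"
  have M3: "bounded3 T (\<lambda>s t r. ?M s t)"
    by (rule lbd_bounded3[OF lbd_add[OF lbd_const lbd_mono[OF lbd_step]] E]) (use alpha_pos in auto)
  have v3: "bounded3 T (\<lambda>s t r. v s)" by (rule bounded3_bmeas[OF vm])
  have \<Psi>3: "bounded3 T (\<lambda>s t r. \<Psi> E s)" "bounded3 T (\<lambda>s t r. \<Psi> E t)" by (rule bounded3_bmeas[OF \<Psi>m])+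
  have \<Phi>3: "bounded3 T (\<lambda>s t r. \<Phi> E t)" by (rule bounded3_bmeas[OF \<Phi>m])
  note b3 = bounded3_bilinear[OF mb]
  have J\<Psi>: "small_o T (\<lambda>s t. J s t ** \<Psi> E s)" by (rule small_o_mm_left[OF J \<Psi>3(1)])
  have e1: "small_o T (\<lambda>s t. \<Psi> E t ** ((J s t ** \<Psi> E s) ** v s ** transpose (?P s t)
      + ?M s t ** v s ** transpose (J s t ** \<Psi> E s)) ** transpose (\<Psi> E t))"
  proof (intro small_o_mm_left[OF small_o_mm_right[OF \<Psi>3(2)]] bounded3_transpose \<Psi>3 small_o_add)
    show "small_o T (\<lambda>s t. (J s t ** \<Psi> E s) ** v s ** transpose (?P s t))"
      by (rule small_o_mm_left[OF small_o_mm_left[OF J\<Psi> v3] bounded3_transpose[OF b3[OF \<Phi>3 \<Psi>3(1)]]])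
    have "small_o T (\<lambda>s t. transpose (J s t ** \<Psi> E s))"
    proof -
      obtain K where "\<And>x :: real^'a^'a. norm (transpose x) \<le> norm x * K"
        using bounded_linear.bounded[OF bounded_linear_transpose] by blast
      then show ?thesis by (intro small_o_dominated[OF J\<Psi>, of _ K]) (simp add: mult.commute)
    qed
    then show "small_o T (\<lambda>s t. ?M s t ** v s ** transpose (J s t ** \<Psi> E s))"
      by (rule small_o_mm_right[OF b3[OF M3 v3]])
  qed
  let ?h = "\<lambda>s t r. (\<Psi> E t - \<Psi> E r) ** g r ** transpose (\<Psi> E t) + \<Psi> E r ** g r ** transpose (\<Psi> E t - \<Psi> E r)"
  have "vanish T ?h"
    by (intro vanish_add vanish_bilinear_left[OF mb] vanish_bilinear_right[OF mb] b3
        vanish_linear[OF bounded_linear_transpose] continuous_imp_vanish \<Psi>c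
        bounded3_bmeas gm \<Psi>m bounded3_transpose)
  then have "small_o T (\<lambda>s t. integral {s..t} (?h s t))"
    by (rule small_o_integral_vanish)
      (intro bmeas_integrable[of T] bmeas_add bmeas_diff bmeas_bilinear[OF mb]
        bmeas_linear[OF bounded_linear_transpose] bmeas_const gm \<Psi>m, auto)
  from small_o_diff[OF this e1] show ?thesis
  proof (rule small_o_cong)
    fix s t assume st: "0 \<le> s" "s \<le> t" "t \<le> T"
    have gi: "g integrable_on {s..t}" using st bmeas_integrable[OF gm] by auto
    have lin: "bounded_linear (\<lambda>Y. \<Psi> E t ** Y ** transpose (\<Psi> E t))"
      by (intro bounded_linear_compose[OF mm.bounded_linear_left] mm.bounded_linear_right)
    have i1: "(\<lambda>r. \<Psi> E t ** g r ** transpose (\<Psi> E t)) integrable_on {s..t}"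
      and i2: "(\<lambda>r. \<Psi> E r ** g r ** transpose (\<Psi> E r)) integrable_on {s..t}"
      using st by (intro bmeas_integrable[of T] bmeas_bilinear[OF mb]
        bmeas_linear[OF bounded_linear_transpose] bmeas_const gm \<Psi>m; simp)+
    have "?h s t = (\<lambda>r. \<Psi> E t ** g r ** transpose (\<Psi> E t) - \<Psi> E r ** g r ** transpose (\<Psi> E r))"
      by (simp add: fun_eq_iff mm.diff_left mm.diff_right
          linear_diff[OF bounded_linear.linear[OF bounded_linear_transpose]])
    then have h: "integral {s..t} (?h s t) = \<Psi> E t ** integral {s..t} g ** transpose (\<Psi> E t)
      - integral {s..t} (\<lambda>r. \<Psi> E r ** g r ** transpose (\<Psi> E r))"
      using Henstock_Kurzweil_Integration.integral_diff[OF i1 i2] integral_bounded_linear_comp[OF lin gi] by simp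
    have inv: "\<Psi> E t ** \<Phi> E t = mat 1" "\<Phi> E s ** \<Psi> E s = mat 1"
      using flow_inverse[OF E, of t] flow_inverse[OF E, of s] st by auto
    have J\<Psi>_eq: "J s t ** \<Psi> E s = ?P s t - ?M s t"
      using inv(2) by (simp add: J_def mm.diff_left flip: matrix_mul_assoc)
    have "\<Psi> E t ** (?P s t ** v s ** transpose (?P s t)) ** transpose (\<Psi> E t)
      = (\<Psi> E t ** \<Phi> E t) ** (\<Psi> E s ** v s ** transpose (\<Psi> E s)) ** transpose (\<Psi> E t ** \<Phi> E t)"
      by (simp add: matrix_transpose_mul matrix_mul_assoc)
    also have "\<dots> = w s" unfolding inv by (simp add: w_def)
    finally have ws: "\<Psi> E t ** (?P s t ** v s ** transpose (?P s t)) ** transpose (\<Psi> E t) = w s" .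
    have split: "(J s t ** \<Psi> E s) ** v s ** transpose (?P s t) + ?M s t ** v s ** transpose (J s t ** \<Psi> E s)
      = ?P s t ** v s ** transpose (?P s t) - ?M s t ** v s ** transpose (?M s t)"
      unfolding J\<Psi>_eq
      by (simp add: mm.diff_left mm.diff_right linear_diff[OF bounded_linear.linear[OF bounded_linear_transpose]])
    show "w t - w s - integral {s..t} (\<lambda>r. \<Psi> E r ** smooth_drift E r (v r) ** transpose (\<Psi> E r))
      - \<Psi> E t ** flow_defect E v s t ** transpose (\<Psi> E t)
      = integral {s..t} (?h s t) - \<Psi> E t ** ((J s t ** \<Psi> E s) ** v s ** transpose (?P s t)
      + ?M s t ** v s ** transpose (J s t ** \<Psi> E s)) ** transpose (\<Psi> E t)"
      unfolding h split
      unfolding flow_defect_def g_def[symmetric] mm.diff_left mm.diff_right ws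
      by (simp add: w_def)
  qed
qed

section \<open>The reduced ordinary Riccati equation\<close>

definition ode_Q :: "('a, 'b) riccati_data \<Rightarrow> real \<Rightarrow> real^'a^'a" where
  "ode_Q E t = \<Psi> E t ** dat_Q E t ** transpose (\<Psi> E t)"

definition ode_S :: "('a, 'b) riccati_data \<Rightarrow> real \<Rightarrow> real^'a^'a" where
  "ode_S E t = transpose (dat_H E t ** \<Phi> E t) ** dat_R E t ** (dat_H E t ** \<Phi> E t)"

text \<open>The factors \<open>\<Phi>\<close> inside \<open>ode_S\<close> cancel against the factors
  \<open>\<Psi>\<close> of the two adjacent copies of \<open>w\<close>.\<close>

lemma conjugated_drift:
  fixes v :: "real^'a^'a"
  assumes E: "E \<in> data_ball" and t: "0 \<le> t" "t \<le> T"
  defines "w \<equiv> \<Psi> E t ** v ** transpose (\<Psi> E t)"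
  shows "\<Psi> E t ** smooth_drift E t v ** transpose (\<Psi> E t) = ode_Q E t - w ** ode_S E t ** w"
proof -
  note inv = flow_inverse[OF E t]
  have invT: "transpose (\<Psi> E t) ** transpose (\<Phi> E t) = mat 1"
    using inv(2) by (simp flip: matrix_transpose_mul)
  have "w ** ode_S E t ** w = \<Psi> E t ** v ** (transpose (\<Psi> E t) ** transpose (\<Phi> E t)) ** transpose (dat_H E t)
     ** dat_R E t ** dat_H E t ** (\<Phi> E t ** \<Psi> E t) ** v ** transpose (\<Psi> E t)"
    by (simp add: w_def ode_S_def matrix_transpose_mul matrix_mul_assoc)
  also have "\<dots> = \<Psi> E t ** (v ** transpose (dat_H E t) ** dat_R E t ** dat_H E t ** v) ** transpose (\<Psi> E t)"
    unfolding inv invT by (simp add: matrix_mul_assoc)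
  finally show ?thesis
    by (simp add: smooth_drift_def ode_Q_def mm.diff_left mm.diff_right)
qed

lemma bmeas_ode:
  assumes "E \<in> data_ball"
  shows "bmeas T (ode_Q E)" "bmeas T (ode_S E)"
  unfolding ode_Q_def ode_S_def
  by (intro bmeas_bilinear[OF bounded_bilinear_matrix_mult] bmeas_linear[OF bounded_linear_transpose]
      bmeas_continuous[OF flow_continuous(1)] bmeas_continuous[OF flow_continuous(2)] assms
      admissible_holder[OF ball_admissible[OF assms] pos_T alpha(2)])+

lemma psd_ode:
  assumes "E \<in> data_ball" "0 \<le> t" "t \<le> T"
  shows "psd (ode_Q E t)" "psd (ode_S E t)"
proof -
  have "psd (dat_Q E t)" "psd (dat_R E t)"
    using ball_admissible[OF assms(1)] assms(2,3) by (auto simp: admissible_def)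
  then show "psd (ode_Q E t)" "psd (ode_S E t)"
    using psd_congruence[of "dat_Q E t" "transpose (\<Psi> E t)"] psd_congruence[of "dat_R E t" "dat_H E t ** \<Phi> E t"]
    by (simp_all add: ode_Q_def ode_S_def)
qed

text \<open>Every passage preserves o(t - s) in both directions, since conjugation with the bounded
  \<open>\<Psi>\<close> is undone by the bounded \<open>\<Phi>\<close>. The forward direction is
  used for uniqueness, the backward one for existence.\<close>

lemma solution_iff_ode:
  assumes E: "E \<in> data_ball" and v: "continuous_on {0..T} v"
  defines "w \<equiv> \<lambda>t. \<Psi> E t ** v t ** transpose (\<Psi> E t)"
  shows "riccati_solution T E v \<longleftrightarrow> v 0 = dat_v0 E \<and> prim T w (\<lambda>t. ode_Q E t - w t ** ode_S E t ** w t)"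
proof -
  note mb = bounded_bilinear_matrix_mult
  note vm = bmeas_continuous[OF v]
  note \<Psi>c = flow_continuous(2)[OF E] and \<Phi>c = flow_continuous(1)[OF E]
  note \<Psi>m = bmeas_continuous[OF \<Psi>c] and \<Phi>m = bmeas_continuous[OF \<Phi>c]
  have wm: "bmeas T w"
    unfolding w_def by (intro bmeas_bilinear[OF mb] bmeas_linear[OF bounded_linear_transpose] \<Psi>m vm)
  have fm: "bmeas T (\<lambda>t. ode_Q E t - w t ** ode_S E t ** w t)"
    by (intro bmeas_diff bmeas_bilinear[OF mb] bmeas_ode[OF E] wm)
  let ?Z = "\<lambda>s t. w t - w s - integral {s..t} (\<lambda>t. ode_Q E t - w t ** ode_S E t ** w t)"
  let ?X = "\<lambda>s t. \<Psi> E t ** flow_defect E v s t ** transpose (\<Psi> E t)"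
  have ZX: "small_o T (\<lambda>s t. ?Z s t - ?X s t)"
  proof (rule small_o_cong[OF conjugated_increment[OF E v]])
    fix s t assume st: "0 \<le> s" "s \<le> t" "t \<le> T"
    have "integral {s..t} (\<lambda>r. \<Psi> E r ** smooth_drift E r (v r) ** transpose (\<Psi> E r))
      = integral {s..t} (\<lambda>t. ode_Q E t - w t ** ode_S E t ** w t)"
      unfolding w_def using st by (intro Henstock_Kurzweil_Integration.integral_cong conjugated_drift E) auto
    then show "?Z s t - ?X s t = \<Psi> E t ** v t ** transpose (\<Psi> E t) - \<Psi> E s ** v s ** transpose (\<Psi> E s) -
        integral {s..t} (\<lambda>r. \<Psi> E r ** smooth_drift E r (v r) ** transpose (\<Psi> E r)) - ?X s t"
      by (simp add: w_def)
  qed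
  have "small_o T (riccati_remainder T E v) \<longleftrightarrow> small_o T (flow_defect E v)"
  proof
    assume "small_o T (riccati_remainder T E v)"
    from small_o_add[OF flow_defect_eq_remainder(1)[OF E v] this] show "small_o T (flow_defect E v)" by simp
  next
    assume "small_o T (flow_defect E v)"
    from small_o_diff[OF this flow_defect_eq_remainder(1)[OF E v]] show "small_o T (riccati_remainder T E v)" by simp
  qed
  also have "\<dots> \<longleftrightarrow> small_o T ?X"
  proof
    assume "small_o T (flow_defect E v)"
    then show "small_o T ?X"
      by (rule small_o_mm_left[OF small_o_mm_right[OF bounded3_bmeas(3)[OF \<Psi>m]]
            bounded3_transpose[OF bounded3_bmeas(3)[OF \<Psi>m]]])
  next
    assume "small_o T ?X"
    then have "small_o T (\<lambda>s t. \<Phi> E t ** ?X s t ** transpose (\<Phi> E t))"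
      by (rule small_o_mm_left[OF small_o_mm_right[OF bounded3_bmeas(3)[OF \<Phi>m]]
            bounded3_transpose[OF bounded3_bmeas(3)[OF \<Phi>m]]])
    then show "small_o T (flow_defect E v)"
    proof (rule small_o_cong)
      fix s t assume st: "0 \<le> s" "s \<le> t" "t \<le> T"
      then have inv: "\<Phi> E t ** \<Psi> E t = mat 1" using flow_inverse[OF E] by auto
      have "\<Phi> E t ** ?X s t ** transpose (\<Phi> E t)
        = (\<Phi> E t ** \<Psi> E t) ** flow_defect E v s t ** transpose (\<Phi> E t ** \<Psi> E t)"
        by (simp add: matrix_transpose_mul matrix_mul_assoc)
      then show "flow_defect E v s t = \<Phi> E t ** ?X s t ** transpose (\<Phi> E t)"
        by (simp add: inv)
    qed
  qed
  also have "\<dots> \<longleftrightarrow> small_o T ?Z"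
  proof
    assume "small_o T ?X" from small_o_add[OF ZX this] show "small_o T ?Z" by simp
  next
    assume "small_o T ?Z" from small_o_diff[OF this ZX] show "small_o T ?X" by simp
  qed
  also have "\<dots> \<longleftrightarrow> prim T w (\<lambda>t. ode_Q E t - w t ** ode_S E t ** w t)"
  proof
    assume "small_o T ?Z" then show "prim T w (\<lambda>t. ode_Q E t - w t ** ode_S E t ** w t)"
      by (rule primI_small_o[OF fm])
  next
    assume p: "prim T w (\<lambda>t. ode_Q E t - w t ** ode_S E t ** w t)"
    \<comment> \<open>Here the remainder vanishes identically, so it is bounded with constant 0 and
      any exponent above 1.\<close>
    show "small_o T ?Z"
      by (rule small_o_powr[of 2 _ _ 0]) (use primD[OF p] in auto)
  qed
  finally have *: "small_o T (riccati_remainder T E v) \<longleftrightarrow> prim T w (\<lambda>t. ode_Q E t - w t ** ode_S E t ** w t)" .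
  have "(\<lambda>r. riccati_drift T E r (v r)) absolutely_integrable_on {0..T}"
    by (rule bmeas_absolutely_integrable[OF flow_defect_eq_remainder(2)[OF E v]])
  with * v show ?thesis
    unfolding riccati_solution_def small_o_def by blast
qed

lemma ode_solution_exists:
  "\<exists>w. \<forall>E\<in>data_ball. w E 0 = dat_v0 E \<and> prim T (w E) (\<lambda>t. ode_Q E t - w E t ** ode_S E t ** w E t) \<and>
     (\<forall>t. 0 \<le> t \<and> t \<le> T \<longrightarrow> psd (w E t))"
proof -
  have "\<forall>E\<in>data_ball. \<exists>w. w 0 = dat_v0 E \<and> prim T w (\<lambda>t. ode_Q E t - w t ** ode_S E t ** w t) \<and>
     (\<forall>t. 0 \<le> t \<and> t \<le> T \<longrightarrow> psd (w t))"
  proof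
    fix E assume E: "E \<in> data_ball"
    have "psd (dat_v0 E)" using ball_admissible[OF E] by (simp add: admissible_def)
    then show "\<exists>w. w 0 = dat_v0 E \<and> prim T w (\<lambda>t. ode_Q E t - w t ** ode_S E t ** w t) \<and>
       (\<forall>t. 0 \<le> t \<and> t \<le> T \<longrightarrow> psd (w t))"
      by (intro riccati_ode_exists bmeas_ode[OF E] pos_T psd_ode[OF E])
  qed
  then show ?thesis by (rule bchoice)
qed

lemma lbd_ode: "lbd 0 (\<lambda>i s u t. ode_Q i t)" "lbd 0 (\<lambda>i s u t. ode_S i t)"
proof -
  note tr = lbd_bounded_linear[OF bounded_linear_transpose]
  have "lbd 0 (\<lambda>i s u t. \<Psi> i t ** dat_Q i t)" by (rule lbd_mm[OF lbd_flow(2) lbd_Q]) auto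
  from lbd_mm[OF this tr[OF lbd_flow(2)]] show "lbd 0 (\<lambda>i s u t. ode_Q i t)" by (simp add: ode_Q_def)
  have H: "lbd 0 (\<lambda>i s u t. dat_H i t ** \<Phi> i t)" by (rule lbd_mm[OF lbd_H lbd_flow(1)]) auto
  have "lbd 0 (\<lambda>i s u t. transpose (dat_H i t ** \<Phi> i t) ** dat_R i t)"
    by (rule lbd_mm[OF tr[OF H] lbd_R]) auto
  from lbd_mm[OF this H] show "lbd 0 (\<lambda>i s u t. ode_S i t)" by (simp add: ode_S_def)
qed

text \<open>\<open>riccati_ode_bound\<close> gives one bound for all members of the ball; after that
  \<open>riccati_ode_compare\<close> applies with constants that no longer depend on the pair of
  data.\<close>

lemma lbd_ode_solution:
  assumes w: "\<And>E. E \<in> data_ball \<Longrightarrow> w E 0 = dat_v0 E"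
    "\<And>E. E \<in> data_ball \<Longrightarrow> prim T (w E) (\<lambda>t. ode_Q E t - w E t ** ode_S E t ** w E t)"
    "\<And>E t. \<lbrakk>E \<in> data_ball; 0 \<le> t; t \<le> T\<rbrakk> \<Longrightarrow> psd (w E t)"
  shows "lbd 0 (\<lambda>E s u t. w E t)"
proof -
  obtain K1 where K1: "0 < K1" "\<And>i t. \<lbrakk>i \<in> data_ball; 0 \<le> t; t \<le> T\<rbrakk> \<Longrightarrow> norm (ode_Q i t) \<le> K1"
    "\<And>i j t. \<lbrakk>i \<in> data_ball; j \<in> data_ball; 0 \<le> t; t \<le> T\<rbrakk> \<Longrightarrow> norm (ode_Q i t - ode_Q j t) \<le> K1 * data_dist T \<alpha> i j"
    by (rule lbd_point_bound[OF lbd_ode(1)]) (rule that)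
  obtain K2 where K2: "0 < K2" "\<And>i t. \<lbrakk>i \<in> data_ball; 0 \<le> t; t \<le> T\<rbrakk> \<Longrightarrow> norm (ode_S i t) \<le> K2"
    "\<And>i j t. \<lbrakk>i \<in> data_ball; j \<in> data_ball; 0 \<le> t; t \<le> T\<rbrakk> \<Longrightarrow> norm (ode_S i t - ode_S j t) \<le> K2 * data_dist T \<alpha> i j"
    by (rule lbd_point_bound[OF lbd_ode(2)]) (rule that)
  obtain K3 where K3: "0 < K3" "\<And>i t. \<lbrakk>i \<in> data_ball; 0 \<le> t; t \<le> T\<rbrakk> \<Longrightarrow> norm (dat_v0 i) \<le> K3"
    "\<And>i j t. \<lbrakk>i \<in> data_ball; j \<in> data_ball; 0 \<le> t; t \<le> T\<rbrakk> \<Longrightarrow> norm (dat_v0 i - dat_v0 j) \<le> K3 * data_dist T \<alpha> i j"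
    by (rule lbd_point_bound[OF lbd_v0]) (rule that)
  \<comment> \<open>Sums in place of maxima: \<open>K\<close> dominates the constants of all three
    families, and \<open>B\<close> below dominates the solutions as well as
    \<open>ode_S\<close>.\<close>
  define K where "K = K1 + K2 + K3"
  have K: "0 < K" "K1 \<le> K" "K2 \<le> K" "K3 \<le> K" using K1 K2 K3 by (auto simp: K_def)
  define B where "B = real CARD('a) * (real CARD('a) * (K + K * T)) + K"
  have B0: "0 \<le> B" using K pos_T by (simp add: B_def)
  have bound: "norm (w E t) \<le> real CARD('a) * (real CARD('a) * (K + K * T))"
    if E: "E \<in> data_ball" and t: "0 \<le> t" "t \<le> T" for E t
  proof (rule riccati_ode_bound[OF w(2)[OF E] bmeas_ode(1)[OF E] w(3)[OF E] psd_ode(2)[OF E] _ _ t])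
    show "norm (w E 0) \<le> K" using K3(2)[OF E t] K w(1)[OF E] by simp
    show "norm (ode_Q E t) \<le> K" if "0 \<le> t" "t \<le> T" for t using K1(2)[OF E that] K by simp
  qed
  obtain C :: real where C: "C > 0" "\<And>(x::real^'a^'a) (y::real^'a^'a). norm (x ** y) \<le> norm x * norm y * C"
    using mm.pos_bounded by blast
  define L where "L = (K + (1 + B * B * C * C) * K * T) * exp (2 * (B * B * C * C) * T)"
  have L0: "0 \<le> L" using K B0 C pos_T by (simp add: L_def)
  show ?thesis
  proof (rule lbd_pointI[of "B + L"])
    show "0 \<le> B + L" using B0 L0 by simp
    fix E t assume *: "E \<in> data_ball" "0 \<le> t" "t \<le> T"
    show "norm (w E t) \<le> B + L" using bound[OF *] K L0 by (simp add: B_def)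
  next
    fix i j t assume i: "i \<in> data_ball" and j: "j \<in> data_ball" and t: "0 \<le> t" "t \<le> T"
    let ?d = "data_dist T \<alpha> i j"
    have d0: "0 \<le> ?d" using d_nonneg[OF i j] .
    have up: "k * ?d \<le> K * ?d" if "k \<le> K" for k using that d0 by (rule mult_right_mono)
    have "norm (w i t - w j t) \<le> (norm (w i 0 - w j 0) + (1 + B * B * C * C) * (K * ?d) * T) * exp (2 * (B * B * C * C) * T)"
    proof (rule riccati_ode_compare[OF _ C(2) w(2)[OF i] w(2)[OF j] _ _ t])
      fix t assume t: "0 \<le> t" "t \<le> T"
      show "norm (w i t) \<le> B \<and> norm (w j t) \<le> B \<and> norm (ode_S i t) \<le> B \<and> norm (ode_S j t) \<le> B"
      proof -
        have "0 \<le> real CARD('a) * (real CARD('a) * (K + K * T))" using K pos_T by simp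
        then show ?thesis
          using bound[OF i t] bound[OF j t] K2(2)[OF i t] K2(2)[OF j t] K unfolding B_def by linarith
      qed
      show "norm (ode_Q i t - ode_Q j t) \<le> K * ?d \<and> norm (ode_S i t - ode_S j t) \<le> K * ?d"
        using order_trans[OF K1(3)[OF i j t] up[OF K(2)]] order_trans[OF K2(3)[OF i j t] up[OF K(3)]] by simp
    qed (use C in simp)
    also have "\<dots> \<le> (K * ?d + (1 + B * B * C * C) * (K * ?d) * T) * exp (2 * (B * B * C * C) * T)"
      using order_trans[OF K3(3)[OF i j t] up[OF K(4)]] w(1)[OF i] w(1)[OF j]
      by (intro mult_right_mono add_right_mono) auto
    also have "\<dots> = L * ?d" by (simp add: L_def algebra_simps)
    also have "\<dots> \<le> (B + L) * ?d" using B0 d0 by (intro mult_right_mono) auto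
    finally show "norm (w i t - w j t) \<le> (B + L) * ?d" .
  qed
qed

text \<open>The Lipschitz bound is at first that of a single family \<open>V\<close>, built from the
  chosen flow and the chosen ordinary solutions. Since every rough solution coincides with
  \<open>V\<close> on \<open>[0, T]\<close>, it carries over to arbitrary solutions
  \<open>v1\<close> and \<open>v2\<close>.\<close>

lemma solution_exists_and_lipschitz:
  "(\<exists>v. riccati_solution T D v \<and> (\<forall>t\<in>{0..T}. psd (v t))) \<and>
   (\<exists>L\<ge>0. \<forall>E1\<in>data_ball. \<forall>E2\<in>data_ball. \<forall>v1 v2. riccati_solution T E1 v1 \<and> riccati_solution T E2 v2 \<longrightarrow>
     sup_norm T (\<lambda>t. v1 t - v2 t) \<le> L * data_dist T \<alpha> E1 E2)"
proof -
  note mb = bounded_bilinear_matrix_mult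
  obtain w where w: "\<And>E. E \<in> data_ball \<Longrightarrow> w E 0 = dat_v0 E"
    "\<And>E. E \<in> data_ball \<Longrightarrow> prim T (w E) (\<lambda>t. ode_Q E t - w E t ** ode_S E t ** w E t)"
    "\<And>E t. \<lbrakk>E \<in> data_ball; 0 \<le> t; t \<le> T\<rbrakk> \<Longrightarrow> psd (w E t)"
    using ode_solution_exists by blast
  define V where "V E t = \<Phi> E t ** w E t ** transpose (\<Phi> E t)" for E t
  have Vc: "continuous_on {0..T} (V E)" if "E \<in> data_ball" for E
    unfolding V_def using that
    by (intro bounded_bilinear.continuous_on[OF mb] bounded_linear.continuous_on[OF bounded_linear_transpose]
        flow_continuous(1) prim_continuous[OF w(2)])
  have \<Psi>V: "\<Psi> E t ** V E t ** transpose (\<Psi> E t) = w E t" if "E \<in> data_ball" "0 \<le> t" "t \<le> T" for E t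
  proof -
    have "\<Psi> E t ** V E t ** transpose (\<Psi> E t) = (\<Psi> E t ** \<Phi> E t) ** w E t ** transpose (\<Psi> E t ** \<Phi> E t)"
      by (simp add: V_def matrix_transpose_mul matrix_mul_assoc)
    then show ?thesis using flow_inverse[OF that] by simp
  qed
  \<comment> \<open>The flows are known to be inverse to each other on \<open>[0, T]\<close> only,
    so the conjugated path agrees with \<open>w E\<close> there and not as a function.\<close>
  have prim_cong: "prim T f f'" if "prim T g g'" "\<And>t. \<lbrakk>0 \<le> t; t \<le> T\<rbrakk> \<Longrightarrow> f t = g t" "bmeas T f'"
    "\<And>t. \<lbrakk>0 \<le> t; t \<le> T\<rbrakk> \<Longrightarrow> f' t = g' t" for f f' g g' :: "real \<Rightarrow> real^'a^'a"
    unfolding prim_def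
  proof (intro conjI allI impI that(3))
    fix s t assume st: "0 \<le> s \<and> s \<le> t \<and> t \<le> T"
    have "integral {s..t} f' = integral {s..t} g'"
      using st that(4) by (intro Henstock_Kurzweil_Integration.integral_cong) auto
    then show "f t - f s = integral {s..t} f'"
      using primD[OF that(1), of s t] that(2)[of s] that(2)[of t] st by simp
  qed
  have V_sol: "riccati_solution T E (V E)" if E: "E \<in> data_ball" for E
    unfolding solution_iff_ode[OF E Vc[OF E]]
  proof
    show "V E 0 = dat_v0 E" by (simp add: V_def flow_0(1)[OF E] w(1)[OF E])
    have c: "continuous_on {0..T} (\<lambda>t. \<Psi> E t ** V E t ** transpose (\<Psi> E t))"
      by (intro bounded_bilinear.continuous_on[OF mb] bounded_linear.continuous_on[OF bounded_linear_transpose]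
          flow_continuous(2) E Vc)
    show "prim T (\<lambda>t. \<Psi> E t ** V E t ** transpose (\<Psi> E t)) (\<lambda>t. ode_Q E t -
        \<Psi> E t ** V E t ** transpose (\<Psi> E t) ** ode_S E t ** (\<Psi> E t ** V E t ** transpose (\<Psi> E t)))"
      by (rule prim_cong[OF w(2)[OF E]])
        (intro bmeas_diff bmeas_bilinear[OF mb, of _ "\<lambda>t. \<Psi> E t ** V E t ** transpose (\<Psi> E t) ** ode_S E t"]
          bmeas_bilinear[OF mb, of _ "\<lambda>t. \<Psi> E t ** V E t ** transpose (\<Psi> E t)"] bmeas_ode[OF E]
          bmeas_continuous[OF c] | simp add: \<Psi>V E)+
  qed
  have V_unique: "v t = V E t" if E: "E \<in> data_ball" and v: "riccati_solution T E v" and t: "0 \<le> t" "t \<le> T" for E v t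
  proof -
    have vc: "continuous_on {0..T} v" using v by (simp add: riccati_solution_def)
    define z where "z t = \<Psi> E t ** v t ** transpose (\<Psi> E t)" for t
    have z: "v 0 = dat_v0 E" "prim T z (\<lambda>t. ode_Q E t - z t ** ode_S E t ** z t)"
      using v unfolding solution_iff_ode[OF E vc] z_def by auto
    have "z 0 = w E 0" by (simp add: z_def z(1) flow_0(2)[OF E] w(1)[OF E])
    then have zw: "z t = w E t"
      by (intro riccati_ode_unique[OF z(2) w(2)[OF E] bmeas_ode(2)[OF E] _ t])
    have "V E t = (\<Phi> E t ** \<Psi> E t) ** v t ** transpose (\<Phi> E t ** \<Psi> E t)"
      by (simp add: V_def zw[symmetric] z_def matrix_transpose_mul matrix_mul_assoc)
    then show ?thesis using flow_inverse[OF E t] by simp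
  qed
  have V_psd: "psd (V E t)" if "E \<in> data_ball" "0 \<le> t" "t \<le> T" for E t
    using psd_congruence[OF w(3)[OF that], of "transpose (\<Phi> E t)"] by (simp add: V_def)
  have "lbd 0 (\<lambda>E s u t. \<Phi> E t ** w E t)"
    by (rule lbd_mm[OF lbd_flow(1) lbd_ode_solution[OF w]]) auto
  from lbd_mm[OF this lbd_bounded_linear[OF bounded_linear_transpose lbd_flow(1)]]
  have "lbd 0 (\<lambda>E s u t. V E t)" by (simp add: V_def)
  then obtain L where L: "0 < L" "\<And>i t. \<lbrakk>i \<in> data_ball; 0 \<le> t; t \<le> T\<rbrakk> \<Longrightarrow> norm (V i t) \<le> L"
    "\<And>i j t. \<lbrakk>i \<in> data_ball; j \<in> data_ball; 0 \<le> t; t \<le> T\<rbrakk> \<Longrightarrow> norm (V i t - V j t) \<le> L * data_dist T \<alpha> i j"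
    by (rule lbd_point_bound) (rule that)
  have "sup_norm T (\<lambda>t. v1 t - v2 t) \<le> L * data_dist T \<alpha> E1 E2"
    if "E1 \<in> data_ball" "E2 \<in> data_ball" "riccati_solution T E1 v1" "riccati_solution T E2 v2" for E1 E2 v1 v2
    unfolding sup_norm_def
  proof (rule cSUP_least)
    fix t assume "t \<in> {0..T}"
    then show "norm (v1 t - v2 t) \<le> L * data_dist T \<alpha> E1 E2"
      using V_unique[OF that(1,3), of t] V_unique[OF that(2,4), of t] L(3)[OF that(1,2), of t] by simp
  qed (use pos_T in simp)
  moreover have "riccati_solution T D (V D)" "\<forall>t\<in>{0..T}. psd (V D t)"
    using V_sol[OF D_in_ball] V_psd[OF D_in_ball] by auto
  ultimately show ?thesis using L(1) by (meson less_imp_le)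
qed

end

theorem theorem4p2:
  fixes T \<alpha> :: real
    and D :: "('x::finite, 'y::finite) riccati_data"
  assumes "0 < T" and "1/3 < \<alpha>" and "\<alpha> \<le> 1/2"
    and "admissible T \<alpha> D"
  shows "(\<exists>v. riccati_solution T D v \<and> (\<forall>t\<in>{0..T}. psd (v t))) \<and>
    (\<forall>r>0. \<exists>L\<ge>0. \<forall>D1 D2 :: ('x, 'y) riccati_data. \<forall>v1 v2.
       admissible T \<alpha> D1 \<and> data_dist T \<alpha> D D1 \<le> r \<and> riccati_solution T D1 v1 \<and>
       admissible T \<alpha> D2 \<and> data_dist T \<alpha> D D2 \<le> r \<and> riccati_solution T D2 v2 \<longrightarrow>
       sup_norm T (\<lambda>t. v1 t - v2 t) \<le> L * data_dist T \<alpha> D1 D2)"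
proof -
  \<comment> \<open>The ball depends on \<open>r\<close>, and with it the flows, which are chosen
    for all its members together; they are obtained anew for each radius.\<close>
  have main: "(\<exists>v. riccati_solution T D v \<and> (\<forall>t\<in>{0..T}. psd (v t))) \<and>
   (\<exists>L\<ge>0. \<forall>E1\<in>riccati_family.data_ball T \<alpha> r D. \<forall>E2\<in>riccati_family.data_ball T \<alpha> r D. \<forall>v1 v2.
     riccati_solution T E1 v1 \<and> riccati_solution T E2 v2 \<longrightarrow>
     sup_norm T (\<lambda>t. v1 t - v2 t) \<le> L * data_dist T \<alpha> E1 E2)" if "0 < r" for r
  proof -
    interpret riccati_family T \<alpha> r D
      by unfold_locales (use assms that in auto)
    obtain \<Phi> where \<Phi>: "\<forall>i\<in>data_ball. \<Phi> i 0 = mat 1" "lbd 0 (\<lambda>i s u t. \<Phi> i t)"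
      "lbd (3 * \<alpha>) (\<lambda>i s u t. \<Phi> i t - (mat 1 + step i s t) ** \<Phi> i s)"
      using flow_exists by blast
    obtain \<Psi> where \<Psi>: "\<forall>i\<in>data_ball. \<Psi> i 0 = mat 1" "lbd 0 (\<lambda>i s u t. \<Psi> i t)"
      "lbd (3 * \<alpha>) (\<lambda>i s u t. \<Psi> i t - \<Psi> i s ** (mat 1 - step i s t + step i s t ** step i s t))"
      using inverse_flow_exists by blast
    interpret riccati_flow T \<alpha> r D \<Phi> \<Psi>
      by unfold_locales (use \<Phi> \<Psi> in auto)
    show ?thesis by (rule solution_exists_and_lipschitz)
  qed
  show ?thesis
  proof (intro conjI allI impI)
    \<comment> \<open>Existence does not involve the radius, so any positive one will do.\<close>
    show "\<exists>v. riccati_solution T D v \<and> (\<forall>t\<in>{0..T}. psd (v t))"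
      using main[of 1] by simp
  next
    fix r :: real assume r: "0 < r"
    interpret riccati_family T \<alpha> r D
      by unfold_locales (use assms r in auto)
    show "\<exists>L\<ge>0. \<forall>D1 D2 :: ('x, 'y) riccati_data. \<forall>v1 v2.
       admissible T \<alpha> D1 \<and> data_dist T \<alpha> D D1 \<le> r \<and> riccati_solution T D1 v1 \<and>
       admissible T \<alpha> D2 \<and> data_dist T \<alpha> D D2 \<le> r \<and> riccati_solution T D2 v2 \<longrightarrow>
       sup_norm T (\<lambda>t. v1 t - v2 t) \<le> L * data_dist T \<alpha> D1 D2"
      using main[OF r] unfolding data_ball_def by blast
  qed
qed

end
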